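(* Let $n\ge 2$, let $\Omega\subset\mathbb{R}^n$ be an open set, let $p\in(1,\infty)$, $p'=\frac{p}{p-1}$, and $s\in(0,1)$. Let $(F^k)_k\subset L^p(\mathbb{R}^n;\mathbb{R}^n)$, $F^\infty\in L^p(\mathbb{R}^n;\mathbb{R}^n)$, $(w^k)_k\subset H^{s,p'}(\mathbb{R}^n)$, and $w^\infty\in H^{s,p'}(\mathbb{R}^n)$ satisfy, as $k\to\infty$, \begin{align*} &F^k\to F^\infty &&\text{weakly in } L^p(\mathbb{R}^n;\mathbb{R}^n),\\ &\nabla^s w^k\to\nabla^s w^\infty &&\text{weakly in } L^{p'}_{\rm loc}(\Omega;\mathbb{R}^n). \end{align*} Assume that, as $k\to\infty$, \begin{align*} &\operatorname{div}^s F^k\to\operatorname{div}^s F^\infty &&\text{strongly in } H^{-s,p}_{\rm loc}(\Omega),\\ &w^k\to w^\infty &&\text{strongly in } L^{p'}(\mathbb{R}^n). \end{align*} Then, as $k\to\infty$, $$F^k\cdot\nabla^s w^k\to F^\infty\cdot\nabla^s w^\infty\quad\text{weakly* in } \mathcal{D}'(\Omega),$$ that is, $\int_\Omega \varphi\,F^k\cdot\nabla^s w^k\,{\rm d}x\to\int_\Omega\varphi\,F^\infty\cdot\nabla^s w^\infty\,{\rm d}x$ for every $\varphi\in C_c^\infty(\Omega)$.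
   Context: Notation. For open sets $A,B\subseteq\mathbb{R}^n$, $A\Subset B$ means that there is a compact set $K$ with $A\subset K\subset B$. $\mathcal{D}'(\Omega)$ is the space of distributions on $\Omega$. Riesz fractional gradient. Set $\mu_{n,s}=\frac{2^s\Gamma(\frac{n+s+1}{2})}{\pi^{n/2}\Gamma(\frac{1-s}{2})}$, with $\Gamma$ the Gamma function. For $\psi\in C_c^\infty(\mathbb{R}^n)$, $$\nabla^s\psi(x)=\mu_{n,s}\int_{\mathbb{R}^n}\frac{(\psi(y)-\psi(x))(y-x)}{|y-x|^{n+s+1}}\,{\rm d}y\in\mathbb{R}^n,\qquad x\in\mathbb{R}^n$$ (the integral converges for every $x$). Fractional Sobolev spaces. For $q\in(1,\infty)$ with conjugate exponent $q'=\frac{q}{q-1}$, and $\psi\in C_c^\infty(\mathbb{R}^n)$, let $\|\psi\|_{H^{s,q}(\mathbb{R}^n)}=(\|\psi\|_{L^q(\mathbb{R}^n)}^q+\|\nabla^s\psi\|^q_{L^q(\mathbb{R}^n;\mathbb{R}^n)})^{1/q}$. For an open set $U\subseteq\mathbb{R}^n$, $H^{s,q}_0(U)$ is the closure (completion, realized inside $L^q(\mathbb{R}^n)$) of $C_c^\infty(U)$ in this norm; $H^{s,q}(\mathbb{R}^n)=H^{s,q}_0(\mathbb{R}^n)$; and $H^{-s,q}(U)=(H^{s,q'}_0(U))'$ is the dual space. The operator $\nabla^s$ is extended by continuity to a bounded operator $H^{s,q}(\mathbb{R}^n)\to L^q(\mathbb{R}^n;\mathbb{R}^n)$. The local space is $$H^{-s,q}_{\rm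 loc}(\Omega)=\{f\in\mathcal{D}'(\Omega): f\in H^{-s,q}(\Omega')\text{ for all open sets }\Omega'\Subset\Omega\}.$$ Fractional divergence. For $F\in L^p(\mathbb{R}^n;\mathbb{R}^n)$, $\operatorname{div}^sF\in H^{-s,p}_{\rm loc}(\Omega)$ is defined, for every bounded open set $\Omega'\Subset\Omega$, by $$\langle\operatorname{div}^sF,v\rangle_{H^{-s,p}(\Omega')\times H^{s,p'}_0(\Omega')}=-\int_{\mathbb{R}^n}F\cdot\nabla^sv\,{\rm d}x\quad\text{for all }v\in H^{s,p'}_0(\Omega').$$ Local convergence. Weak convergence in $L^{p'}_{\rm loc}(\Omega;\mathbb{R}^n)$ means weak convergence in $L^{p'}(\Omega';\mathbb{R}^n)$ for every open $\Omega'\Subset\Omega$; strong convergence in $H^{-s,p}_{\rm loc}(\Omega)$ means norm convergence in $H^{-s,p}(\Omega')$ for every open $\Omega'\Subset\Omega$. *)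

theory Defs
  imports "HOL-Analysis.Analysis"
begin

section \<open>Compact containment and test functions\<close>

definition compactly_contained :: "'a::topological_space set \<Rightarrow> 'a set \<Rightarrow> bool" where
  "compactly_contained A B \<longleftrightarrow> (\<exists>K. compact K \<and> A \<subseteq> K \<and> K \<subseteq> B)"

text \<open>For \<open>Suc k\<close>, continuity of \<open>f\<close> itself follows from its differentiability.\<close>

primrec Ck :: "nat \<Rightarrow> (real^'n \<Rightarrow> real) \<Rightarrow> bool" where
  "Ck 0 f \<longleftrightarrow> continuous_on UNIV f"
| "Ck (Suc k) f \<longleftrightarrow>
     (\<forall>x. f differentiable (at x)) \<and> (\<forall>i. Ck k (\<lambda>x. frechet_derivative f (at x) (axis i 1)))"

definition test_functions :: "(real^'n) set \<Rightarrow> (real^'n \<Rightarrow> real) set" where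
  "test_functions U =
     {\<psi>. (\<forall>k. Ck k \<psi>) \<and> compact (closure {x. \<psi> x \<noteq> 0}) \<and> closure {x. \<psi> x \<noteq> 0} \<subseteq> U}"

section \<open>Lebesgue spaces\<close>

text \<open>
  Elements of \<open>L^p\<close> are represented by functions. \<open>L^p(U)\<close> is \<open>Lp p (lebesgue_on U)\<close>, and
  \<open>L^p(R^n)\<close> is \<open>Lp p lebesgue\<close>.
\<close>

definition Lp :: "real \<Rightarrow> 'a measure \<Rightarrow> ('a \<Rightarrow> 'b::euclidean_space) set" where
  "Lp p M = {f \<in> borel_measurable M. integrable M (\<lambda>x. norm (f x) powr p)}"

definition Lp_norm :: "real \<Rightarrow> 'a measure \<Rightarrow> ('a \<Rightarrow> 'b::euclidean_space) \<Rightarrow> real" where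
  "Lp_norm p M f = (LINT x|M. norm (f x) powr p) powr (1 / p)"

definition Lp_tendsto ::
  "real \<Rightarrow> 'a measure \<Rightarrow> (nat \<Rightarrow> 'a \<Rightarrow> 'b::euclidean_space) \<Rightarrow> ('a \<Rightarrow> 'b) \<Rightarrow> bool" where
  "Lp_tendsto p M f g \<longleftrightarrow> (\<forall>k. f k \<in> Lp p M) \<and> g \<in> Lp p M \<and>
     (\<lambda>k. Lp_norm p M (\<lambda>x. f k x - g x)) \<longlonglongrightarrow> 0"

definition conj_exp :: "real \<Rightarrow> real" where
  "conj_exp p = p / (p - 1)"

definition weak_Lp_tendsto ::
  "real \<Rightarrow> 'a measure \<Rightarrow> (nat \<Rightarrow> 'a \<Rightarrow> 'b::euclidean_space) \<Rightarrow> ('a \<Rightarrow> 'b) \<Rightarrow> bool" where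
  "weak_Lp_tendsto p M f g \<longleftrightarrow> (\<forall>k. f k \<in> Lp p M) \<and> g \<in> Lp p M \<and>
     (\<forall>h \<in> Lp (conj_exp p) M. (\<lambda>k. LINT x|M. f k x \<bullet> h x) \<longlonglongrightarrow> (LINT x|M. g x \<bullet> h x))"

definition weak_Lp_loc_tendsto ::
  "real \<Rightarrow> (real^'n) set \<Rightarrow> (nat \<Rightarrow> real^'n \<Rightarrow> 'b::euclidean_space) \<Rightarrow> (real^'n \<Rightarrow> 'b) \<Rightarrow> bool" where
  "weak_Lp_loc_tendsto p \<Omega> f g \<longleftrightarrow>
     (\<forall>U. open U \<and> compactly_contained U \<Omega> \<longrightarrow> weak_Lp_tendsto p (lebesgue_on U) f g)"

section \<open>Riesz fractional gradient and fractional Sobolev spaces\<close>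

definition riesz_const :: "nat \<Rightarrow> real \<Rightarrow> real" where
  "riesz_const n s =
     2 powr s * Gamma ((real n + s + 1) / 2) / (pi powr (real n / 2) * Gamma ((1 - s) / 2))"

text \<open>At \<open>y = x\<close> the integrand is 0, by division by zero.\<close>

definition riesz_grad :: "real \<Rightarrow> (real^'n \<Rightarrow> real) \<Rightarrow> real^'n \<Rightarrow> real^'n" where
  "riesz_grad s \<psi> x = riesz_const CARD('n) s *\<^sub>R
     (LINT y|lebesgue. ((\<psi> y - \<psi> x) / norm (y - x) powr (real CARD('n) + s + 1)) *\<^sub>R (y - x))"

text \<open>
  The norm of \<open>H^{s,q}\<close> is the \<open>L^q\<close> product norm of the pair of \<open>\<psi>\<close> and its fractional gradient.
  The completion of \<open>C_c^\<infinity>(U)\<close> is therefore the closure in \<open>L^q \<times> L^q\<close> of the graph of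
  \<open>riesz_grad s\<close> on \<open>C_c^\<infinity>(U)\<close>. The operator is closable, so the first component determines the
  second one up to null sets; this realizes the completion inside \<open>L^q\<close>, and the second component
  is the extension of the gradient by continuity.
\<close>

definition has_frac_grad ::
  "real \<Rightarrow> real \<Rightarrow> (real^'n) set \<Rightarrow> (real^'n \<Rightarrow> real) \<Rightarrow> (real^'n \<Rightarrow> real^'n) \<Rightarrow> bool" where
  "has_frac_grad s q U v G \<longleftrightarrow>
     (\<exists>\<psi>. (\<forall>k::nat. \<psi> k \<in> test_functions U) \<and>
        Lp_tendsto q lebesgue \<psi> v \<and> Lp_tendsto q lebesgue (\<lambda>k. riesz_grad s (\<psi> k)) G)"

definition Hs0 :: "real \<Rightarrow> real \<Rightarrow> (real^'n) set \<Rightarrow> (real^'n \<Rightarrow> real) set" where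
  "Hs0 s q U = {v. \<exists>G. has_frac_grad s q U v G}"

abbreviation Hs :: "real \<Rightarrow> real \<Rightarrow> (real^'n \<Rightarrow> real) set" where
  "Hs s q \<equiv> Hs0 s q UNIV"

text \<open>A representative of the extended gradient, determined up to null sets on \<open>Hs s q\<close>.\<close>

definition frac_grad :: "real \<Rightarrow> real \<Rightarrow> (real^'n \<Rightarrow> real) \<Rightarrow> real^'n \<Rightarrow> real^'n" where
  "frac_grad s q v = (SOME G. has_frac_grad s q UNIV v G)"

definition Hs_norm :: "real \<Rightarrow> real \<Rightarrow> (real^'n \<Rightarrow> real) \<Rightarrow> real" where
  "Hs_norm s q v =
     (Lp_norm q lebesgue v powr q + Lp_norm q lebesgue (frac_grad s q v) powr q) powr (1 / q)"

section \<open>Dual spaces and fractional divergence\<close>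

text \<open>
  \<open>H^{-s,p}(U)\<close> is the dual of \<open>Hs0 s (conj_exp p) U\<close>. A functional is a function on all of
  \<open>real^'n \<Rightarrow> real\<close> of which only the values on \<open>Hs0 s (conj_exp p) U\<close> matter, so the same
  functional can be restricted to every such \<open>U\<close>.
\<close>

definition Hneg :: "real \<Rightarrow> real \<Rightarrow> (real^'n) set \<Rightarrow> ((real^'n \<Rightarrow> real) \<Rightarrow> real) set" where
  "Hneg s p U = {T.
     (\<forall>u \<in> Hs0 s (conj_exp p) U. \<forall>v \<in> Hs0 s (conj_exp p) U. T (\<lambda>x. u x + v x) = T u + T v) \<and>
     (\<forall>c. \<forall>v \<in> Hs0 s (conj_exp p) U. T (\<lambda>x. c * v x) = c * T v) \<and>
     (\<exists>C. \<forall>v \<in> Hs0 s (conj_exp p) U. \<bar>T v\<bar> \<le> C * Hs_norm s (conj_exp p) v)}"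

definition Hneg_norm :: "real \<Rightarrow> real \<Rightarrow> (real^'n) set \<Rightarrow> ((real^'n \<Rightarrow> real) \<Rightarrow> real) \<Rightarrow> ennreal" where
  "Hneg_norm s p U T =
     (SUP v \<in> {v \<in> Hs0 s (conj_exp p) U. Hs_norm s (conj_exp p) v \<le> 1}. ennreal \<bar>T v\<bar>)"

definition Hneg_loc_tendsto ::
  "real \<Rightarrow> real \<Rightarrow> (real^'n) set \<Rightarrow> (nat \<Rightarrow> (real^'n \<Rightarrow> real) \<Rightarrow> real) \<Rightarrow>
   ((real^'n \<Rightarrow> real) \<Rightarrow> real) \<Rightarrow> bool" where
  "Hneg_loc_tendsto s p \<Omega> T S \<longleftrightarrow>
     (\<forall>U. open U \<and> compactly_contained U \<Omega> \<longrightarrow>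
        (\<forall>k. T k \<in> Hneg s p U) \<and> S \<in> Hneg s p U \<and>
        (\<lambda>k. Hneg_norm s p U (\<lambda>v. T k v - S v)) \<longlonglongrightarrow> 0)"

definition frac_div :: "real \<Rightarrow> real \<Rightarrow> (real^'n \<Rightarrow> real^'n) \<Rightarrow> (real^'n \<Rightarrow> real) \<Rightarrow> real" where
  "frac_div s p F v = - (LINT x|lebesgue. F x \<bullet> frac_grad s (conj_exp p) v x)"

end

theory Submission
  imports Defs
begin

text \<open>
  The gradient satisfies the Leibniz rule
  \<open>\<nabla>\<^sup>s(\<phi> w) = \<phi> \<nabla>\<^sup>s w + R w\<close>, where the commutator \<open>R\<close> is the integral operator with kernel
  \<open>(\<phi>(y) - \<phi>(x)) (y - x) / |y - x|^{n+s+1}\<close>. This kernel is dominated by an integrable function of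
  \<open>y - x\<close>, so by the Schur test \<open>R\<close> is bounded on \<open>L^q\<close> and maps the strongly convergent sequence
  \<open>w\<^sup>k\<close> to a strongly convergent one; no compactness is needed. Hence
  \<open>\<integral>\<phi> F\<^sup>k \<bullet> \<nabla>\<^sup>s w\<^sup>k = - \<langle>div\<^sup>s F\<^sup>k, \<phi> w\<^sup>k\<rangle> - \<integral>F\<^sup>k \<bullet> R w\<^sup>k\<close>. In the last term a weakly convergent sequence
  meets a strongly convergent one. In the first, \<open>\<phi> w\<^sup>k\<close> is bounded in \<open>H^{s,q}\<close> by the uniform
  boundedness principle, so \<open>div\<^sup>s F\<^sup>k\<close> may be replaced by \<open>div\<^sup>s F\<^sup>\<infinity>\<close>, and what remains is linear in \<open>w\<^sup>k\<close>.
\<close>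

section \<open>Lebesgue spaces\<close>

text \<open>Two difficulties shape the proof. The operator is nonlocal: even at points of the
  support of \<open>\<phi>\<close> the commutator sees w on all of R^n. This is where strong
  convergence of w^k on the whole space is used, while gradients and divergences are controlled only
  locally. Locality returns through \<open>\<phi>\<close> w^k, which is a limit of test functions
  supported in an open set U between the support of \<open>\<phi>\<close> and
  \<open>\<Omega>\<close>. Moreover, \<open>frac_grad\<close> is an arbitrary choice of
  representative, so pairings with it can be computed only after uniqueness up to null sets is
  known. This closability follows from integration by parts and the fundamental lemma. Both are
  carried out for Lipschitz functions with compact support: this class contains the smooth test
  functions, is closed under products, and contains truncated distance functions, which approximate
  indicators of open sets without any mollification. The range of s enters through the integrability
  of min(1,|z|) / |z|^(n+s): s < 1 serves the origin and s > 0 serves infinity.\<close>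

lemma conj_exp_gt_1: "1 < p \<Longrightarrow> 1 < conj_exp p"
  by (simp add: conj_exp_def)

lemma inverse_conj_exp: "1 < p \<Longrightarrow> 1 / p + 1 / conj_exp p = 1"
  by (simp add: conj_exp_def field_simps)

lemma conj_exp_conj_exp: "1 < p \<Longrightarrow> conj_exp (conj_exp p) = p"
  by (simp add: conj_exp_def field_simps)

lemma LpD:
  assumes "f \<in> Lp p M"
  shows "f \<in> borel_measurable M" "integrable M (\<lambda>x. norm (f x) powr p)"
  using assms by (auto simp: Lp_def)

lemma Lp_norm_nonneg: "0 \<le> Lp_norm p M f"
  by (simp add: Lp_norm_def)

lemma Lp_norm_powr:
  assumes "p \<noteq> 0" shows "Lp_norm p M f powr p = (LINT x|M. norm (f x) powr p)"
  using assms by (simp add: Lp_norm_def powr_powr)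

lemma Lp_bound_AE:
  assumes f: "f \<in> Lp p M" and g[measurable]: "g \<in> borel_measurable M" and "0 \<le> C" "0 < p"
    and le: "AE x in M. norm (g x) \<le> C * norm (f x)"
  shows "g \<in> Lp p M" and "Lp_norm p M g \<le> C * Lp_norm p M f"
proof -
  note [measurable] = LpD(1)[OF f]
  have le': "AE x in M. norm (g x) powr p \<le> C powr p * norm (f x) powr p"
    using le by eventually_elim
      (metis assms(3) assms(4) less_imp_le norm_ge_zero powr_mono2 powr_mult)
  have int: "integrable M (\<lambda>x. C powr p * norm (f x) powr p)"
    using LpD(2)[OF f] by simp
  have int': "integrable M (\<lambda>x. norm (g x) powr p)"
    by (rule Bochner_Integration.integrable_bound[OF int]) (use le' in auto)
  then show "g \<in> Lp p M" by (simp add: Lp_def)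
  have "(LINT x|M. norm (g x) powr p) \<le> C powr p * (LINT x|M. norm (f x) powr p)"
    using integral_mono_AE[OF int' int le'] by simp
  then have "Lp_norm p M g \<le> (C powr p * (LINT x|M. norm (f x) powr p)) powr (1/p)"
    unfolding Lp_norm_def using \<open>0 < p\<close> by (intro powr_mono2) auto
  also have "\<dots> = C * Lp_norm p M f"
    using assms by (simp add: Lp_norm_def powr_mult powr_powr)
  finally show "Lp_norm p M g \<le> C * Lp_norm p M f" .
qed

lemma Lp_bound:
  assumes "f \<in> Lp p M" "g \<in> borel_measurable M" "0 \<le> C" "0 < p"
    and "\<And>x. norm (g x) \<le> C * norm (f x)"
  shows "g \<in> Lp p M" and "Lp_norm p M g \<le> C * Lp_norm p M f"
  using Lp_bound_AE[OF assms(1-4)] assms(5) by auto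

lemma Lp_scaleR:
  assumes f: "f \<in> Lp p M" and "0 < p"
  shows "(\<lambda>x. c *\<^sub>R f x) \<in> Lp p M" "Lp_norm p M (\<lambda>x. c *\<^sub>R f x) = \<bar>c\<bar> * Lp_norm p M f"
proof -
  note [measurable] = LpD(1)[OF f]
  show "(\<lambda>x. c *\<^sub>R f x) \<in> Lp p M"
    by (rule Lp_bound(1)[OF f, where C="\<bar>c\<bar>"]) (use assms in auto)
  show "Lp_norm p M (\<lambda>x. c *\<^sub>R f x) = \<bar>c\<bar> * Lp_norm p M f"
    using \<open>0 < p\<close> by (simp add: Lp_norm_def powr_mult powr_powr)
qed

text \<open>A quasi-triangle inequality suffices, since norms occur only in bounds and in null
  sequences. The 4 is 2 from |a + b| \<le> 2 max(|a|, |b|), times 2 as a bound for 2^(1/p).\<close>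

lemma Lp_add:
  assumes f: "f \<in> Lp p M" and g: "g \<in> Lp p M" and p: "1 < p"
  shows "(\<lambda>x. f x + g x) \<in> Lp p M"
    and "Lp_norm p M (\<lambda>x. f x + g x) \<le> 4 * (Lp_norm p M f + Lp_norm p M g)"
proof -
  note [measurable] = LpD(1)[OF f] LpD(1)[OF g]
  let ?I = "\<lambda>f. LINT x|M. norm (f x) powr p"
  have le: "norm (f x + g x) powr p \<le> 2 powr p * (norm (f x) powr p + norm (g x) powr p)" for x
  proof -
    have "norm (f x + g x) \<le> 2 * max (norm (f x)) (norm (g x))"
      using norm_triangle_ineq[of "f x" "g x"] by linarith
    then have "norm (f x + g x) powr p \<le> (2 * max (norm (f x)) (norm (g x))) powr p"
      using p by (intro powr_mono2) auto
    also have "\<dots> = 2 powr p * max (norm (f x)) (norm (g x)) powr p"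
      by (simp add: powr_mult)
    also have "\<dots> \<le> 2 powr p * (norm (f x) powr p + norm (g x) powr p)"
      by (auto simp: max_def)
    finally show ?thesis .
  qed
  have int: "integrable M (\<lambda>x. 2 powr p * (norm (f x) powr p + norm (g x) powr p))"
    using LpD(2)[OF f] LpD(2)[OF g] by simp
  have int': "integrable M (\<lambda>x. norm (f x + g x) powr p)"
    by (rule Bochner_Integration.integrable_bound[OF int]) (use le in auto)
  then show "(\<lambda>x. f x + g x) \<in> Lp p M" by (simp add: Lp_def)
  \<comment> \<open>Bounding the sum of the two integrals by twice their maximum lets the p-th root
    fall on a single norm.\<close>
  define m where "m = max (?I f) (?I g)"
  have nn: "0 \<le> ?I f" "0 \<le> ?I g" by auto
  have "?I (\<lambda>x. f x + g x) \<le> 2 powr p * (?I f + ?I g)"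
    using integral_mono[OF int' int le] LpD(2)[OF f] LpD(2)[OF g] by simp
  also have "\<dots> \<le> 2 powr p * (2 * m)"
    by (intro mult_left_mono) (auto simp: m_def)
  finally have "Lp_norm p M (\<lambda>x. f x + g x) \<le> (2 powr p * (2 * m)) powr (1/p)"
    unfolding Lp_norm_def using p by (intro powr_mono2) auto
  also have "\<dots> = 2 * 2 powr (1/p) * m powr (1/p)"
    using p nn by (simp add: powr_mult powr_powr m_def)
  also have "\<dots> \<le> 2 * 2 * m powr (1/p)"
    using p powr_mono[of "1/p" 1 "2::real"] by (intro mult_mono) auto
  also have "m powr (1/p) \<le> Lp_norm p M f + Lp_norm p M g"
    by (auto simp: m_def max_def Lp_norm_def)
  finally show "Lp_norm p M (\<lambda>x. f x + g x) \<le> 4 * (Lp_norm p M f + Lp_norm p M g)"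
    by simp
qed

lemma Lp_diff:
  assumes f: "f \<in> Lp p M" and g: "g \<in> Lp p M" and p: "1 < p"
  shows "(\<lambda>x. f x - g x) \<in> Lp p M"
    and "Lp_norm p M (\<lambda>x. f x - g x) \<le> 4 * (Lp_norm p M f + Lp_norm p M g)"
  using Lp_add[OF f Lp_scaleR(1)[OF g, of "-1"] p] Lp_scaleR(2)[OF g, of "-1"] p by simp_all

lemma Holder:
  assumes p: "1 < p" and f: "f \<in> Lp p M" and g: "g \<in> Lp (conj_exp p) M"
  shows "integrable M (\<lambda>x. norm (f x) * norm (g x))"
    and "(LINT x|M. norm (f x) * norm (g x)) \<le> Lp_norm p M f * Lp_norm (conj_exp p) M g"
proof -
  define q where "q = conj_exp p"
  have q: "1 < q" "1 / p + 1 / q = 1"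
    using conj_exp_gt_1[OF p] inverse_conj_exp[OF p] by (simp_all add: q_def)
  note [measurable] = LpD(1)[OF f] LpD(1)[OF g]
  note intf = LpD(2)[OF f] and intg = LpD(2)[OF g, folded q_def]
  have Young: "a * b \<le> a powr p / p + b powr q / q" if "0 \<le> a" "0 \<le> b" for a b :: real
    using Youngs_inequality[of p q a b] p q that by simp
  show int: "integrable M (\<lambda>x. norm (f x) * norm (g x))"
    by (rule Bochner_Integration.integrable_bound[of _ "\<lambda>x. norm (f x) powr p / p + norm (g x) powr q / q"])
      (use intf intg p q Young in \<open>auto intro!: AE_I2 order_trans[OF Young] simp: abs_mult\<close>)
  define a where "a = Lp_norm p M f"
  define b where "b = Lp_norm q M g"
  have a: "0 \<le> a" "a powr p = (LINT x|M. norm (f x) powr p)"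
    using p by (simp_all add: a_def Lp_norm_nonneg Lp_norm_powr)
  have b: "0 \<le> b" "b powr q = (LINT x|M. norm (g x) powr q)"
    using q by (simp_all add: b_def Lp_norm_nonneg Lp_norm_powr)
  have "(LINT x|M. norm (f x) * norm (g x)) \<le> a * b"
  proof (cases "a = 0 \<or> b = 0")
    case True
    \<comment> \<open>Normalization by a and b is impossible here, but a vanishing norm forces the
      product to vanish almost everywhere.\<close>
    then have "AE x in M. norm (f x) * norm (g x) = 0"
    proof
      assume "a = 0"
      then have "(LINT x|M. norm (f x) powr p) = 0" using a by simp
      then have "AE x in M. norm (f x) powr p = 0"
        using integral_nonneg_eq_0_iff_AE[OF intf] by simp
      then show ?thesis by eventually_elim simp
    next
      assume "b = 0"
      then have "(LINT x|M. norm (g x) powr q) = 0" using b by simp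
      then have "AE x in M. norm (g x) powr q = 0"
        using integral_nonneg_eq_0_iff_AE[OF intg] by simp
      then show ?thesis by eventually_elim simp
    qed
    then have "(LINT x|M. norm (f x) * norm (g x)) = 0"
      by (rule integral_eq_zero_AE)
    with True show ?thesis by auto
  next
    case False
    then have ab: "0 < a" "0 < b" using a b by auto
    have "(LINT x|M. norm (f x) * norm (g x)) / (a * b) = (LINT x|M. (norm (f x) / a) * (norm (g x) / b))"
      by simp
    also have "\<dots> \<le> (LINT x|M. (norm (f x) / a) powr p / p + (norm (g x) / b) powr q / q)"
      using int intf intg ab by (intro integral_mono Young) (auto simp: powr_divide)
    also have "\<dots> = (LINT x|M. norm (f x) powr p) / a powr p / p + (LINT x|M. norm (g x) powr q) / b powr q / q"
      using ab intf intg by (simp add: powr_divide)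
    also have "\<dots> = 1"
      using ab q by (simp add: a(2)[symmetric] b(2)[symmetric])
    finally show ?thesis using ab by (simp add: field_simps)
  qed
  then show "(LINT x|M. norm (f x) * norm (g x)) \<le> Lp_norm p M f * Lp_norm (conj_exp p) M g"
    by (simp add: a_def b_def q_def)
qed

lemma Holder_inner:
  assumes p: "1 < p" and f: "f \<in> Lp p M" and g: "g \<in> Lp (conj_exp p) M"
  shows "integrable M (\<lambda>x. f x \<bullet> g x)"
    and "\<bar>LINT x|M. f x \<bullet> g x\<bar> \<le> Lp_norm p M f * Lp_norm (conj_exp p) M g"
proof -
  note [measurable] = LpD(1)[OF f] LpD(1)[OF g]
  note H = Holder[OF assms]
  show int: "integrable M (\<lambda>x. f x \<bullet> g x)"
    by (rule Bochner_Integration.integrable_bound[OF H(1)]) (auto simp: Cauchy_Schwarz_ineq2)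
  have "\<bar>LINT x|M. f x \<bullet> g x\<bar> \<le> (LINT x|M. \<bar>f x \<bullet> g x\<bar>)"
    by (rule integral_abs_bound)
  also have "\<dots> \<le> (LINT x|M. norm (f x) * norm (g x))"
    using int H(1) by (intro integral_mono) (auto simp: Cauchy_Schwarz_ineq2)
  finally show "\<bar>LINT x|M. f x \<bullet> g x\<bar> \<le> Lp_norm p M f * Lp_norm (conj_exp p) M g"
    using H(2) by simp
qed

text \<open>The equality case of the Holder inequality, with g = |f|^(p-2) f / ||f||^(p-1). It
  supplies an explicit norming element, so no Hahn-Banach argument enters.\<close>

lemma Lp_dual_element:
  assumes p: "1 < p" and f: "f \<in> Lp p M" and nz: "0 < Lp_norm p M f"
  obtains g where "g \<in> Lp (conj_exp p) M" "Lp_norm (conj_exp p) M g = 1"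
    "(LINT x|M. f x \<bullet> g x) = Lp_norm p M f"
proof -
  define q where "q = conj_exp p"
  have q: "1 < q" "(p - 1) * q = p"
    using p by (simp_all add: q_def conj_exp_def field_simps)
  note [measurable] = LpD(1)[OF f] and int = LpD(2)[OF f]
  define a where "a = Lp_norm p M f"
  have a: "0 < a" "(LINT x|M. norm (f x) powr p) = a powr p"
    using nz p by (simp_all add: a_def Lp_norm_powr)
  define g where "g x = (norm (f x) powr (p - 2) / a powr (p - 1)) *\<^sub>R f x" for x
  have [measurable]: "g \<in> borel_measurable M"
    unfolding g_def by measurable
  have ng: "norm (g x) powr q = norm (f x) powr p / a powr p" for x
  proof -
    have "norm (g x) = norm (f x) powr (p - 1) / a powr (p - 1)"
      using powr_mult_base[of "norm (f x)" "p - 2"] by (simp add: g_def mult.commute)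
    then show ?thesis
      by (simp add: powr_divide powr_powr q)
  qed
  show ?thesis
  proof
    show "g \<in> Lp (conj_exp p) M"
      unfolding q_def[symmetric] using int by (simp add: Lp_def ng)
    show "Lp_norm (conj_exp p) M g = 1"
      unfolding q_def[symmetric] using a by (simp add: Lp_norm_def ng)
    have "f x \<bullet> g x = norm (f x) powr p / a powr (p - 1)" for x
    proof -
      have "f x \<bullet> g x = norm (f x) powr (p - 2) * (norm (f x) * norm (f x)) / a powr (p - 1)"
        by (simp add: g_def dot_square_norm power2_eq_square)
      also have "norm (f x) powr (p - 2) * (norm (f x) * norm (f x)) = norm (f x) powr p"
        using powr_mult_base[of "norm (f x)" "p - 2"] powr_mult_base[of "norm (f x)" "p - 1"]
        by (simp add: mult_ac)
      finally show ?thesis .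
    qed
    then have "(LINT x|M. f x \<bullet> g x) = a powr p / a powr (p - 1)"
      using a by simp
    also have "\<dots> = a"
      using a by (simp flip: powr_diff)
    finally show "(LINT x|M. f x \<bullet> g x) = Lp_norm p M f"
      by (simp add: a_def)
  qed
qed

section \<open>Uniform boundedness of weakly convergent sequences\<close>

lemma Lp_zero: "(\<lambda>x. 0) \<in> Lp p M"
  by (simp add: Lp_def)

text \<open>Stands in for completeness of L^q: partial sums with geometrically small increments
  converge almost everywhere under one L^q majorant. Dominated convergence can then pass the
  functionals to the limit.\<close>

lemma Lp_sum_of_bounded:
  fixes X :: "nat \<Rightarrow> 'a \<Rightarrow> 'b::euclidean_space"
  assumes q: "1 < q" and g: "\<And>j. g j \<in> Lp q M" "\<And>j. Lp_norm q M (g j) = 1"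
    and X0: "X 0 = (\<lambda>x. 0)"
    and X: "\<And>j x. norm (X (Suc j) x - X j x) = (1/3) ^ j * norm (g j x)"
    and meas: "\<And>j. X j \<in> borel_measurable M"
  obtains h D where "h \<in> Lp q M" "D \<in> Lp q M" "AE x in M. (\<lambda>j. X j x) \<longlonglongrightarrow> h x"
    "\<And>j. AE x in M. norm (X j x) \<le> norm (D x :: real)"
proof -
  note [measurable] = LpD(1)[OF g(1)] meas
  note intg = LpD(2)[OF g(1)]
  have int1: "(LINT x|M. norm (g j x) powr q) = 1" for j
    using Lp_norm_powr[of q M "g j"] q g(2) by simp
  \<comment> \<open>The factor 1/3 is split as 1/2 times 2/3. The q-th powers of the (2/3)^j |g j|
    form a series with finite integral, so each term is at most S^(1/q) pointwise; the remaining
    (1/2)^j makes the increments summable.\<close>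
  define c :: real where "c = (2/3) powr q"
  have c: "0 < c" "c < 1"
    unfolding c_def using powr_less_mono2[of q "2/3" 1] q by auto
  define u where "u j x = c ^ j * norm (g j x) powr q" for j x
  have u0: "0 \<le> u j x" for j x
    using c by (simp add: u_def)
  have intu: "integrable M (u j)" and Iu: "(LINT x|M. norm (u j x)) = c ^ j" for j
    using intg[of j] int1[of j] c by (simp_all add: u_def[abs_def])
  have sumu: "AE x in M. summable (\<lambda>j. u j x)"
  proof -
    have [measurable]: "u j \<in> borel_measurable M" for j
      using intu[of j] by simp
    have "(\<integral>\<^sup>+x. (\<Sum>j. ennreal (u j x)) \<partial>M) = (\<Sum>j. \<integral>\<^sup>+x. ennreal (u j x) \<partial>M)"
      by (rule nn_integral_suminf) measurable
    also have "\<dots> = (\<Sum>j. ennreal (c ^ j))"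
      using intu Iu u0 by (intro suminf_cong) (simp add: nn_integral_eq_integral)
    also have "\<dots> < \<infinity>"
      using c by (subst suminf_ennreal2) (auto intro!: summable_geometric)
    finally have "(\<integral>\<^sup>+x. (\<Sum>j. ennreal (u j x)) \<partial>M) \<noteq> \<infinity>" by simp
    then have "AE x in M. (\<Sum>j. ennreal (u j x)) \<noteq> \<infinity>"
      by (intro nn_integral_noteq_infinite) auto
    then show ?thesis
      by eventually_elim (use u0 in \<open>auto intro: summable_suminf_not_top\<close>)
  qed
  define S where "S x = (\<Sum>j. u j x)" for x
  have intS: "integrable M S"
    unfolding S_def
    by (rule integrable_suminf) (use intu Iu sumu u0 c in \<open>auto intro!: summable_geometric\<close>)
  have [measurable]: "S \<in> borel_measurable M" using intS by simp
  \<comment> \<open>The 2 is the sum of the geometric series with ratio 1/2.\<close>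
  define D where "D x = 2 * S x powr (1/q)" for x
  have D0: "0 \<le> D x" for x by (simp add: D_def)
  have [measurable]: "D \<in> borel_measurable M" by (simp add: D_def[abs_def])
  have S0: "AE x in M. 0 \<le> S x"
    using sumu by eventually_elim (simp add: S_def suminf_nonneg u0)
  have "integrable M (\<lambda>x. norm (D x) powr q)"
  proof (rule integrable_cong_AE_imp[where g="\<lambda>x. 2 powr q * S x"])
    show "AE x in M. 2 powr q * S x = norm (D x) powr q"
      using S0 by eventually_elim (use q in \<open>simp add: D_def powr_mult powr_powr\<close>)
  qed (use intS in auto)
  then have DL: "D \<in> Lp q M" by (simp add: Lp_def)
  have step: "norm (X (Suc j) x - X j x) \<le> (1/2) ^ j * (S x powr (1/q))"
    if "summable (\<lambda>j. u j x)" for x j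
  proof -
    have "u j x \<le> S x"
      unfolding S_def using that sum_le_suminf[of "\<lambda>j. u j x" "{j}"] u0 by auto
    then have "u j x powr (1/q) \<le> S x powr (1/q)"
      using q u0 by (intro powr_mono2) auto
    moreover have "u j x powr (1/q) = (2/3) ^ j * norm (g j x)"
    proof -
      have "c ^ j = ((2/3) ^ j) powr q"
        by (simp add: c_def powr_power powr_realpow[symmetric] powr_powr mult.commute)
      then show ?thesis
        using q by (simp add: u_def powr_mult powr_powr)
    qed
    ultimately have "(1/2) ^ j * ((2/3) ^ j * norm (g j x)) \<le> (1/2) ^ j * S x powr (1/q)"
      by (intro mult_left_mono) auto
    moreover have "(1/2) ^ j * ((2/3) ^ j * norm (g j x)) = (1/3) ^ j * norm (g j x)"
      by (simp add: power_mult_distrib[symmetric] mult.assoc[symmetric])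
    ultimately show ?thesis by (simp add: X)
  qed
  have XD: "norm (X j x) \<le> D x" if "summable (\<lambda>j. u j x)" for x j
  proof -
    \<comment> \<open>The induction carries the exact partial sum 2 - 2 (1/2)^j of the geometric
      series.\<close>
    have "norm (X j x) \<le> (2 - 2 * (1/2) ^ j) * S x powr (1/q)"
    proof (induction j)
      case (Suc j)
      have "norm (X (Suc j) x) \<le> norm (X j x) + norm (X (Suc j) x - X j x)"
        using norm_triangle_ineq[of "X j x" "X (Suc j) x - X j x"] by simp
      also have "\<dots> \<le> (2 - 2 * (1/2) ^ j) * S x powr (1/q) + (1/2) ^ j * (S x powr (1/q))"
        by (intro add_mono Suc step that)
      also have "\<dots> = (2 - 2 * (1/2) ^ Suc j) * S x powr (1/q)"
        by (simp add: algebra_simps)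
      finally show ?case .
    qed (simp add: X0)
    also have "\<dots> \<le> 2 * S x powr (1/q)"
      by (intro mult_right_mono) auto
    finally show ?thesis by (simp add: D_def)
  qed
  have conv: "convergent (\<lambda>j. X j x)" if "summable (\<lambda>j. u j x)" for x
  proof -
    have "summable (\<lambda>j. X (Suc j) x - X j x)"
      by (rule summable_comparison_test'[where g="\<lambda>j. (1/2) ^ j * (S x powr (1/q))" and N=0])
        (use step[OF that] in \<open>auto intro!: summable_mult2 summable_geometric\<close>)
    then have "convergent (\<lambda>n. \<Sum>j<n. X (Suc j) x - X j x)"
      by (simp add: summable_iff_convergent)
    then show ?thesis
      by (simp add: sum_lessThan_telescope[of "\<lambda>j. X j x"] X0)
  qed
  define h where "h x = lim (\<lambda>j. X j x)" for x
  have lim: "(\<lambda>j. X j x) \<longlonglongrightarrow> h x" if "summable (\<lambda>j. u j x)" for x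
    using conv[OF that] by (simp add: h_def convergent_LIMSEQ_iff)
  have [measurable]: "h \<in> borel_measurable M"
    unfolding h_def by (rule borel_measurable_lim_metric) measurable
  have "h \<in> Lp q M"
  proof (rule Lp_bound_AE(1)[OF DL, where C=1])
    show "AE x in M. norm (h x) \<le> 1 * norm (D x)"
      using sumu
    proof eventually_elim
      case (elim x)
      then have "norm (h x) \<le> D x"
        by (intro LIMSEQ_le_const2[OF tendsto_norm[OF lim]] exI[of _ 0]) (auto intro: XD)
      then show ?case by simp
    qed
  qed (use q in auto)
  moreover have "AE x in M. (\<lambda>j. X j x) \<longlonglongrightarrow> h x"
    using sumu by eventually_elim (rule lim)
  moreover have "AE x in M. norm (X j x) \<le> norm (D x)" for j
    using sumu by eventually_elim (use XD D0 in auto)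
  ultimately show ?thesis using that DL by blast
qed

text \<open>
  Sokal's form of the gliding hump: since \<open>T \<xi>\<close> is half the difference of \<open>T (x + \<xi>)\<close> and \<open>T (x - \<xi>)\<close>,
  one of the two signs makes \<open>|T (x \<plusminus> \<xi>)| \<ge> |T \<xi>|\<close>. Along indices where the norms exceed \<open>4^n\<close>,
  steps of length \<open>3^{-n}\<close> chosen this way converge to an element on which the functionals are unbounded.
\<close>

lemma Lp_bounded_if_weakly_bounded:
  fixes f :: "nat \<Rightarrow> 'a \<Rightarrow> 'b::euclidean_space"
  assumes p: "1 < p" and f: "\<And>k. f k \<in> Lp p M"
    and bdd: "\<And>h. h \<in> Lp (conj_exp p) M \<Longrightarrow> bounded (range (\<lambda>k. LINT x|M. f k x \<bullet> h x))"
  shows "bounded (range (\<lambda>k. Lp_norm p M (f k)))"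
proof (rule ccontr)
  assume unb: "\<not> bounded (range (\<lambda>k. Lp_norm p M (f k)))"
  define q where "q = conj_exp p"
  have q: "1 < q" using conj_exp_gt_1[OF p] by (simp add: q_def)
  have "\<exists>k. 4 ^ n \<le> Lp_norm p M (f k)" for n :: nat
  proof (rule ccontr)
    assume "\<nexists>k. 4 ^ n \<le> Lp_norm p M (f k)"
    then have "\<forall>k. norm (Lp_norm p M (f k)) \<le> 4 ^ n"
      by (auto simp: not_le abs_of_nonneg[OF Lp_norm_nonneg] intro: less_imp_le)
    with unb show False by (auto simp: bounded_iff)
  qed
  then obtain \<kappa> where \<kappa>: "\<And>n. 4 ^ n \<le> Lp_norm p M (f (\<kappa> n))" by metis
  define a where "a n = Lp_norm p M (f (\<kappa> n))" for n
  have a: "4 ^ n \<le> a n" "0 < a n" for n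
    using \<kappa>[of n] less_le_trans[OF _ \<kappa>[of n], of 0] by (simp_all add: a_def)
  have "\<exists>g. g \<in> Lp q M \<and> Lp_norm q M g = 1 \<and> (LINT x|M. f (\<kappa> n) x \<bullet> g x) = a n" for n
    using Lp_dual_element[OF p f, of "\<kappa> n"] a(2)[of n] unfolding q_def a_def by metis
  then obtain g where g: "\<And>n. g n \<in> Lp q M" "\<And>n. Lp_norm q M (g n) = 1"
    "\<And>n. (LINT x|M. f (\<kappa> n) x \<bullet> g n x) = a n" by metis
  define T where "T n h = (LINT x|M. f (\<kappa> n) x \<bullet> h x)" for n h
  have Tint: "integrable M (\<lambda>x. f (\<kappa> n) x \<bullet> h x)" if "h \<in> Lp q M" for h n
    using Holder_inner(1)[OF p f] that by (simp add: q_def)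
  have Tlin: "T n (\<lambda>x. h x + c *\<^sub>R g j x) = T n h + c * T n (g j)" if "h \<in> Lp q M" for h n j c
    using Tint[OF that, of n] Tint[OF g(1)[of j], of n]
    by (simp add: T_def inner_add_right)
  have Tg: "\<bar>T n (g j)\<bar> \<le> a n" for n j
    using Holder_inner(2)[OF p f, of "g j" "\<kappa> n"] g(1,2)[of j] by (simp add: T_def a_def q_def)
  define \<delta> :: "nat \<Rightarrow> ('a \<Rightarrow> 'b) \<Rightarrow> real" where "\<delta> n X = (if (1/3) ^ n * a n \<le> \<bar>T n (\<lambda>x. X x + (1/3) ^ n *\<^sub>R g n x)\<bar>
     then (1/3) ^ n else - ((1/3) ^ n))" for n and X :: "'a \<Rightarrow> 'b"
  define X where "X = rec_nat (\<lambda>x. 0) (\<lambda>n X x. X x + \<delta> n X *\<^sub>R g n x)"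
  have X0: "X 0 = (\<lambda>x. 0)" and XS: "X (Suc n) = (\<lambda>x. X n x + \<delta> n (X n) *\<^sub>R g n x)" for n
    by (simp_all add: X_def)
  have \<delta>: "\<bar>\<delta> n X\<bar> = (1/3) ^ n" for n X by (simp add: \<delta>_def)
  have XL: "X n \<in> Lp q M" for n
    by (induction n) (use q g(1) in \<open>auto simp: X0 XS Lp_zero intro!: Lp_add(1) Lp_scaleR(1)\<close>)
  have TXS: "(1/3) ^ n * a n \<le> \<bar>T n (X (Suc n))\<bar>" for n
  proof (cases "(1/3) ^ n * a n \<le> \<bar>T n (\<lambda>x. X n x + (1/3) ^ n *\<^sub>R g n x)\<bar>")
    case True
    then show ?thesis by (simp add: XS \<delta>_def)
  next
    case False
    have Tgn: "T n (g n) = a n" by (simp add: T_def g)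
    \<comment> \<open>If the plus sign fails, T n (X n) must be negative. Subtracting then adds two
      numbers of the same sign.\<close>
    from False have "\<bar>T n (X n) + (1/3) ^ n * a n\<bar> < (1/3) ^ n * a n"
      unfolding Tlin[OF XL] Tgn by simp
    then have "(1/3) ^ n * a n \<le> \<bar>T n (X n) + (- ((1/3) ^ n)) * a n\<bar>"
      by linarith
    moreover have "T n (X (Suc n)) = T n (X n) + (- ((1/3) ^ n)) * a n"
      unfolding XS Tlin[OF XL] Tgn using False by (simp add: \<delta>_def)
    ultimately show ?thesis by simp
  qed
  \<comment> \<open>The step at an index j > n changes T n by at most (1/3)^j a n. Subtracting these
    losses up to n + m from (1/3)^n a n leaves exactly the left side, so half of the gain survives
    in the limit.\<close>
  have TX: "a n * ((1/3) ^ n / 2 + (1/3) ^ (n + m) / 2) \<le> \<bar>T n (X (Suc (n + m)))\<bar>" for n m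
  proof (induction m)
    case 0
    then show ?case using TXS[of n] by (simp add: mult.commute)
  next
    case (Suc m)
    let ?j = "Suc (n + m)"
    have "\<bar>\<delta> ?j (X ?j) * T n (g ?j)\<bar> \<le> (1/3) ^ ?j * a n"
      unfolding abs_mult \<delta> by (intro mult_left_mono Tg) auto
    moreover have "a n * ((1/3) ^ n / 2 + (1/3) ^ (n + Suc m) / 2)
        = a n * ((1/3) ^ n / 2 + (1/3) ^ (n + m) / 2) - (1/3) ^ ?j * a n"
      by (simp add: algebra_simps)
    ultimately show ?case
      using Suc unfolding XS[of ?j] add_Suc_right Tlin[OF XL] by linarith
  qed
  have Xmeas: "X j \<in> borel_measurable M" for j using LpD(1)[OF XL] .
  have Xstep: "norm (X (Suc j) x - X j x) = (1/3) ^ j * norm (g j x)" for j x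
    by (simp add: XS \<delta>)
  obtain h D where h: "h \<in> Lp q M" and D: "D \<in> Lp q M" and lim: "AE x in M. (\<lambda>j. X j x) \<longlonglongrightarrow> h x"
    and dom: "\<And>j. AE x in M. norm (X j x) \<le> norm (D x :: real)"
    using Lp_sum_of_bounded[OF q g(1,2) X0 Xstep Xmeas] by blast
  note [measurable] = Xmeas LpD(1)[OF h] LpD(1)[OF f] LpD(1)[OF D]
  have Tlim: "(\<lambda>j. T n (X j)) \<longlonglongrightarrow> T n h" for n
    unfolding T_def
  proof (rule integral_dominated_convergence[where w="\<lambda>x. norm (f (\<kappa> n) x) * norm (D x)"])
    show "integrable M (\<lambda>x. norm (f (\<kappa> n) x) * norm (D x))"
      by (rule Holder(1)[OF p f D[unfolded q_def]])
    show "AE x in M. (\<lambda>j. f (\<kappa> n) x \<bullet> X j x) \<longlonglongrightarrow> f (\<kappa> n) x \<bullet> h x"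
      using lim by eventually_elim (intro tendsto_intros)
    show "AE x in M. norm (f (\<kappa> n) x \<bullet> X j x) \<le> norm (f (\<kappa> n) x) * norm (D x)" for j
      using dom[of j] by eventually_elim
        (auto intro!: order_trans[OF Cauchy_Schwarz_ineq2] mult_left_mono)
  qed measurable
  have "(4/3) ^ n / 2 \<le> \<bar>T n h\<bar>" for n
  proof -
    have "4 ^ n * (1/3) ^ n / 2 \<le> a n * (1/3) ^ n / 2"
      using a(1)[of n] by simp
    also have "a n * (1/3) ^ n / 2 \<le> \<bar>T n h\<bar>"
    proof (rule LIMSEQ_le_const)
      show "(\<lambda>j. \<bar>T n (X j)\<bar>) \<longlonglongrightarrow> \<bar>T n h\<bar>"
        by (intro tendsto_rabs Tlim)
      show "\<exists>N. \<forall>j\<ge>N. a n * (1/3) ^ n / 2 \<le> \<bar>T n (X j)\<bar>"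
      proof (intro exI allI impI)
        fix j assume "Suc n \<le> j"
        then obtain m where "j = Suc (n + m)" by (metis add_Suc le_Suc_ex)
        moreover have "a n * (1/3) ^ n / 2 \<le> a n * ((1/3) ^ n / 2 + (1/3) ^ (n + m) / 2)"
          using a(2)[of n] by (simp add: distrib_left)
        ultimately show "a n * (1/3) ^ n / 2 \<le> \<bar>T n (X j)\<bar>"
          using TX[of n m] by simp
      qed
    qed
    finally show ?thesis by (simp add: power_divide)
  qed
  moreover obtain B where B: "\<And>k. \<bar>LINT x|M. f k x \<bullet> h x\<bar> \<le> B"
    using bdd[of h] h by (auto simp: bounded_iff q_def)
  moreover obtain n where "2 * B < (4/3 :: real) ^ n"
    using real_arch_pow[of "4/3" "2 * B"] by auto
  ultimately have "(4/3) ^ n / 2 \<le> B" "2 * B < (4/3) ^ n"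
    unfolding T_def by (meson order_trans)+
  then show False by simp
qed

lemma weak_Lp_tendsto_bounded:
  assumes "weak_Lp_tendsto p M f g" "1 < p"
  obtains B where "0 < B" "\<And>k. Lp_norm p M (f k) \<le> B"
proof -
  have "bounded (range (\<lambda>k. Lp_norm p M (f k)))"
    using assms by (intro Lp_bounded_if_weakly_bounded)
      (auto simp: weak_Lp_tendsto_def intro: convergent_imp_bounded)
  then obtain B where "0 < B" "\<forall>x\<in>range (\<lambda>k. Lp_norm p M (f k)). norm x \<le> B"
    using bounded_pos by blast
  then show ?thesis using that[of B] by (auto simp: abs_of_nonneg[OF Lp_norm_nonneg])
qed

section \<open>Test functions\<close>

lemma frechet_derivative_add_at:
  assumes "f differentiable (at x)" "g differentiable (at x)"
  shows "frechet_derivative (\<lambda>x. f x + g x) (at x) = (\<lambda>h. frechet_derivative f (at x) h + frechet_derivative g (at x) h)"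
  using assms
  by (intro frechet_derivative_at[symmetric] has_derivative_add) (auto simp: frechet_derivative_works)

lemma frechet_derivative_mult_at:
  fixes f g :: "_ \<Rightarrow> real"
  assumes "f differentiable (at x)" "g differentiable (at x)"
  shows "frechet_derivative (\<lambda>x. f x * g x) (at x) =
    (\<lambda>h. f x * frechet_derivative g (at x) h + frechet_derivative f (at x) h * g x)"
  using assms
  by (intro frechet_derivative_at[symmetric] has_derivative_mult) (auto simp: frechet_derivative_works)

text \<open>Needed for products: the derivative of f g still contains the undifferentiated factors,
  which must be known to be of class k.\<close>

lemma Ck_Suc_imp_Ck: "Ck (Suc k) f \<Longrightarrow> Ck k f"
proof (induction k arbitrary: f)
  case 0
  then have "\<And>x. f differentiable (at x)" by simp
  then have "f differentiable_on UNIV" by (simp add: differentiable_on_def)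
  then show ?case by (simp add: differentiable_imp_continuous_on)
next
  case (Suc k)
  have "Ck k (\<lambda>x. frechet_derivative f (at x) (axis i 1))" for i
    by (rule Suc.IH) (use Suc.prems in simp)
  with Suc.prems show ?case by simp
qed

lemma Ck_add: "Ck k f \<Longrightarrow> Ck k g \<Longrightarrow> Ck k (\<lambda>x. f x + g x)"
proof (induction k arbitrary: f g)
  case 0
  then show ?case by (auto intro: continuous_on_add continuous_on_mult)
next
  case (Suc k)
  then show ?case by (simp add: frechet_derivative_add_at)
qed

lemma Ck_mult: "Ck k f \<Longrightarrow> Ck k g \<Longrightarrow> Ck k (\<lambda>x. f x * g x)"
proof (induction k arbitrary: f g)
  case 0
  then show ?case by (auto intro: continuous_on_add continuous_on_mult)
next
  case (Suc k)
  have "Ck k f" "Ck k g"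
    using Suc.prems by (auto intro: Ck_Suc_imp_Ck)
  then show ?case
    using Suc by (simp add: frechet_derivative_mult_at Ck_add)
qed

lemma Ck_const: "Ck k (\<lambda>x. c)"
  by (induction k arbitrary: c) auto

lemma test_functions_mono: "U \<subseteq> V \<Longrightarrow> test_functions U \<subseteq> test_functions V"
  by (auto simp: test_functions_def)

text \<open>Only one factor has to be supported in U. This is what localizes approximating sequences
  living on the whole space.\<close>

lemma test_functions_mult:
  assumes "\<phi> \<in> test_functions U" "\<psi> \<in> test_functions UNIV"
  shows "(\<lambda>x. \<phi> x * \<psi> x) \<in> test_functions U"
proof -
  have sub: "closure {x. \<phi> x * \<psi> x \<noteq> 0} \<subseteq> closure {x. \<phi> x \<noteq> 0}"
    by (intro closure_mono) auto
  moreover have "compact (closure {x. \<phi> x * \<psi> x \<noteq> 0})"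
    using assms(1) sub compact_Int_closed[of "closure {x. \<phi> x \<noteq> 0}" "closure {x. \<phi> x * \<psi> x \<noteq> 0}"]
    by (simp add: test_functions_def Int_absorb1)
  ultimately show ?thesis
    using assms by (auto simp: test_functions_def intro: Ck_mult)
qed

lemma test_functions_scale:
  assumes "\<phi> \<in> test_functions U"
  shows "(\<lambda>x. c * \<phi> x) \<in> test_functions U"
proof (cases "c = 0")
  case True
  then show ?thesis by (simp add: test_functions_def Ck_const)
next
  case False
  then show ?thesis using assms by (auto simp: test_functions_def intro: Ck_mult Ck_const)
qed

section \<open>Lipschitz functions with compact support\<close>

definition lipschitz_cs :: "('a::euclidean_space \<Rightarrow> real) \<Rightarrow> bool" where
  "lipschitz_cs f \<longleftrightarrow> (\<exists>L. L-lipschitz_on UNIV f) \<and> (\<exists>K. compact K \<and> (\<forall>x. x \<notin> K \<longrightarrow> f x = 0))"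

text \<open>One constant serves as sup bound and as Lipschitz bound, so differences are at most 2 C
  min(1, |y - x|), the numerator of \<open>riesz_weight\<close>.\<close>

lemma lipschitz_cs_bound:
  assumes "lipschitz_cs f"
  obtains C K where "0 < C" "compact K" "\<And>x. x \<notin> K \<Longrightarrow> f x = 0" "\<And>x. \<bar>f x\<bar> \<le> C"
    "\<And>x y. \<bar>f y - f x\<bar> \<le> C * norm (y - x)" "continuous_on UNIV f"
proof -
  obtain L K where L: "L-lipschitz_on UNIV f" and K: "compact K" "\<And>x. x \<notin> K \<Longrightarrow> f x = 0"
    using assms by (auto simp: lipschitz_cs_def)
  have cont: "continuous_on UNIV f" using L by (rule lipschitz_on_continuous_on)
  have "compact (f ` K)"
    using K cont by (intro compact_continuous_image) (auto intro: continuous_on_subset)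
  then obtain B where B: "0 < B" "\<And>x. x \<in> K \<Longrightarrow> \<bar>f x\<bar> \<le> B"
    using compact_imp_bounded[of "f ` K"] by (auto simp: bounded_pos)
  define C where "C = max B L"
  show ?thesis
  proof (rule that[of C K])
    show "\<bar>f x\<bar> \<le> C" for x
      using B(1) B(2)[of x] K(2)[of x] by (cases "x \<in> K") (auto simp: C_def)
    show "\<bar>f y - f x\<bar> \<le> C * norm (y - x)" for x y
    proof -
      have "\<bar>f y - f x\<bar> \<le> L * norm (y - x)"
        using lipschitz_onD[OF L, of y x] by (simp add: dist_norm)
      also have "\<dots> \<le> C * norm (y - x)" by (intro mult_right_mono) (auto simp: C_def)
      finally show ?thesis .
    qed
  qed (use B K cont in \<open>auto simp: C_def\<close>)
qed

lemma lipschitz_csI: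
  assumes "0 \<le> L" "\<And>x y. \<bar>f y - f x\<bar> \<le> L * norm (y - x)" "compact K" "\<And>x. x \<notin> K \<Longrightarrow> f x = 0"
  shows "lipschitz_cs f"
  using assms unfolding lipschitz_cs_def
  by (intro conjI exI[of _ L] exI[of _ K] lipschitz_onI) (auto simp: dist_norm)

lemma lipschitz_cs_mult:
  assumes "lipschitz_cs f" "lipschitz_cs g"
  shows "lipschitz_cs (\<lambda>x. f x * g x)"
proof -
  obtain C K where f: "0 < C" "compact K" "\<And>x. x \<notin> K \<Longrightarrow> f x = 0" "\<And>x. \<bar>f x\<bar> \<le> C"
    "\<And>x y. \<bar>f y - f x\<bar> \<le> C * norm (y - x)"
    using lipschitz_cs_bound[OF assms(1)] by metis
  obtain D where g: "0 < D" "\<And>x. \<bar>g x\<bar> \<le> D" "\<And>x y. \<bar>g y - g x\<bar> \<le> D * norm (y - x)"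
    using lipschitz_cs_bound[OF assms(2)] by metis
  show ?thesis
  proof (rule lipschitz_csI[of "2 * C * D" _ K])
    fix x y
    have "f y * g y - f x * g x = f y * (g y - g x) + (f y - f x) * g x"
      by (simp add: algebra_simps)
    then have "\<bar>f y * g y - f x * g x\<bar> \<le> \<bar>f y\<bar> * \<bar>g y - g x\<bar> + \<bar>f y - f x\<bar> * \<bar>g x\<bar>"
      by (metis abs_triangle_ineq abs_mult)
    also have "\<dots> \<le> C * (D * norm (y - x)) + (C * norm (y - x)) * D"
      by (intro add_mono mult_mono f g) (use f g in auto)
    finally show "\<bar>f y * g y - f x * g x\<bar> \<le> 2 * C * D * norm (y - x)"
      by (simp add: algebra_simps)
  qed (use f g in auto)
qed

text \<open>\<open>Ck\<close> speaks only of continuous partial derivatives. They vanish off the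
  compact support, hence are bounded; expanding a direction in the basis bounds the full derivative,
  and the mean value inequality on the convex set \<open>UNIV\<close> gives the Lipschitz
  constant.\<close>

lemma test_functions_imp_lipschitz_cs:
  fixes \<psi> :: "real^'n \<Rightarrow> real"
  assumes "\<psi> \<in> test_functions U"
  shows "lipschitz_cs \<psi>"
proof -
  define K where "K = closure {x. \<psi> x \<noteq> 0}"
  have K: "compact K" "closed K" "\<And>x. x \<notin> K \<Longrightarrow> \<psi> x = 0"
    using assms closure_subset[of "{x. \<psi> x \<noteq> 0}"] by (auto simp: test_functions_def K_def)
  have "Ck 1 \<psi>" using assms by (auto simp: test_functions_def)
  then have diff: "\<And>x. \<psi> differentiable (at x)"
    and cont: "\<And>i. continuous_on UNIV (\<lambda>x. frechet_derivative \<psi> (at x) (axis i 1))"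
    by auto
  define D where "D x = frechet_derivative \<psi> (at x)" for x
  have D: "(\<psi> has_derivative D x) (at x)" for x
    using diff by (simp add: D_def frechet_derivative_works)
  have D0: "D x h = 0" if "x \<notin> K" for x h
  proof -
    have "((\<lambda>_. 0) has_derivative D x) (at x)"
    proof (rule has_derivative_transform_within_open[OF D])
      show "open (- K)" using K by auto
    qed (use that K in auto)
    then have "D x = (\<lambda>_. 0)"
      using has_derivative_unique[OF _ has_derivative_const] by blast
    then show ?thesis by simp
  qed
  have "\<exists>B. \<forall>x. \<bar>D x (axis i 1)\<bar> \<le> B" for i
  proof -
    have "compact ((\<lambda>x. D x (axis i 1)) ` K)"
      using K cont[of i] unfolding D_def
      by (intro compact_continuous_image) (auto intro: continuous_on_subset)
    from compact_imp_bounded[OF this]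
    obtain B where B: "0 < B" "\<And>x. x \<in> K \<Longrightarrow> \<bar>D x (axis i 1)\<bar> \<le> B"
      by (auto simp: bounded_pos)
    then have "\<bar>D x (axis i 1)\<bar> \<le> B" for x
      using D0[of x] by (cases "x \<in> K") auto
    then show ?thesis by blast
  qed
  then obtain B where B: "\<And>i x. \<bar>D x (axis i 1)\<bar> \<le> B i" by metis
  have B0: "0 \<le> B i" for i using B[where i=i] by (meson abs_ge_zero order_trans)
  have bound: "norm (D x h) \<le> (\<Sum>i\<in>UNIV. B i) * norm h" for x h
  proof -
    interpret bounded_linear "D x" using D by (rule has_derivative_bounded_linear)
    have "D x h = D x (\<Sum>i\<in>UNIV. (h $ i) *\<^sub>R axis i 1)"
      using basis_expansion[of h] by (simp add: scalar_mult_eq_scaleR)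
    also have "\<dots> = (\<Sum>i\<in>UNIV. (h $ i) * D x (axis i 1))"
      by (simp add: sum scaleR)
    also have "\<bar>\<dots>\<bar> \<le> (\<Sum>i\<in>UNIV. \<bar>(h $ i) * D x (axis i 1)\<bar>)"
      by (rule sum_abs)
    also have "\<dots> \<le> (\<Sum>i\<in>UNIV. norm h * B i)"
      unfolding abs_mult by (intro sum_mono mult_mono B component_le_norm_cart) auto
    finally show ?thesis by (simp add: sum_distrib_left sum_distrib_right mult.commute)
  qed
  show ?thesis
  proof (rule lipschitz_csI[of "\<Sum>i\<in>UNIV. B i"])
    fix x y :: "real^'n"
    have "norm (\<psi> y - \<psi> x) \<le> (\<Sum>i\<in>UNIV. B i) * norm (y - x)"
    proof (rule differentiable_bound[where S=UNIV and f'=D])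
      show "onorm (D z) \<le> (\<Sum>i\<in>UNIV. B i)" for z
        by (rule onorm_bound) (use bound B0 in \<open>auto intro: sum_nonneg\<close>)
    qed (use D in auto)
    then show "\<bar>\<psi> y - \<psi> x\<bar> \<le> (\<Sum>i\<in>UNIV. B i) * norm (y - x)" by simp
  qed (use K B0 in \<open>auto intro: sum_nonneg\<close>)
qed

lemma exists_open_between:
  fixes K :: "'a::euclidean_space set"
  assumes "compact K" "open \<Omega>" "K \<subseteq> \<Omega>"
  obtains U where "open U" "K \<subseteq> U" "compactly_contained U \<Omega>"
proof -
  obtain e where e: "e > 0" "(\<Union>x\<in>K. cball x e) \<subseteq> \<Omega>"
    using compact_subset_open_imp_cball_epsilon_subset[OF assms] by blast
  define U where "U = (\<Union>x\<in>K. ball x e)"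
  have "compact (\<Union>x\<in>K. cball x e)"
    using assms(1) by (rule compact_minkowski_sum_cball)
  then have "compactly_contained U \<Omega>"
    unfolding compactly_contained_def using e(2)
    by (intro exI[of _ "\<Union>x\<in>K. cball x e"]) (auto simp: U_def)
  moreover have "K \<subseteq> U" using e by (auto simp: U_def)
  moreover have "open U" by (auto simp: U_def)
  ultimately show ?thesis using that by blast
qed

section \<open>Integrability of the Riesz kernel\<close>

lemma ennreal_le_suminf: "u j \<le> (\<Sum>j. u j :: ennreal)"
  using sum_le_suminf[of u "{j}"] by simp

text \<open>A substitute for polar coordinates: a function majorized by a series of constants on
  balls has finite integral once the sum of the c_j r_j^n converges.\<close>

lemma nn_integral_cball_series_finite:
  fixes r c :: "nat \<Rightarrow> real"
  assumes "\<And>j. 0 \<le> r j" "\<And>j. 0 \<le> c j" "summable (\<lambda>j. c j * r j ^ DIM('a::euclidean_space))"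
  shows "(\<integral>\<^sup>+z. (\<Sum>j. ennreal (c j) * indicator (cball 0 (r j)) z) \<partial>(lborel :: 'a measure)) < \<infinity>"
proof -
  have [measurable]: "cball 0 (r j) \<in> sets (borel :: 'a measure)" for j by simp
  have "(\<integral>\<^sup>+z. (\<Sum>j. ennreal (c j) * indicator (cball 0 (r j)) z) \<partial>(lborel :: 'a measure))
      = (\<Sum>j. \<integral>\<^sup>+z. ennreal (c j) * indicator (cball 0 (r j)) z \<partial>(lborel :: 'a measure))"
    by (rule nn_integral_suminf) measurable
  also have "\<dots> = (\<Sum>j. ennreal (unit_ball_vol (DIM('a)) * (c j * r j ^ DIM('a))))"
    using assms(1,2)
    by (intro suminf_cong) (simp add: nn_integral_cmult_indicator emeasure_cball ennreal_mult[symmetric] mult_ac)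
  also have "\<dots> < \<infinity>"
    using assms by (subst suminf_ennreal2) (auto intro!: summable_mult)
  finally show ?thesis .
qed

text \<open>The common majorant of all kernels below. It is |z|^(1-n-s) inside the unit ball, where
  the Lipschitz bound is used, and |z|^(-n-s) outside, where boundedness is used. Its value at 0 is
  0, by division by zero.\<close>

definition riesz_weight :: "real \<Rightarrow> real^'n \<Rightarrow> real" where
  "riesz_weight s z = min 1 (norm z) / norm z powr (real CARD('n) + s)"

lemma riesz_weight_nonneg: "0 \<le> riesz_weight s z"
  by (simp add: riesz_weight_def)

lemma riesz_weight_uminus: "riesz_weight s (- z) = riesz_weight s z"
  by (simp add: riesz_weight_def)

lemma borel_measurable_riesz_weight [measurable]: "riesz_weight s \<in> borel_measurable borel"
  unfolding riesz_weight_def[abs_def] by measurable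

lemma riesz_weight_le_inner:
  fixes z :: "real^'n"
  assumes s: "0 < s" "s < 1" and z: "norm z < 1"
  shows "ennreal (riesz_weight s z) \<le> (\<Sum>j. ennreal (2 * 2 powr (real CARD('n) + s) * (2 ^ j) powr (real CARD('n) + s - 1)) * indicator (cball 0 ((1/2) ^ j)) z)"
    (is "_ \<le> (\<Sum>j. ?u j)")
proof (cases "z = 0")
  case True
  then show ?thesis by (simp add: riesz_weight_def)
next
  case False
  \<comment> \<open>The order of the singularity: the weight equals |z|^(-b) in the punctured unit
    ball. Positivity of b makes this decreasing in |z|.\<close>
  define b where "b = real CARD('n) + s - 1"
  have "1 \<le> real CARD('n)" by (simp add: Suc_leI)
  then have b: "0 < b" unfolding b_def using s(1) by linarith
  \<comment> \<open>The dyadic annulus (1/2)^(j+1) < |z| \<le> (1/2)^j containing z. The single term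
    of index j already dominates the weight.\<close>
  define j where "j = (LEAST j. (1/2) ^ Suc j < norm z)"
  obtain k where k: "(1/2 :: real) ^ k < norm z"
    using real_arch_pow_inv[of "norm z" "1/2"] False by auto
  have ex: "(1/2) ^ Suc k < norm z"
    using k by (rule le_less_trans[rotated]) simp
  have j1: "(1/2) ^ Suc j < norm z"
    unfolding j_def by (rule LeastI[of _ k]) (fact ex)
  have j2: "norm z \<le> (1/2) ^ j"
  proof (cases j)
    case 0
    then show ?thesis using z by simp
  next
    case (Suc i)
    then have "\<not> (1/2) ^ Suc i < norm z"
      using not_less_Least[of i "\<lambda>j. (1/2) ^ Suc j < norm z"] by (simp add: j_def)
    then show ?thesis using Suc by simp
  qed
  have "riesz_weight s z = norm z powr - b"
  proof -
    have "riesz_weight s z = norm z powr 1 / norm z powr (b + 1)"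
      using z False by (simp add: riesz_weight_def b_def)
    also have "\<dots> = norm z powr - b"
      using powr_diff[of "norm z" 1 "b + 1"] by simp
    finally show ?thesis .
  qed
  also have "\<dots> \<le> ((1/2) ^ Suc j) powr - b"
    using j1 b by (intro powr_mono2') auto
  also have "\<dots> = (2 ^ Suc j) powr b"
    by (simp add: powr_minus powr_divide power_divide field_simps)
  also have "\<dots> = 2 powr b * (2 ^ j) powr b"
    by (simp add: powr_mult)
  also have "\<dots> \<le> 2 * 2 powr (real CARD('n) + s) * (2 ^ j) powr b"
  proof (rule mult_right_mono)
    have "2 powr b \<le> 2 powr (real CARD('n) + s)"
      by (intro powr_mono) (auto simp: b_def)
    then show "2 powr b \<le> 2 * 2 powr (real CARD('n) + s)"
      using powr_ge_zero[of 2 "real CARD('n) + s"] by linarith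
  qed simp
  finally have "ennreal (riesz_weight s z) \<le> ?u j"
    using j2 by (simp add: b_def ennreal_leI)
  also have "?u j \<le> (\<Sum>j. ?u j)"
    by (rule ennreal_le_suminf)
  finally show ?thesis .
qed

lemma riesz_weight_le_outer:
  fixes z :: "real^'n"
  assumes s: "0 < s" and z: "1 \<le> norm z"
  shows "ennreal (riesz_weight s z) \<le> (\<Sum>j. ennreal ((2 ^ j) powr - (real CARD('n) + s)) * indicator (cball 0 (2 ^ Suc j)) z)"
    (is "_ \<le> (\<Sum>j. ?u j)")
proof -
  define a where "a = real CARD('n) + s"
  have a: "0 < a" using s by (simp add: a_def)
  \<comment> \<open>Now the annuli grow: 2^j \<le> |z| < 2^(j+1), which explains the radius
    \<open>2 ^ Suc j\<close> of the ball.\<close>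
  define j where "j = (LEAST j. norm z < 2 ^ Suc j)"
  obtain k where k: "norm z < 2 ^ k"
    using real_arch_pow[of 2 "norm z"] by auto
  have ex: "norm z < 2 ^ Suc k"
    using k by (rule less_le_trans) simp
  have j1: "norm z < 2 ^ Suc j"
    unfolding j_def by (rule LeastI[of _ k]) (fact ex)
  have j2: "2 ^ j \<le> norm z"
  proof (cases j)
    case 0
    then show ?thesis using z by simp
  next
    case (Suc i)
    then have "\<not> norm z < 2 ^ Suc i"
      using not_less_Least[of i "\<lambda>j. norm z < 2 ^ Suc j"] by (simp add: j_def)
    then show ?thesis using Suc by simp
  qed
  have "riesz_weight s z = 1 / norm z powr a"
    using z by (simp add: riesz_weight_def a_def)
  also have "\<dots> = norm z powr - a"
    by (simp add: powr_minus divide_inverse)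
  also have "\<dots> \<le> (2 ^ j) powr - a"
    using j2 a by (intro powr_mono2') auto
  finally have "ennreal (riesz_weight s z) \<le> ?u j"
    using j1 by (simp add: a_def ennreal_leI)
  also have "?u j \<le> (\<Sum>j. ?u j)"
    by (rule ennreal_le_suminf)
  finally show ?thesis .
qed

lemma two_power_powr: "(2 ^ j :: real) powr c = (2 powr c) ^ j"
  by (simp add: powr_power powr_realpow[symmetric] powr_powr mult.commute)

lemma integrable_riesz_weight:
  assumes s: "0 < s" "s < 1"
  shows "integrable lborel (riesz_weight s :: real^'n \<Rightarrow> real)"
proof -
  let ?n = "real CARD('n)"
  let ?u = "\<lambda>j (z::real^'n). ennreal (2 * 2 powr (?n + s) * (2 ^ j) powr (?n + s - 1)) * indicator (cball 0 ((1/2) ^ j)) z"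
  let ?v = "\<lambda>j (z::real^'n). ennreal ((2 ^ j) powr - (?n + s)) * indicator (cball 0 (2 ^ Suc j)) z"
  have "(\<integral>\<^sup>+z. (\<Sum>j. ?u j z) \<partial>lborel) < \<infinity>"
  proof (rule nn_integral_cball_series_finite)
    \<comment> \<open>Multiplied by the volume factor, the inner terms are geometric with ratio
      2^(s-1), which is below 1 because s < 1.\<close>
    have eq: "2 * 2 powr (?n + s) * (2 ^ j) powr (?n + s - 1) * ((1/2) ^ j) ^ DIM(real^'n)
        = 2 * 2 powr (?n + s) * (2 powr (s - 1)) ^ j" for j
    proof -
      have "((1/2) ^ j) ^ DIM(real^'n) = ((2::real) ^ j) powr - ?n"
        by (simp add: powr_minus powr_realpow power_divide field_simps)
      moreover have "(2 ^ j) powr (?n + s - 1) * ((2::real) ^ j) powr - ?n = (2 ^ j) powr (s - 1)"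
        by (simp add: powr_add[symmetric])
      ultimately show ?thesis by (simp add: two_power_powr)
    qed
    have "2 powr (s - 1) < (1::real)"
      using powr_less_mono[of "s - 1" 0 "2::real"] s by simp
    then show "summable (\<lambda>j. 2 * 2 powr (?n + s) * (2 ^ j) powr (?n + s - 1) * ((1/2) ^ j) ^ DIM(real^'n))"
      unfolding eq by (intro summable_mult summable_geometric) simp
  qed auto
  moreover have "(\<integral>\<^sup>+z. (\<Sum>j. ?v j z) \<partial>lborel) < \<infinity>"
  proof (rule nn_integral_cball_series_finite)
    \<comment> \<open>The outer terms are geometric with ratio 2^(-s), which is below 1 because s >
      0.\<close>
    have eq: "(2 ^ j) powr - (?n + s) * (2 ^ Suc j) ^ DIM(real^'n) = 2 ^ CARD('n) * (2 powr - s) ^ j" for j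
    proof -
      have "(2 ^ Suc j) ^ DIM(real^'n) = 2 ^ CARD('n) * ((2::real) ^ j) powr ?n"
        by (simp add: powr_realpow power_mult_distrib)
      moreover have "(2 ^ j) powr - (?n + s) * ((2::real) ^ j) powr ?n = (2 ^ j) powr - s"
        by (simp add: powr_add[symmetric])
      ultimately show ?thesis by (simp add: two_power_powr)
    qed
    have "2 powr - s < (1::real)"
      using powr_less_mono[of "- s" 0 "2::real"] s by simp
    then show "summable (\<lambda>j. (2 ^ j) powr - (?n + s) * (2 ^ Suc j) ^ DIM(real^'n))"
      unfolding eq by (intro summable_mult summable_geometric) simp
  qed auto
  ultimately have fin: "(\<integral>\<^sup>+z. (\<Sum>j. ?u j z) \<partial>lborel) + (\<integral>\<^sup>+z. (\<Sum>j. ?v j z) \<partial>lborel) < \<infinity>"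
    by simp
  have [measurable]: "cball 0 r \<in> sets (borel :: (real^'n) measure)" for r by simp
  have "(\<integral>\<^sup>+z. ennreal (norm (riesz_weight s (z::real^'n))) \<partial>lborel)
      \<le> (\<integral>\<^sup>+z. (\<Sum>j. ?u j z) + (\<Sum>j. ?v j z) \<partial>lborel)"
  proof (rule nn_integral_mono)
    fix z :: "real^'n"
    show "ennreal (norm (riesz_weight s z)) \<le> (\<Sum>j. ?u j z) + (\<Sum>j. ?v j z)"
    proof (cases "norm z < 1")
      case True
      then have "ennreal (norm (riesz_weight s z)) \<le> (\<Sum>j. ?u j z)"
        using riesz_weight_le_inner[OF s, of z] riesz_weight_nonneg[of s z] by simp
      also have "\<dots> \<le> (\<Sum>j. ?u j z) + (\<Sum>j. ?v j z)" by simp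
      finally show ?thesis .
    next
      case False
      then have "ennreal (norm (riesz_weight s z)) \<le> (\<Sum>j. ?v j z)"
        using riesz_weight_le_outer[OF s(1), of z] riesz_weight_nonneg[of s z] by simp
      also have "\<dots> \<le> (\<Sum>j. ?u j z) + (\<Sum>j. ?v j z)" by simp
      finally show ?thesis .
    qed
  qed
  also have "\<dots> = (\<integral>\<^sup>+z. (\<Sum>j. ?u j z) \<partial>lborel) + (\<integral>\<^sup>+z. (\<Sum>j. ?v j z) \<partial>lborel)"
    by (rule nn_integral_add) measurable
  finally have "(\<integral>\<^sup>+z. ennreal (norm (riesz_weight s (z::real^'n))) \<partial>lborel) < \<infinity>"
    using fin by (rule le_less_trans)
  then show ?thesis
    by (rule integrableI_bounded[rotated]) simp
qed

section \<open>The Schur test\<close>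

text \<open>Write k = k^(1/q) k^(1/p) with p conjugate to q. The Holder inequality in y uses the
  bound on the integrals over y, and Tonelli then uses the bound on the integrals over x. Absolute
  convergence for almost every x is a conclusion of its own, since linearity of the operator rests
  on it.\<close>

lemma Lp_Schur_test:
  fixes w :: "'a \<Rightarrow> real" and K :: "'a \<Rightarrow> 'a \<Rightarrow> 'b::euclidean_space" and k :: "'a \<Rightarrow> 'a \<Rightarrow> real"
  assumes q: "1 < q" and sf: "sigma_finite_measure M"
    and K[measurable]: "(\<lambda>(x,y). K x y) \<in> borel_measurable (M \<Otimes>\<^sub>M M)"
    and k[measurable]: "(\<lambda>(x,y). k x y) \<in> borel_measurable (M \<Otimes>\<^sub>M M)"
    and Kk: "\<And>x y. norm (K x y) \<le> k x y"
    and A: "0 < A" "\<And>x. (\<integral>\<^sup>+y. ennreal (k x y) \<partial>M) \<le> ennreal A" "\<And>y. (\<integral>\<^sup>+x. ennreal (k x y) \<partial>M) \<le> ennreal A"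
    and w: "w \<in> Lp q M"
  defines "R \<equiv> \<lambda>x. LINT y|M. w y *\<^sub>R K x y"
  shows "AE x in M. integrable M (\<lambda>y. w y *\<^sub>R K x y)"
    and "R \<in> Lp q M" and "Lp_norm q M R \<le> A * Lp_norm q M w"
proof -
  interpret pair_sigma_finite M M using sf by (simp add: pair_sigma_finite_def)
  define p where "p = conj_exp q"
  have p: "1 < p" "1 / q + 1 / p = 1" using conj_exp_gt_1[OF q] inverse_conj_exp[OF q] by (auto simp: p_def)
  note [measurable] = LpD(1)[OF w]
  have k0: "0 \<le> k x y" for x y using Kk[of x y] norm_ge_zero order_trans by blast
  \<comment> \<open>This is the q-th power of |w(y)| k(x,y)^(1/q), the first Holder factor below.
    Its integrability over pairs is settled first, to know that almost every slice is
    integrable.\<close>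
  define g where "g x y = norm (w y) powr q * k x y" for x y
  have g0: "0 \<le> g x y" for x y by (simp add: g_def k0)
  have [measurable]: "(\<lambda>(x,y). g x y) \<in> borel_measurable (M \<Otimes>\<^sub>M M)"
    unfolding g_def by measurable
  have "(\<integral>\<^sup>+x. \<integral>\<^sup>+y. ennreal (g x y) \<partial>M \<partial>M) = (\<integral>\<^sup>+y. \<integral>\<^sup>+x. ennreal (g x y) \<partial>M \<partial>M)"
    by (rule Fubini') measurable
  also have "\<dots> = (\<integral>\<^sup>+y. ennreal (norm (w y) powr q) * (\<integral>\<^sup>+x. ennreal (k x y) \<partial>M) \<partial>M)"
    by (rule nn_integral_cong) (simp add: g_def ennreal_mult k0 nn_integral_cmult)
  also have "\<dots> \<le> (\<integral>\<^sup>+y. ennreal (norm (w y) powr q) * ennreal A \<partial>M)"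
    by (intro nn_integral_mono mult_left_mono A) simp
  also have "\<dots> = ennreal (A * (LINT y|M. norm (w y) powr q))"
    using LpD(2)[OF w] A(1)
    by (subst nn_integral_multc) (simp_all add: nn_integral_eq_integral ennreal_mult mult.commute)
  finally have I: "(\<integral>\<^sup>+x. \<integral>\<^sup>+y. ennreal (g x y) \<partial>M \<partial>M) \<le> ennreal (A * (LINT y|M. norm (w y) powr q))" .
  have int: "integrable (M \<Otimes>\<^sub>M M) (\<lambda>(x,y). g x y)"
  proof (rule integrableI_nonneg)
    have "(\<integral>\<^sup>+z. ennreal (case z of (x, y) \<Rightarrow> g x y) \<partial>(M \<Otimes>\<^sub>M M)) = (\<integral>\<^sup>+x. \<integral>\<^sup>+y. ennreal (g x y) \<partial>M \<partial>M)"
      by (subst sigma_finite_measure.nn_integral_fst[OF sf, symmetric]) auto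
    also note I
    finally show "(\<integral>\<^sup>+z. ennreal (case z of (x, y) \<Rightarrow> g x y) \<partial>(M \<Otimes>\<^sub>M M)) < \<infinity>"
      by (rule le_less_trans) simp
  qed (use g0 in auto)
  have gx: "AE x in M. integrable M (\<lambda>y. g x y)" and intg: "integrable M (\<lambda>x. LINT y|M. g x y)"
    using AE_integrable_fst'[OF int] integrable_fst'[OF int] by simp_all
  have Ig: "(LINT x|M. LINT y|M. g x y) \<le> A * (LINT y|M. norm (w y) powr q)"
  proof -
    have "ennreal (LINT x|M. LINT y|M. g x y) = (\<integral>\<^sup>+x. ennreal (LINT y|M. g x y) \<partial>M)"
      by (rule nn_integral_eq_integral[symmetric]) (use intg g0 in auto)
    also have "\<dots> = (\<integral>\<^sup>+x. \<integral>\<^sup>+y. ennreal (g x y) \<partial>M \<partial>M)"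
      by (rule nn_integral_cong_AE, use gx in eventually_elim) (simp add: nn_integral_eq_integral g0)
    also note I
    finally show ?thesis using A(1) by (subst (asm) ennreal_le_iff) auto
  qed
  have kint: "integrable M (\<lambda>y. k x y)" "(LINT y|M. k x y) \<le> A" if "x \<in> space M" for x
  proof -
    have [measurable]: "k x \<in> borel_measurable M" using that by measurable
    show *: "integrable M (\<lambda>y. k x y)"
      using le_less_trans[OF A(2)[of x]] k0 by (intro integrableI_nonneg) auto
    have "ennreal (LINT y|M. k x y) \<le> ennreal A"
      using A(2)[of x] by (subst nn_integral_eq_integral[symmetric]) (use * k0 in auto)
    then show "(LINT y|M. k x y) \<le> A" using A(1) by (subst (asm) ennreal_le_iff) auto
  qed
  have main: "AE x in M. integrable M (\<lambda>y. w y *\<^sub>R K x y) \<and>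
      norm (R x) powr q \<le> A powr (q / p) * (LINT y|M. g x y)"
    using gx AE_space
  proof eventually_elim
    case (elim x)
    have [measurable]: "k x \<in> borel_measurable M" "K x \<in> borel_measurable M"
      using elim(2) by measurable
    define a where "a y = w y * k x y powr (1/q)" for y
    define b where "b y = k x y powr (1/p)" for y
    have [measurable]: "a \<in> borel_measurable M" "b \<in> borel_measurable M"
      unfolding a_def[abs_def] b_def[abs_def] by measurable
    have aq: "\<bar>a y\<bar> powr q = g x y" for y
      using q k0[of x y] by (simp add: a_def g_def abs_mult powr_mult powr_powr)
    have bp: "\<bar>b y\<bar> powr p = k x y" for y
      using p k0[of x y] by (simp add: b_def powr_powr)
    have aL: "a \<in> Lp q M" using elim(1) by (simp add: Lp_def aq)
    have bL: "b \<in> Lp (conj_exp q) M" using kint(1)[OF elim(2)] by (simp add: Lp_def bp flip: p_def)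
    have ab: "norm (a y) * norm (b y) = \<bar>w y\<bar> * k x y" for y
    proof -
      have "k x y powr (1/q) * k x y powr (1/p) = k x y"
        using p k0[of x y] by (simp flip: powr_add)
      then show ?thesis by (simp add: a_def b_def abs_mult)
    qed
    note H = Holder[OF q aL bL, unfolded ab]
    have int: "integrable M (\<lambda>y. w y *\<^sub>R K x y)"
      by (rule Bochner_Integration.integrable_bound[OF H(1)])
        (use Kk[of x] k0 in \<open>auto intro!: mult_left_mono simp: abs_mult\<close>)
    have "norm (R x) \<le> (LINT y|M. norm (w y *\<^sub>R K x y))"
      unfolding R_def by (rule integral_norm_bound)
    also have "\<dots> \<le> (LINT y|M. \<bar>w y\<bar> * k x y)"
      using integrable_norm[OF int] H(1) Kk[of x]
      by (intro integral_mono) (simp_all add: mult_left_mono)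
    also have "\<dots> \<le> (LINT y|M. g x y) powr (1/q) * (LINT y|M. k x y) powr (1/p)"
      using H(2) by (simp add: Lp_norm_def aq bp flip: p_def)
    also have "\<dots> \<le> (LINT y|M. g x y) powr (1/q) * A powr (1/p)"
      using kint(2)[OF elim(2)] p k0 by (intro mult_left_mono powr_mono2) auto
    finally have "norm (R x) powr q \<le> ((LINT y|M. g x y) powr (1/q) * A powr (1/p)) powr q"
      using q by (intro powr_mono2) auto
    also have "\<dots> = A powr (q / p) * (LINT y|M. g x y)"
      using q g0 by (simp add: powr_mult powr_powr)
    finally show ?case using int by simp
  qed
  then show "AE x in M. integrable M (\<lambda>y. w y *\<^sub>R K x y)" by eventually_elim simp
  have Rm[measurable]: "R \<in> borel_measurable M"
    unfolding R_def by measurable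
  have intb: "integrable M (\<lambda>x. A powr (q / p) * (LINT y|M. g x y))"
    using intg by simp
  have intR: "integrable M (\<lambda>x. norm (R x) powr q)"
  proof (rule Bochner_Integration.integrable_bound[OF intb])
    show "AE x in M. norm (norm (R x) powr q) \<le> norm (A powr (q / p) * (LINT y|M. g x y))"
      using main by eventually_elim auto
  qed measurable
  then show "R \<in> Lp q M" by (simp add: Lp_def)
  have "(LINT x|M. norm (R x) powr q) \<le> (LINT x|M. A powr (q / p) * (LINT y|M. g x y))"
    using intR intb main by (intro integral_mono_AE) auto
  also have "\<dots> = A powr (q / p) * (LINT x|M. LINT y|M. g x y)"
    by simp
  also have "\<dots> \<le> A powr (q / p) * (A * (LINT y|M. norm (w y) powr q))"
    by (intro mult_left_mono Ig) auto
  also have "\<dots> = A powr q * (LINT y|M. norm (w y) powr q)"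
  proof -
    \<comment> \<open>The y-bound contributes A^(q/p) and the x-bound contributes A, together A^q,
      whose q-th root is A.\<close>
    have "q / p + 1 = q"
      using p q by (simp add: p_def conj_exp_def field_simps)
    then have "A powr (q / p) * A = A powr q"
      using A(1) by (metis powr_add powr_one less_imp_le)
    then show ?thesis by (simp flip: mult.assoc)
  qed
  finally have "Lp_norm q M R \<le> (A powr q * (LINT y|M. norm (w y) powr q)) powr (1/q)"
    unfolding Lp_norm_def using q by (intro powr_mono2) auto
  also have "\<dots> = A * Lp_norm q M w"
    using q A(1) by (simp add: Lp_norm_def powr_mult powr_powr)
  finally show "Lp_norm q M R \<le> A * Lp_norm q M w" .
qed

section \<open>The Riesz kernel\<close>

definition riesz_kernel :: "real \<Rightarrow> real^'n \<Rightarrow> real^'n" where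
  "riesz_kernel s z = (1 / norm z powr (real CARD('n) + s + 1)) *\<^sub>R z"

lemma borel_measurable_riesz_kernel [measurable]: "riesz_kernel s \<in> borel_measurable borel"
  unfolding riesz_kernel_def[abs_def] by measurable

lemma riesz_kernel_uminus: "riesz_kernel s (- z) = - riesz_kernel s z"
  by (simp add: riesz_kernel_def)

lemma norm_riesz_kernel: "norm (riesz_kernel s (z::real^'n)) = (if z = 0 then 0 else 1 / norm z powr (real CARD('n) + s))"
proof (cases "z = 0")
  case False
  then have "norm z powr (real CARD('n) + s + 1) = norm z powr (real CARD('n) + s) * norm z"
    by (simp add: powr_add)
  with False show ?thesis by (simp add: riesz_kernel_def)
qed (simp add: riesz_kernel_def)

lemma riesz_grad_eq_kernel:
  "riesz_grad s \<psi> x = riesz_const CARD('n) s *\<^sub>R (LINT y|lebesgue. (\<psi> y - \<psi> x) *\<^sub>R riesz_kernel s (y - (x::real^'n)))"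
  by (simp add: riesz_grad_def riesz_kernel_def)

lemma riesz_kernel_diff_bound:
  assumes "\<And>x. \<bar>f x\<bar> \<le> C" "\<And>x y. \<bar>f y - f x\<bar> \<le> C * norm (y - x)"
  shows "norm ((f y - f x) *\<^sub>R riesz_kernel s (y - x)) \<le> 2 * C * riesz_weight s (y - x)"
proof (cases "y = x")
  case True
  then show ?thesis by (simp add: riesz_weight_def)
next
  case False
  have C: "0 \<le> C" using assms(1) abs_ge_zero order_trans by blast
  have "\<bar>f y - f x\<bar> \<le> 2 * C" using assms(1)[of x] assms(1)[of y] by linarith
  moreover have "\<bar>f y - f x\<bar> \<le> 2 * C * norm (y - x)"
    using assms(2)[of y x] C mult_nonneg_nonneg[of C "norm (y - x)"] by linarith
  ultimately have "\<bar>f y - f x\<bar> \<le> 2 * C * min 1 (norm (y - x))"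
    by (simp add: min_def)
  then have "\<bar>f y - f x\<bar> / norm (y - x) powr (real CARD('a) + s)
      \<le> 2 * C * min 1 (norm (y - x)) / norm (y - x) powr (real CARD('a) + s)"
    by (rule divide_right_mono) simp
  then show ?thesis using False by (simp add: norm_riesz_kernel riesz_weight_def)
qed

text \<open>For integrals over pairs (x, y) a majorant in y - x alone is too large. The indicators
  record that the difference vanishes unless one of the two points lies in the support.\<close>

lemma riesz_kernel_diff_bound_supp:
  assumes "\<And>x. \<bar>f x\<bar> \<le> C" "\<And>x y. \<bar>f y - f x\<bar> \<le> C * norm (y - x)" "\<And>x. x \<notin> K \<Longrightarrow> f x = 0"
  shows "norm ((f y - f x) *\<^sub>R riesz_kernel s (y - x)) \<le> 2 * C * (riesz_weight s (y - x) * (indicator K x + indicator K y))"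
proof (cases "x \<in> K \<or> y \<in> K")
  case True
  have C: "0 \<le> C" using assms(1) abs_ge_zero order_trans by blast
  have "riesz_weight s (y - x) * 1 \<le> riesz_weight s (y - x) * (indicator K x + indicator K y)"
    using True by (intro mult_left_mono riesz_weight_nonneg) (auto simp: indicator_def)
  then have "2 * C * riesz_weight s (y - x) \<le> 2 * C * (riesz_weight s (y - x) * (indicator K x + indicator K y))"
    using C by (intro mult_left_mono) auto
  with riesz_kernel_diff_bound[OF assms(1,2), of y x s] show ?thesis by linarith
next
  case False
  then show ?thesis using assms(3) by simp
qed

text \<open>The type token fixes the dimension, which neither s nor the real result would
  determine.\<close>

definition riesz_mass :: "'n::finite itself \<Rightarrow> real \<Rightarrow> real" where
  "riesz_mass _ s = (LINT z|lborel. riesz_weight s (z::real^'n))"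

lemma riesz_mass_nonneg: "0 \<le> riesz_mass TYPE('n::finite) s"
  unfolding riesz_mass_def by (simp add: riesz_weight_nonneg)

lemma nn_integral_lborel_translate:
  fixes x :: "'a::euclidean_space"
  assumes [measurable]: "f \<in> borel_measurable borel"
  shows "(\<integral>\<^sup>+y. f (y - x) \<partial>lborel) = (\<integral>\<^sup>+y. f y \<partial>lborel)"
proof -
  have "(\<integral>\<^sup>+y. f y \<partial>lborel) = (\<integral>\<^sup>+y. f y \<partial>distr lborel borel ((+) (- x)))"
    by (simp add: lborel_distr_plus)
  also have "\<dots> = (\<integral>\<^sup>+y. f (- x + y) \<partial>lborel)"
    by (rule nn_integral_distr) auto
  finally show ?thesis by simp
qed

lemma nn_integral_riesz_weight:
  fixes x :: "real^'n"
  assumes s: "0 < s" "s < 1"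
  shows "(\<integral>\<^sup>+y. ennreal (riesz_weight s (y - x)) \<partial>lborel) = ennreal (riesz_mass TYPE('n) s)"
    and "(\<integral>\<^sup>+y. ennreal (riesz_weight s (x - y)) \<partial>lborel) = ennreal (riesz_mass TYPE('n) s)"
proof -
  show *: "(\<integral>\<^sup>+y. ennreal (riesz_weight s (y - x)) \<partial>lborel) = ennreal (riesz_mass TYPE('n) s)" for x :: "real^'n"
    using nn_integral_lborel_translate[of "\<lambda>y. ennreal (riesz_weight s y)" x]
    by (simp add: riesz_mass_def nn_integral_eq_integral[OF integrable_riesz_weight[OF s]] riesz_weight_nonneg)
  show "(\<integral>\<^sup>+y. ennreal (riesz_weight s (x - y)) \<partial>lborel) = ennreal (riesz_mass TYPE('n) s)"
    using *[of x] riesz_weight_uminus[of s "x - _"] by simp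
qed

lemma integrable_riesz_weight_translate:
  fixes x :: "real^'n"
  assumes s: "0 < s" "s < 1"
  shows "integrable lborel (\<lambda>y. riesz_weight s (y - x))"
proof (rule integrableI_nonneg)
  show "(\<integral>\<^sup>+y. ennreal (riesz_weight s (y - x)) \<partial>lborel) < \<infinity>"
    unfolding nn_integral_riesz_weight(1)[OF s] by simp
qed (simp_all add: riesz_weight_nonneg)

lemma integrable_lborel_pairI:
  fixes h :: "'a::euclidean_space \<Rightarrow> 'b::euclidean_space \<Rightarrow> real"
  assumes [measurable]: "(\<lambda>(x,y). h x y) \<in> borel_measurable (lborel \<Otimes>\<^sub>M lborel)"
    and "\<And>x y. 0 \<le> h x y" and "(\<integral>\<^sup>+x. \<integral>\<^sup>+y. ennreal (h x y) \<partial>lborel \<partial>lborel) < \<infinity>"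
  shows "integrable (lborel \<Otimes>\<^sub>M lborel) (\<lambda>(x,y). h x y)"
proof (rule integrableI_nonneg)
  have "(\<integral>\<^sup>+z. ennreal (case z of (x, y) \<Rightarrow> h x y) \<partial>(lborel \<Otimes>\<^sub>M lborel)) = (\<integral>\<^sup>+x. \<integral>\<^sup>+y. ennreal (h x y) \<partial>lborel \<partial>lborel)"
    by (subst lborel.nn_integral_fst[symmetric]) auto
  then show "(\<integral>\<^sup>+z. ennreal (case z of (x, y) \<Rightarrow> h x y) \<partial>(lborel \<Otimes>\<^sub>M lborel)) < \<infinity>"
    using assms(3) by simp
qed (use assms(2) in auto)

text \<open>The same majorant in two coordinate systems: (x, y) for the gradient and the commutator,
  and (x, z) with z = y - x for the mean value of the gradient. Each indicator contributes the mass
  of the weight times the finite measure of K.\<close>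

lemma integrable_riesz_weight_indicator:
  fixes K :: "(real^'n) set"
  assumes s: "0 < s" "s < 1" and K: "compact K"
  shows "integrable (lborel \<Otimes>\<^sub>M lborel) (\<lambda>(x,z). riesz_weight s z * (indicator K x + indicator K (x + z)))"
    and "integrable (lborel \<Otimes>\<^sub>M lborel) (\<lambda>(x,y). riesz_weight s (y - x) * (indicator K x + indicator K y))"
proof -
  have [measurable]: "K \<in> sets borel" using K by (simp add: borel_compact)
  have fin: "emeasure lborel K < \<infinity>" using K by (rule emeasure_compact_finite)
  define m where "m = ennreal (riesz_mass TYPE('n) s)"
  note w = nn_integral_riesz_weight[OF s, where 'n='n, folded m_def]
  have w0: "(\<integral>\<^sup>+z. ennreal (riesz_weight s (z :: real^'n)) \<partial>lborel) = m"
    using w(1)[of 0] by simp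
  have split: "ennreal (riesz_weight s z * (indicator K a + indicator K b))
      = ennreal (riesz_weight s z) * indicator K a + ennreal (riesz_weight s z) * indicator K b" for z a b :: "real^'n"
    by (simp add: indicator_def riesz_weight_nonneg flip: ennreal_plus)
  have m: "m < \<infinity>" by (simp add: m_def)
  have K': "(\<integral>\<^sup>+x. indicator K x * m \<partial>lborel) < \<infinity>" "(\<integral>\<^sup>+x. m * indicator K x \<partial>lborel) < \<infinity>"
    using fin m by (simp_all add: nn_integral_multc nn_integral_cmult ennreal_mult_less_top)
  show "integrable (lborel \<Otimes>\<^sub>M lborel) (\<lambda>(x,z). riesz_weight s z * (indicator K x + indicator K (x + z)))"
  proof (rule integrable_lborel_pairI)
    have 1: "(\<integral>\<^sup>+x. \<integral>\<^sup>+z. ennreal (riesz_weight s (z::real^'n)) * indicator K x \<partial>lborel \<partial>lborel) < \<infinity>"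
      using K' by (simp add: nn_integral_multc w0)
    have "(\<integral>\<^sup>+x. \<integral>\<^sup>+z. ennreal (riesz_weight s z) * indicator K (x + z) \<partial>lborel \<partial>lborel)
        = (\<integral>\<^sup>+z. \<integral>\<^sup>+x. ennreal (riesz_weight s z) * indicator K (x + z) \<partial>lborel \<partial>lborel)"
      by (rule lborel_pair.Fubini'[symmetric]) measurable
    also have "\<dots> = (\<integral>\<^sup>+z. ennreal (riesz_weight s z) * (\<integral>\<^sup>+x. indicator K (x + z) \<partial>lborel) \<partial>lborel)"
      by (intro nn_integral_cong nn_integral_cmult) measurable
    also have "\<dots> = (\<integral>\<^sup>+z. ennreal (riesz_weight s z) * emeasure lborel K \<partial>(lborel :: (real^'n) measure))"
    proof -
      have "(\<integral>\<^sup>+x. indicator K (x + z) \<partial>lborel) = emeasure lborel K" for z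
        using nn_integral_lborel_translate[of "indicator K" "- z"] by simp
      then show ?thesis by simp
    qed
    also have "\<dots> < \<infinity>"
      using fin m by (simp add: nn_integral_multc w0 ennreal_mult_less_top)
    finally have 2: "(\<integral>\<^sup>+x. \<integral>\<^sup>+z. ennreal (riesz_weight s z) * indicator K (x + z) \<partial>lborel \<partial>lborel) < \<infinity>" .
    have "(\<integral>\<^sup>+x. \<integral>\<^sup>+z. ennreal (riesz_weight s z * (indicator K x + indicator K (x + z))) \<partial>lborel \<partial>lborel)
       = (\<integral>\<^sup>+x. \<integral>\<^sup>+z. ennreal (riesz_weight s (z::real^'n)) * indicator K x \<partial>lborel \<partial>lborel)
       + (\<integral>\<^sup>+x. \<integral>\<^sup>+z. ennreal (riesz_weight s z) * indicator K (x + z) \<partial>lborel \<partial>lborel)"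
      unfolding split by (simp add: nn_integral_add)
    then show "(\<integral>\<^sup>+x. \<integral>\<^sup>+z. ennreal (riesz_weight s z * (indicator K x + indicator K (x + z))) \<partial>lborel \<partial>lborel) < \<infinity>"
      using 1 2 by simp
  qed (auto simp: riesz_weight_nonneg)
  show "integrable (lborel \<Otimes>\<^sub>M lborel) (\<lambda>(x,y). riesz_weight s (y - x) * (indicator K x + indicator K y))"
  proof (rule integrable_lborel_pairI)
    have 1: "(\<integral>\<^sup>+x. \<integral>\<^sup>+y. ennreal (riesz_weight s (y - x)) * indicator K x \<partial>lborel \<partial>lborel) < \<infinity>"
      using K' by (simp add: nn_integral_multc w)
    have "(\<integral>\<^sup>+x. \<integral>\<^sup>+y. ennreal (riesz_weight s (y - x)) * indicator K y \<partial>lborel \<partial>lborel)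
        = (\<integral>\<^sup>+y. \<integral>\<^sup>+x. ennreal (riesz_weight s (y - x)) * indicator K y \<partial>lborel \<partial>lborel)"
      by (rule lborel_pair.Fubini'[symmetric]) measurable
    also have "\<dots> < \<infinity>"
      using K' by (simp add: nn_integral_multc w)
    finally have 2: "(\<integral>\<^sup>+x. \<integral>\<^sup>+y. ennreal (riesz_weight s (y - x)) * indicator K y \<partial>lborel \<partial>lborel) < \<infinity>" .
    have "(\<integral>\<^sup>+x. \<integral>\<^sup>+y. ennreal (riesz_weight s (y - x) * (indicator K x + indicator K y)) \<partial>lborel \<partial>lborel)
       = (\<integral>\<^sup>+x. \<integral>\<^sup>+y. ennreal (riesz_weight s (y - x)) * indicator K x \<partial>lborel \<partial>lborel)
       + (\<integral>\<^sup>+x. \<integral>\<^sup>+y. ennreal (riesz_weight s (y - x)) * indicator K y \<partial>lborel \<partial>lborel)"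
      unfolding split by (simp add: nn_integral_add)
    then show "(\<integral>\<^sup>+x. \<integral>\<^sup>+y. ennreal (riesz_weight s (y - x) * (indicator K x + indicator K y)) \<partial>lborel \<partial>lborel) < \<infinity>"
      using 1 2 by simp
  qed (auto simp: riesz_weight_nonneg)
qed

section \<open>The fundamental lemma of the calculus of variations\<close>

lemma lipschitz_cs_continuous: "lipschitz_cs f \<Longrightarrow> continuous_on UNIV f"
  by (auto simp: lipschitz_cs_def intro: lipschitz_on_continuous_on)

lemma lipschitz_cs_measurable:
  assumes "lipschitz_cs f"
  shows "f \<in> borel_measurable borel"
  using lipschitz_cs_continuous[OF assms] by (rule borel_measurable_continuous_onI)

lemma indicator_Lp:
  assumes "A \<in> sets M" "emeasure M A < \<infinity>"
  shows "(\<lambda>x. indicator A x :: real) \<in> Lp p M"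
    and "Lp_norm p M (\<lambda>x. indicator A x :: real) = measure M A powr (1/p)"
proof -
  have eq: "(indicator A x :: real) powr p = indicator A x" for x
    by (simp add: indicator_def)
  show "(\<lambda>x. indicator A x :: real) \<in> Lp p M"
    using assms by (simp add: Lp_def eq integrable_indicator_iff)
  show "Lp_norm p M (\<lambda>x. indicator A x :: real) = measure M A powr (1/p)"
    using assms sets.sets_into_space[OF assms(1)] by (simp add: Lp_norm_def eq Int_absorb2)
qed

lemma lipschitz_cs_Lp:
  assumes f: "lipschitz_cs f" and p: "0 < p"
  shows "f \<in> Lp p lebesgue"
proof -
  obtain C K where C: "0 < C" and K: "compact K" "\<And>x. x \<notin> K \<Longrightarrow> f x = 0" and b: "\<And>x. \<bar>f x\<bar> \<le> C"
    using lipschitz_cs_bound[OF f] by metis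
  have K': "K \<in> sets lebesgue" "emeasure lebesgue K < \<infinity>"
    using K(1) emeasure_compact_finite[OF K(1)] by (simp_all add: borel_compact)
  show ?thesis
  proof (rule Lp_bound(1)[OF indicator_Lp(1)[OF K'], where C=C])
    show "f \<in> borel_measurable lebesgue"
      using lipschitz_cs_measurable[OF f] by (simp add: measurable_completion)
    show "norm (f x) \<le> C * norm (indicator K x :: real)" for x
      using b[of x] K(2)[of x] by (cases "x \<in> K") auto
  qed (use C p in auto)
qed

text \<open>The distance to the complement is 1-Lipschitz and vanishes off U, so its truncated
  multiples are admissible test functions that approximate the indicator of U.\<close>

lemma lipschitz_cs_cutoff:
  fixes U :: "'a::euclidean_space set"
  assumes U: "open U" "bounded U"
  shows "lipschitz_cs (\<lambda>x. min 1 (real j * infdist x (- U)))"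
proof (rule lipschitz_csI[of "real j" _ "closure U"])
  have "- U \<noteq> {}" using U(2) by (metis Compl_empty_eq double_complement not_bounded_UNIV)
  fix x y :: 'a
  have "\<bar>infdist y (- U) - infdist x (- U)\<bar> \<le> norm (y - x)"
    using infdist_triangle_abs[of y "- U" x] by (simp add: dist_norm)
  then have "\<bar>real j * infdist y (- U) - real j * infdist x (- U)\<bar> \<le> real j * norm (y - x)"
    by (simp add: abs_mult mult_left_mono flip: right_diff_distrib)
  then show "\<bar>min 1 (real j * infdist y (- U)) - min 1 (real j * infdist x (- U))\<bar> \<le> real j * norm (y - x)"
    by linarith
next
  fix x assume "x \<notin> closure U"
  then have "x \<in> - U" using closure_subset by auto
  then show "min 1 (real j * infdist x (- U)) = 0" by simp
qed (use U in auto)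

lemma lipschitz_cs_cutoff_tendsto:
  assumes U: "open U" "bounded U"
  shows "(\<lambda>j. min 1 (real j * infdist x (- U))) \<longlonglongrightarrow> indicator U (x::'a::euclidean_space)"
proof (cases "x \<in> U")
  case True
  \<comment> \<open>Boundedness of U matters: \<open>infdist\<close> to the empty set is 0 by
    default, so for U = \<open>UNIV\<close> all cutoffs would vanish.\<close>
  have ne: "- U \<noteq> {}" using U(2) by (metis Compl_empty_eq double_complement not_bounded_UNIV)
  have "infdist x (- U) \<noteq> 0"
    using True U(1) in_closed_iff_infdist_zero[of "- U" x] ne by auto
  then have pos: "0 < infdist x (- U)" using infdist_nonneg[of x "- U"] by linarith
  obtain N where N: "1 < real N * infdist x (- U)" using reals_Archimedean3[OF pos] by blast
  have "\<forall>\<^sub>F j in sequentially. min 1 (real j * infdist x (- U)) = 1"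
  proof (rule eventually_sequentiallyI)
    fix j assume "N \<le> j"
    then have "real N * infdist x (- U) \<le> real j * infdist x (- U)"
      using pos by (intro mult_right_mono) auto
    with N show "min 1 (real j * infdist x (- U)) = 1" by simp
  qed
  then show ?thesis using True by (simp add: tendsto_eventually)
next
  case False
  then show ?thesis by simp
qed

lemma Lp_scaleR_integrable:
  assumes "1 < q" "f \<in> Lp q M" "g \<in> Lp (conj_exp q) M"
  shows "integrable M (\<lambda>x. g x *\<^sub>R f x)" 
    "norm (LINT x|M. g x *\<^sub>R f x) \<le> Lp_norm q M f * Lp_norm (conj_exp q) M g"
proof -
  note [measurable] = LpD(1)[OF assms(2)] LpD(1)[OF assms(3)]
  note H = Holder[OF assms]
  show int: "integrable M (\<lambda>x. g x *\<^sub>R f x)"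
    by (rule Bochner_Integration.integrable_bound[OF H(1)]) (auto simp: abs_mult mult.commute)
  have "norm (LINT x|M. g x *\<^sub>R f x) \<le> (LINT x|M. norm (g x *\<^sub>R f x))"
    by (rule integral_norm_bound)
  also have "\<dots> = (LINT x|M. norm (f x) * norm (g x))"
    by (simp add: mult.commute)
  finally show "norm (LINT x|M. g x *\<^sub>R f x) \<le> Lp_norm q M f * Lp_norm (conj_exp q) M g"
    using H(2) by linarith
qed

text \<open>Cutoffs reach bounded open sets by dominated convergence, and outer regularity then
  reaches measurable sets, with the Holder inequality controlling the excess.\<close>

lemma fundamental_lemma_indicator:
  fixes f :: "'a::euclidean_space \<Rightarrow> 'b::euclidean_space"
  assumes q: "1 < q" and f: "f \<in> Lp q lebesgue"
    and zero: "\<And>\<eta>. lipschitz_cs \<eta> \<Longrightarrow> (LINT x|lebesgue. \<eta> x *\<^sub>R f x) = 0"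
    and A: "A \<in> sets lebesgue" "A \<subseteq> ball 0 R"
  shows "(LINT x|lebesgue. indicator A x *\<^sub>R f x) = 0"
proof -
  define p where "p = conj_exp q"
  have p: "1 < p" using conj_exp_gt_1[OF q] by (simp add: p_def)
  note [measurable] = LpD(1)[OF f]
  have ind: "(\<lambda>x. indicator B x :: real) \<in> Lp p lebesgue" if "B \<in> sets lebesgue" "B \<subseteq> ball 0 R" for B :: "'a set"
  proof (rule indicator_Lp(1)[OF that(1)])
    have "emeasure lebesgue B \<le> emeasure lebesgue (ball 0 R :: 'a set)"
      using that by (intro emeasure_mono) auto
    also have "\<dots> < \<infinity>" using emeasure_bounded_finite[of "ball 0 R :: 'a set"] by simp
    finally show "emeasure lebesgue B < \<infinity>" .
  qed
  have int: "integrable lebesgue (\<lambda>x. indicator B x *\<^sub>R f x)" if "B \<in> sets lebesgue" "B \<subseteq> ball 0 R" for B :: "'a set"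
    using Lp_scaleR_integrable(1)[OF q f ind[OF that, unfolded p_def]] .
  have open0: "(LINT x|lebesgue. indicator U x *\<^sub>R f x) = 0" if U: "open U" "U \<subseteq> ball 0 R" for U
  proof -
    have bU: "bounded U" using U(2) bounded_subset bounded_ball by blast
    have [measurable]: "U \<in> sets lebesgue" using U(1) by simp
    let ?\<eta> = "\<lambda>j x. min 1 (real j * infdist x (- U))"
    have "(\<lambda>j. LINT x|lebesgue. ?\<eta> j x *\<^sub>R f x) \<longlonglongrightarrow> (LINT x|lebesgue. indicator U x *\<^sub>R f x)"
    proof (rule integral_dominated_convergence[where w="\<lambda>x. norm (indicator U x *\<^sub>R f x)"])
      show "(\<lambda>x. ?\<eta> j x *\<^sub>R f x) \<in> borel_measurable lebesgue" for j
        using lipschitz_cs_measurable[OF lipschitz_cs_cutoff[OF U(1) bU, of j]]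
        by (intro borel_measurable_scaleR) (simp_all add: measurable_completion)
      show "integrable lebesgue (\<lambda>x. norm (indicator U x *\<^sub>R f x))"
        using int[OF _ U(2)] by (intro integrable_norm) simp
      show "AE x in lebesgue. (\<lambda>j. ?\<eta> j x *\<^sub>R f x) \<longlonglongrightarrow> indicator U x *\<^sub>R f x"
        by (intro AE_I2 tendsto_scaleR lipschitz_cs_cutoff_tendsto U bU tendsto_const)
      show "AE x in lebesgue. norm (?\<eta> j x *\<^sub>R f x) \<le> norm (indicator U x *\<^sub>R f x)" for j
      proof (rule AE_I2)
        fix x
        show "norm (?\<eta> j x *\<^sub>R f x) \<le> norm (indicator U x *\<^sub>R f x)"
        proof (cases "x \<in> U")
          case True
          have "\<bar>?\<eta> j x\<bar> \<le> 1" using infdist_nonneg[of x "- U"] by auto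
          with True show ?thesis by (simp add: mult_left_le_one_le)
        qed simp
      qed
    qed simp
    moreover have "(LINT x|lebesgue. ?\<eta> j x *\<^sub>R f x) = 0" for j
      by (rule zero[OF lipschitz_cs_cutoff[OF U(1) bU]])
    ultimately show ?thesis by (simp add: LIMSEQ_const_iff)
  qed
  have "norm (LINT x|lebesgue. indicator A x *\<^sub>R f x) \<le> Lp_norm q lebesgue f * \<delta>" if \<delta>: "0 < \<delta>" for \<delta>
  proof -
    \<comment> \<open>The excess measure is taken below \<open>\<delta> powr p\<close> because the
      L^p norm of an indicator is the p-th root of its measure.\<close>
    obtain V where V: "open V" "A \<subseteq> V" "V - A \<in> lmeasurable" "emeasure lebesgue (V - A) < ennreal (\<delta> powr p)"
      using sets_lebesgue_outer_open[OF A(1), of "\<delta> powr p"] \<delta> by auto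
    define W where "W = V \<inter> ball 0 R"
    have W: "open W" "W \<subseteq> ball 0 R" "A \<subseteq> W" using V A by (auto simp: W_def)
    have Wl: "W \<in> sets lebesgue" using W(1) by simp
    have WA: "W - A \<in> sets lebesgue" "W - A \<subseteq> ball 0 R" using Wl A W by auto
    have "(LINT x|lebesgue. indicator W x *\<^sub>R f x) = (LINT x|lebesgue. indicator A x *\<^sub>R f x + indicator (W - A) x *\<^sub>R f x)"
      using W(3) by (intro Bochner_Integration.integral_cong) (auto simp: indicator_def)
    also have "\<dots> = (LINT x|lebesgue. indicator A x *\<^sub>R f x) + (LINT x|lebesgue. indicator (W - A) x *\<^sub>R f x)"
      by (rule Bochner_Integration.integral_add[OF int[OF A] int[OF WA]])
    finally have "norm (LINT x|lebesgue. indicator A x *\<^sub>R f x) = norm (LINT x|lebesgue. indicator (W - A) x *\<^sub>R f x)"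
      using open0[OF W(1,2)] by (metis add.inverse_unique norm_minus_cancel)
    also have "\<dots> \<le> Lp_norm q lebesgue f * Lp_norm p lebesgue (\<lambda>x. indicator (W - A) x :: real)"
      using Lp_scaleR_integrable(2)[OF q f] ind[OF WA] by (simp add: p_def)
    also have "\<dots> \<le> Lp_norm q lebesgue f * \<delta>"
    proof (intro mult_left_mono Lp_norm_nonneg)
      have em: "emeasure lebesgue (W - A) < ennreal (\<delta> powr p)"
        using V(3) WA by (intro le_less_trans[OF emeasure_mono V(4)]) (auto simp: W_def)
      have fin: "emeasure lebesgue (W - A) < \<infinity>" using em by (rule less_trans) simp
      have "measure lebesgue (W - A) \<le> \<delta> powr p"
        using em fin by (simp add: measure_def enn2real_leI less_imp_le)
      then have "measure lebesgue (W - A) powr (1/p) \<le> (\<delta> powr p) powr (1/p)"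
        using p by (intro powr_mono2) auto
      also have "\<dots> = \<delta>" using p \<delta> by (simp add: powr_powr)
      finally show "Lp_norm p lebesgue (\<lambda>x. indicator (W - A) x :: real) \<le> \<delta>"
        by (simp add: indicator_Lp(2)[OF WA(1) fin])
    qed
    finally show ?thesis .
  qed
  note bound = this
  have "norm (LINT x|lebesgue. indicator A x *\<^sub>R f x) \<le> 0 + e" if "0 < e" for e
  proof -
    define N where "N = Lp_norm q lebesgue f"
    have N: "0 \<le> N" by (simp add: N_def Lp_norm_nonneg)
    \<comment> \<open>Dividing by N + 1 rather than N covers the case where f has norm 0.\<close>
    have "norm (LINT x|lebesgue. indicator A x *\<^sub>R f x) \<le> N * (e / (N + 1))"
      unfolding N_def using that Lp_norm_nonneg[of q lebesgue f] by (intro bound) simp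
    also have "\<dots> \<le> e" using N that by (simp add: divide_simps mult_left_mono)
    finally show ?thesis by simp
  qed
  then have "norm (LINT x|lebesgue. indicator A x *\<^sub>R f x) \<le> 0"
    by (rule field_le_epsilon)
  then show ?thesis by simp
qed

text \<open>An L^q function need not be integrable, so each component is first restricted to a ball.
  Countably many balls and finitely many basis vectors keep the exceptional set null.\<close>

lemma fundamental_lemma:
  fixes f :: "'a::euclidean_space \<Rightarrow> 'b::euclidean_space"
  assumes q: "1 < q" and f: "f \<in> Lp q lebesgue"
    and zero: "\<And>\<eta>. lipschitz_cs \<eta> \<Longrightarrow> (LINT x|lebesgue. \<eta> x *\<^sub>R f x) = 0"
  shows "AE x in lebesgue. f x = 0"
proof -
  have "AE x in lebesgue. indicator (ball 0 (real n)) x * (f x \<bullet> b) = 0" for n :: nat and b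
  proof (rule density_unique_real)
    have [measurable]: "ball (0::'a) (real n) \<in> sets lebesgue" by simp
    have fin: "emeasure lebesgue (ball (0::'a) (real n)) < \<infinity>"
      using emeasure_bounded_finite[of "ball (0::'a) (real n)"] by simp
    have int: "integrable lebesgue (\<lambda>x. indicator (ball 0 (real n)) x *\<^sub>R f x)"
      by (rule Lp_scaleR_integrable(1)[OF q f indicator_Lp(1)[OF _ fin]]) simp
    show "integrable lebesgue (\<lambda>x. indicator (ball 0 (real n)) x * (f x \<bullet> b))"
      using integrable_inner_left[OF int, of b] by simp
    fix A :: "'a set" assume A: "A \<in> sets lebesgue"
    have "(LINT x:A|lebesgue. indicator (ball 0 (real n)) x * (f x \<bullet> b))
        = (LINT x|lebesgue. (indicator (A \<inter> ball 0 (real n)) x *\<^sub>R f x) \<bullet> b)"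
      unfolding set_lebesgue_integral_def
      by (intro Bochner_Integration.integral_cong) (auto simp: indicator_def)
    also have "\<dots> = (LINT x|lebesgue. indicator (A \<inter> ball 0 (real n)) x *\<^sub>R f x) \<bullet> b"
    proof (rule integral_inner_left)
      have "integrable lebesgue (\<lambda>x. indicator A x *\<^sub>R (indicator (ball 0 (real n)) x *\<^sub>R f x))"
        by (rule integrable_mult_indicator[OF A int])
      then show "integrable lebesgue (\<lambda>x. indicator (A \<inter> ball 0 (real n)) x *\<^sub>R f x)"
        by (simp add: indicator_inter_arith)
    qed
    also have "\<dots> = 0"
      using fundamental_lemma_indicator[OF q f zero, of "A \<inter> ball 0 (real n)" "real n"] A by simp
    finally show "(LINT x:A|lebesgue. indicator (ball 0 (real n)) x * (f x \<bullet> b)) = (LINT x:A|lebesgue. 0)"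
      by (simp add: set_lebesgue_integral_def)
  qed simp
  note comp = this
  have "AE x in lebesgue. \<forall>n::nat. \<forall>b\<in>Basis. indicator (ball 0 (real n)) x * (f x \<bullet> b) = 0"
    unfolding AE_all_countable by (intro allI AE_finite_allI finite_Basis comp)
  then show ?thesis
  proof eventually_elim
    case (elim x)
    obtain n :: nat where "norm x < real n" using reals_Archimedean2 by blast
    then have "f x \<bullet> b = 0" if "b \<in> Basis" for b
      using elim[rule_format, OF that, of n] by simp
    then show ?case using euclidean_all_zero_iff by blast
  qed
qed

text \<open>Stated for a general bilinear product because it is applied to scalar multiplication in
  either order and to the inner product.\<close>

lemma Lp_tendsto_integral:
  fixes f :: "nat \<Rightarrow> 'a \<Rightarrow> 'b::euclidean_space" and h :: "'a \<Rightarrow> 'c::euclidean_space"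
    and prod :: "'b \<Rightarrow> 'c \<Rightarrow> 'd::euclidean_space"
  assumes prod: "bounded_bilinear prod" and q: "1 < q" and f: "Lp_tendsto q M f g" and h: "h \<in> Lp (conj_exp q) M"
  shows "(\<lambda>k. LINT x|M. prod (f k x) (h x)) \<longlonglongrightarrow> (LINT x|M. prod (g x) (h x))"
proof -
  interpret bounded_bilinear prod by fact
  obtain B where B: "0 < B" "\<And>a b. norm (prod a b) \<le> norm a * norm b * B"
    using pos_bounded by blast
  note fg = f[unfolded Lp_tendsto_def]
  have meas: "(\<lambda>x. prod (u x) (h x)) \<in> borel_measurable M" if "u \<in> Lp q M" for u
    using borel_measurable_continuous_Pair[OF LpD(1)[OF that] LpD(1)[OF h], of prod]
    by (simp add: isCont continuous_on_eq_continuous_at split_beta' continuous_at_imp_continuous_on bounded_bilinear_axioms)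
  have int: "integrable M (\<lambda>x. prod (u x) (h x))"
    and bound: "norm (LINT x|M. prod (u x) (h x)) \<le> B * (Lp_norm q M u * Lp_norm (conj_exp q) M h)"
    if u: "u \<in> Lp q M" for u
  proof -
    note H = Holder[OF q u h]
    show int: "integrable M (\<lambda>x. prod (u x) (h x))"
      by (rule Bochner_Integration.integrable_bound[of _ "\<lambda>x. B * (norm (u x) * norm (h x))"])
        (use H(1) meas[OF u] B in \<open>auto simp: mult.commute\<close>)
    have "norm (LINT x|M. prod (u x) (h x)) \<le> (LINT x|M. norm (prod (u x) (h x)))"
      by (rule integral_norm_bound)
    also have "\<dots> \<le> (LINT x|M. B * (norm (u x) * norm (h x)))"
      using H(1) integrable_norm[OF int] B(2) by (intro integral_mono) (auto simp: mult.commute)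
    also have "\<dots> \<le> B * (Lp_norm q M u * Lp_norm (conj_exp q) M h)"
      using H(2) B(1) by (simp add: mult_left_mono)
    finally show "norm (LINT x|M. prod (u x) (h x)) \<le> B * (Lp_norm q M u * Lp_norm (conj_exp q) M h)" .
  qed
  have "(\<lambda>k. (LINT x|M. prod (f k x) (h x)) - (LINT x|M. prod (g x) (h x))) \<longlonglongrightarrow> 0"
  proof (rule Lim_null_comparison)
    show "\<forall>\<^sub>F k in sequentially. norm ((LINT x|M. prod (f k x) (h x)) - (LINT x|M. prod (g x) (h x)))
        \<le> B * (Lp_norm q M (\<lambda>x. f k x - g x) * Lp_norm (conj_exp q) M h)"
    proof (rule always_eventually, rule allI)
      fix k
      have "(LINT x|M. prod (f k x) (h x)) - (LINT x|M. prod (g x) (h x)) = (LINT x|M. prod (f k x - g x) (h x))"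
        using fg by (simp add: diff_left int)
      then show "norm ((LINT x|M. prod (f k x) (h x)) - (LINT x|M. prod (g x) (h x)))
        \<le> B * (Lp_norm q M (\<lambda>x. f k x - g x) * Lp_norm (conj_exp q) M h)"
        using bound[OF Lp_diff(1)[OF _ _ q], of "f k" g] fg by simp
    qed
    show "(\<lambda>k. B * (Lp_norm q M (\<lambda>x. f k x - g x) * Lp_norm (conj_exp q) M h)) \<longlonglongrightarrow> 0"
      using fg by (auto intro!: tendsto_mult_right_zero tendsto_mult_left_zero)
  qed
  then show ?thesis by (simp add: LIM_zero_iff)
qed

section \<open>The Riesz gradient of Lipschitz functions with compact support\<close>

lemma lipschitz_cs_integrable:
  assumes f: "lipschitz_cs f"
  shows "integrable lborel f"
proof -
  obtain C K where C: "0 < C" and K: "compact K" "\<And>x. x \<notin> K \<Longrightarrow> f x = 0" and b: "\<And>x. \<bar>f x\<bar> \<le> C"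
    using lipschitz_cs_bound[OF f] by metis
  have [measurable]: "f \<in> borel_measurable borel" by (rule lipschitz_cs_measurable[OF f])
  have K': "K \<in> sets lborel" "emeasure lborel K < \<infinity>"
    using K(1) emeasure_compact_finite[OF K(1)] by (simp_all add: borel_compact)
  show ?thesis
  proof (rule Bochner_Integration.integrable_bound)
    show "integrable lborel (\<lambda>x. C * indicator K x)" using K' by simp
    show "AE x in lborel. norm (f x) \<le> norm (C * indicator K x :: real)"
    proof (rule AE_I2)
      fix x show "norm (f x) \<le> norm (C * indicator K x :: real)"
        using b[of x] C K(2)[of x] by (cases "x \<in> K") auto
    qed
  qed simp
qed

lemma integrable_riesz_diff:
  assumes s: "0 < s" "s < 1" and f: "lipschitz_cs f"
  shows "integrable lborel (\<lambda>y. (f y - f x) *\<^sub>R riesz_kernel s (y - x))"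
proof -
  obtain C where C: "0 < C" "\<And>x. \<bar>f x\<bar> \<le> C" "\<And>x y. \<bar>f y - f x\<bar> \<le> C * norm (y - x)"
    using lipschitz_cs_bound[OF f] by metis
  have [measurable]: "f \<in> borel_measurable borel" by (rule lipschitz_cs_measurable[OF f])
  show ?thesis
  proof (rule Bochner_Integration.integrable_bound)
    show "integrable lborel (\<lambda>y. 2 * C * riesz_weight s (y - x))"
      using integrable_riesz_weight_translate[OF s, of x] by simp
    show "AE y in lborel. norm ((f y - f x) *\<^sub>R riesz_kernel s (y - x)) \<le> norm (2 * C * riesz_weight s (y - x))"
      using C riesz_kernel_diff_bound[OF C(2,3)]
      by (simp add: abs_mult abs_of_nonneg riesz_weight_nonneg)
  qed measurable
qed

text \<open>Fubini and translation invariance are used over \<open>lborel\<close>. The integrand is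
  Borel measurable, so passing to the completion does not change the integral.\<close>

lemma riesz_grad_lborel:
  fixes f :: "real^'n \<Rightarrow> real"
  assumes f: "lipschitz_cs f"
  shows "riesz_grad s f x = riesz_const CARD('n) s *\<^sub>R (LINT y|lborel. (f y - f x) *\<^sub>R riesz_kernel s (y - x))"
proof -
  have [measurable]: "f \<in> borel_measurable borel" by (rule lipschitz_cs_measurable[OF f])
  show ?thesis unfolding riesz_grad_eq_kernel by (subst integral_completion) simp_all
qed

lemma integrable_riesz_diff_pair:
  fixes f :: "real^'n \<Rightarrow> real"
  assumes s: "0 < s" "s < 1" and f: "lipschitz_cs f"
  shows "integrable (lborel \<Otimes>\<^sub>M lborel) (\<lambda>(x,y). (f y - f x) *\<^sub>R riesz_kernel s (y - x))"
    and "integrable (lborel \<Otimes>\<^sub>M lborel) (\<lambda>(x,z). (f (x + z) - f x) *\<^sub>R riesz_kernel s z)"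
proof -
  obtain C K where C: "0 < C" and K: "compact K" and b: "\<And>x. \<bar>f x\<bar> \<le> C" "\<And>x y. \<bar>f y - f x\<bar> \<le> C * norm (y - x)"
      "\<And>x. x \<notin> K \<Longrightarrow> f x = 0"
    using lipschitz_cs_bound[OF f] by metis
  have [measurable]: "f \<in> borel_measurable borel" by (rule lipschitz_cs_measurable[OF f])
  have bound: "norm ((f y - f x) *\<^sub>R riesz_kernel s (y - x)) \<le> 2 * C * (riesz_weight s (y - x) * (indicator K x + indicator K y))" for x y
    by (rule riesz_kernel_diff_bound_supp) (fact b)+
  have nn: "0 \<le> riesz_weight s z * (indicator K u + indicator K v)" for z u v :: "real^'n"
    by (simp add: riesz_weight_nonneg)
  show "integrable (lborel \<Otimes>\<^sub>M lborel) (\<lambda>(x,y). (f y - f x) *\<^sub>R riesz_kernel s (y - x))"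
  proof (rule Bochner_Integration.integrable_bound)
    show "integrable (lborel \<Otimes>\<^sub>M lborel) (\<lambda>u. 2 * C * (case u of (x,y) \<Rightarrow> riesz_weight s (y - x) * (indicator K x + indicator K y)))"
      by (rule integrable_mult_right[OF integrable_riesz_weight_indicator(2)[OF s K]])
    show "AE u in lborel \<Otimes>\<^sub>M lborel. norm (case u of (x,y) \<Rightarrow> (f y - f x) *\<^sub>R riesz_kernel s (y - x))
        \<le> norm (2 * C * (case u of (x,y) \<Rightarrow> riesz_weight s (y - x) * (indicator K x + indicator K y)))"
    proof (rule AE_I2, clarify)
      fix x y
      show "norm ((f y - f x) *\<^sub>R riesz_kernel s (y - x))
        \<le> norm (2 * C * (riesz_weight s (y - x) * (indicator K x + indicator K y)))"
        unfolding real_norm_def by (rule order_trans[OF bound abs_ge_self])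
    qed
  qed measurable
  show "integrable (lborel \<Otimes>\<^sub>M lborel) (\<lambda>(x,z). (f (x + z) - f x) *\<^sub>R riesz_kernel s z)"
  proof (rule Bochner_Integration.integrable_bound)
    show "integrable (lborel \<Otimes>\<^sub>M lborel) (\<lambda>u. 2 * C * (case u of (x,z) \<Rightarrow> riesz_weight s z * (indicator K x + indicator K (x + z))))"
      by (rule integrable_mult_right[OF integrable_riesz_weight_indicator(1)[OF s K]])
    show "AE u in lborel \<Otimes>\<^sub>M lborel. norm (case u of (x,z) \<Rightarrow> (f (x + z) - f x) *\<^sub>R riesz_kernel s z)
        \<le> norm (2 * C * (case u of (x,z) \<Rightarrow> riesz_weight s z * (indicator K x + indicator K (x + z))))"
    proof (rule AE_I2, clarify)
      fix x z
      show "norm ((f (x + z) - f x) *\<^sub>R riesz_kernel s z)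
        \<le> norm (2 * C * (riesz_weight s z * (indicator K x + indicator K (x + z))))"
        using order_trans[OF bound[of "x + z" x] abs_ge_self] unfolding real_norm_def add_diff_cancel_left' .
    qed
  qed measurable
qed

lemma riesz_grad_borel_measurable:
  assumes f: "lipschitz_cs f"
  shows "riesz_grad s f \<in> borel_measurable borel"
proof -
  have [measurable]: "f \<in> borel_measurable borel" by (rule lipschitz_cs_measurable[OF f])
  have "(\<lambda>x. LINT y|lborel. (f y - f x) *\<^sub>R riesz_kernel s (y - x)) \<in> borel_measurable lborel"
    by measurable
  then show ?thesis
    unfolding riesz_grad_lborel[OF f, abs_def] by simp
qed

lemma riesz_grad_integrable:
  assumes s: "0 < s" "s < 1" and f: "lipschitz_cs f"
  shows "integrable lborel (riesz_grad s f)"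
  unfolding riesz_grad_lborel[OF f, abs_def]
  by (intro integrable_scaleR_right lborel_pair.integrable_fst[OF integrable_riesz_diff_pair(1)[OF s f]])

lemma riesz_grad_bounded:
  fixes f :: "real^'n \<Rightarrow> real"
  assumes s: "0 < s" "s < 1" and f: "lipschitz_cs f"
  obtains B where "0 < B" "\<And>x. norm (riesz_grad s f x) \<le> B"
proof -
  obtain C where C: "0 < C" "\<And>x. \<bar>f x\<bar> \<le> C" "\<And>x y. \<bar>f y - f x\<bar> \<le> C * norm (y - x)"
    using lipschitz_cs_bound[OF f] by metis
  let ?c = "riesz_const CARD('n) s"
  define B where "B = \<bar>?c\<bar> * (2 * C * riesz_mass TYPE('n) s)"
  have "norm (riesz_grad s f x) \<le> B" for x
  proof -
    have "(LINT y|lborel. riesz_weight s (y - x)) = riesz_mass TYPE('n) s"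
      using nn_integral_riesz_weight(1)[OF s, of x] riesz_mass_nonneg[where 'n='n]
      by (simp add: nn_integral_eq_integral[OF integrable_riesz_weight_translate[OF s]] riesz_weight_nonneg)
    moreover have "norm (LINT y|lborel. (f y - f x) *\<^sub>R riesz_kernel s (y - x))
        \<le> (LINT y|lborel. 2 * C * riesz_weight s (y - x))"
      by (rule order_trans[OF integral_norm_bound])
        (intro integral_mono integrable_norm integrable_riesz_diff[OF s f] integrable_mult_right
          integrable_riesz_weight_translate[OF s] riesz_kernel_diff_bound[OF C(2,3)])
    ultimately show ?thesis
      by (simp add: riesz_grad_lborel[OF f] B_def mult_left_mono)
  qed
  moreover have "0 \<le> B" using C(1) riesz_mass_nonneg[where 'n='n] by (simp add: B_def)
  ultimately have "\<And>x. norm (riesz_grad s f x) \<le> B + 1" "0 < B + 1"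
    by (smt (verit))+
  then show ?thesis using that by blast
qed

text \<open>Interpolation between bounded and integrable: |g|^r \<le> B^(r-1) |g|. No decay estimate
  at infinity is involved.\<close>

lemma riesz_grad_Lp:
  assumes s: "0 < s" "s < 1" and f: "lipschitz_cs f" and r: "1 < r"
  shows "riesz_grad s f \<in> Lp r lebesgue"
proof -
  obtain B where B: "0 < B" "\<And>x. norm (riesz_grad s f x) \<le> B"
    using riesz_grad_bounded[OF s f] by metis
  have [measurable]: "riesz_grad s f \<in> borel_measurable borel"
    by (rule riesz_grad_borel_measurable[OF f])
  have "integrable lborel (\<lambda>x. norm (riesz_grad s f x) powr r)"
  proof (rule Bochner_Integration.integrable_bound)
    show "integrable lborel (\<lambda>x. B powr (r - 1) * norm (riesz_grad s f x))"
      using riesz_grad_integrable[OF s f] by simp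
    show "AE x in lborel. norm (norm (riesz_grad s f x) powr r) \<le> norm (B powr (r - 1) * norm (riesz_grad s f x))"
    proof (rule AE_I2)
      fix x
      have "norm (riesz_grad s f x) powr r = norm (riesz_grad s f x) powr (r - 1) * norm (riesz_grad s f x)"
        using powr_mult_base[of "norm (riesz_grad s f x)" "r - 1"] by (simp add: mult.commute)
      also have "\<dots> \<le> B powr (r - 1) * norm (riesz_grad s f x)"
        using B r by (intro mult_right_mono powr_mono2) auto
      finally show "norm (norm (riesz_grad s f x) powr r) \<le> norm (B powr (r - 1) * norm (riesz_grad s f x))"
        using B by simp
    qed
  qed measurable
  then show ?thesis
    by (simp add: Lp_def integrable_completion measurable_completion)
qed

lemma integral_lborel_translate:
  fixes f :: "'a::euclidean_space \<Rightarrow> 'b::{banach, second_countable_topology}"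
  assumes [measurable]: "f \<in> borel_measurable borel"
  shows "(LINT y|lborel. f (x + y)) = (LINT y|lborel. f y)"
proof -
  have "(LINT y|lborel. f y) = (LINT y|distr lborel borel ((+) x). f y)"
    by (simp add: lborel_distr_plus)
  also have "\<dots> = (LINT y|lborel. f (x + y))"
    by (rule integral_distr) auto
  finally show ?thesis by simp
qed

text \<open>
  After the substitution \<open>y = x + z\<close>, the difference \<open>f (x + z) - f x\<close> integrates to 0 over \<open>x\<close> for each \<open>z\<close>.
  Combined with the Leibniz rule this gives integration by parts without principal values.
\<close>

lemma integral_riesz_grad_eq_0:
  assumes s: "0 < s" "s < 1" and f: "lipschitz_cs f"
  shows "(LINT x|lborel. riesz_grad s f x) = 0"
proof -
  have [measurable]: "f \<in> borel_measurable borel" by (rule lipschitz_cs_measurable[OF f])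
  have intf: "integrable lborel f" by (rule lipschitz_cs_integrable[OF f])
  have "(LINT y|lborel. (f y - f x) *\<^sub>R riesz_kernel s (y - x))
      = (LINT z|lborel. (f (x + z) - f x) *\<^sub>R riesz_kernel s z)" for x
    using integral_lborel_translate[of "\<lambda>y. (f y - f x) *\<^sub>R riesz_kernel s (y - x)" x] by simp
  then have "(LINT x|lborel. LINT y|lborel. (f y - f x) *\<^sub>R riesz_kernel s (y - x))
      = (LINT x|lborel. LINT z|lborel. (f (x + z) - f x) *\<^sub>R riesz_kernel s z)"
    by simp
  also have "\<dots> = (LINT z|lborel. LINT x|lborel. (f (x + z) - f x) *\<^sub>R riesz_kernel s z)"
    by (rule lborel_pair.Fubini_integral[symmetric], rule integrable_riesz_diff_pair(2)[OF s f])
  also have "\<dots> = 0"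
  proof -
    have "(LINT x|lborel. (f (x + z) - f x) *\<^sub>R riesz_kernel s z) = 0" for z
    proof -
      have "integrable lborel (\<lambda>x. f (z + x))"
      proof -
        have "integrable (distr lborel borel ((+) z)) f"
          using intf by (simp add: lborel_distr_plus)
        then show ?thesis by (subst (asm) integrable_distr_eq) auto
      qed
      then have int: "integrable lborel (\<lambda>x. f (x + z) - f x)" and "(LINT x|lborel. f (x + z) - f x) = 0"
        using intf integral_lborel_translate[of f z] by (simp_all add: add.commute)
      then show ?thesis by (subst integral_scaleR_left[OF int]) simp
    qed
    then show ?thesis by simp
  qed
  finally show ?thesis by (simp add: riesz_grad_lborel[OF f])
qed

section \<open>The Leibniz rule, the commutator and integration by parts\<close>

definition riesz_comm :: "real \<Rightarrow> (real^'n \<Rightarrow> real) \<Rightarrow> (real^'n \<Rightarrow> real) \<Rightarrow> real^'n \<Rightarrow> real^'n" where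
  "riesz_comm s \<phi> w x = riesz_const CARD('n) s *\<^sub>R
     (LINT y|lebesgue. w y *\<^sub>R ((\<phi> y - \<phi> x) *\<^sub>R riesz_kernel s (y - x)))"

lemma riesz_comm_lborel:
  fixes f g :: "real^'n \<Rightarrow> real"
  assumes f: "lipschitz_cs f" and g: "lipschitz_cs g"
  shows "riesz_comm s f g x = riesz_const CARD('n) s *\<^sub>R (LINT y|lborel. g y *\<^sub>R ((f y - f x) *\<^sub>R riesz_kernel s (y - x)))"
proof -
  have [measurable]: "f \<in> borel_measurable borel" "g \<in> borel_measurable borel"
    by (simp_all add: lipschitz_cs_measurable f g)
  show ?thesis unfolding riesz_comm_def by (subst integral_completion) simp_all
qed

text \<open>Rests on f(y)g(y) - f(x)g(x) = f(x)(g(y) - g(x)) + g(y)(f(y) - f(x)). The second term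
  contains g itself and no difference of g, so the commutator asks for no regularity of g.\<close>

lemma riesz_grad_mult:
  assumes s: "0 < s" "s < 1" and f: "lipschitz_cs f" and g: "lipschitz_cs g"
  shows "riesz_grad s (\<lambda>x. f x * g x) x = f x *\<^sub>R riesz_grad s g x + riesz_comm s f g x"
proof -
  have fg: "lipschitz_cs (\<lambda>x. f x * g x)" by (rule lipschitz_cs_mult[OF f g])
  let ?K = "\<lambda>y. riesz_kernel s (y - x)"
  have "(LINT y|lborel. g y *\<^sub>R ((f y - f x) *\<^sub>R ?K y))
      = (LINT y|lborel. (f y * g y - f x * g x) *\<^sub>R ?K y - f x *\<^sub>R ((g y - g x) *\<^sub>R ?K y))"
    by (intro Bochner_Integration.integral_cong) (simp_all add: algebra_simps)
  also have "\<dots> = (LINT y|lborel. (f y * g y - f x * g x) *\<^sub>R ?K y) - (LINT y|lborel. f x *\<^sub>R ((g y - g x) *\<^sub>R ?K y))"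
    by (intro Bochner_Integration.integral_diff integrable_scaleR_right integrable_riesz_diff[OF s fg] integrable_riesz_diff[OF s g])
  also have "(LINT y|lborel. f x *\<^sub>R ((g y - g x) *\<^sub>R ?K y)) = f x *\<^sub>R (LINT y|lborel. (g y - g x) *\<^sub>R ?K y)"
    by (rule integral_scaleR_right)
  finally show ?thesis
    unfolding riesz_comm_lborel[OF f g] riesz_grad_lborel[OF fg] riesz_grad_lborel[OF g]
    by (simp add: scaleR_diff_right scaleR_left_commute[of "f x"])
qed

text \<open>Both f(y) - f(x) and the Riesz kernel change sign when x and y are exchanged, so their
  product is symmetric and Fubini turns the inner integral into the gradient of f.\<close>

lemma integral_riesz_comm:
  assumes s: "0 < s" "s < 1" and f: "lipschitz_cs f" and g: "lipschitz_cs g"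
  shows "integrable lborel (riesz_comm s f g)"
    and "(LINT x|lborel. riesz_comm s f g x) = (LINT x|lborel. g x *\<^sub>R riesz_grad s f x)"
proof -
  have [measurable]: "f \<in> borel_measurable borel" "g \<in> borel_measurable borel"
    by (simp_all add: lipschitz_cs_measurable f g)
  obtain C where C: "0 < C" "\<And>x. \<bar>g x\<bar> \<le> C"
    using lipschitz_cs_bound[OF g] by metis
  have int: "integrable (lborel \<Otimes>\<^sub>M lborel) (\<lambda>(x,y). g y *\<^sub>R ((f y - f x) *\<^sub>R riesz_kernel s (y - x)))"
  proof (rule Bochner_Integration.integrable_bound)
    show "integrable (lborel \<Otimes>\<^sub>M lborel) (\<lambda>u. C * norm (case u of (x,y) \<Rightarrow> (f y - f x) *\<^sub>R riesz_kernel s (y - x)))"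
      by (intro integrable_mult_right integrable_norm integrable_riesz_diff_pair(1)[OF s f])
    show "AE u in lborel \<Otimes>\<^sub>M lborel. norm (case u of (x,y) \<Rightarrow> g y *\<^sub>R ((f y - f x) *\<^sub>R riesz_kernel s (y - x)))
        \<le> norm (C * norm (case u of (x,y) \<Rightarrow> (f y - f x) *\<^sub>R riesz_kernel s (y - x)))"
      using C by (intro AE_I2) (auto simp: abs_mult mult.assoc intro!: mult_right_mono)
  qed measurable
  show "integrable lborel (riesz_comm s f g)"
    unfolding riesz_comm_lborel[OF f g, abs_def]
    by (intro integrable_scaleR_right lborel_pair.integrable_fst[OF int])
  have "(LINT x|lborel. LINT y|lborel. g y *\<^sub>R ((f y - f x) *\<^sub>R riesz_kernel s (y - x)))
      = (LINT y|lborel. LINT x|lborel. g y *\<^sub>R ((f y - f x) *\<^sub>R riesz_kernel s (y - x)))"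
    by (rule lborel_pair.Fubini_integral[symmetric], rule int)
  also have "\<dots> = (LINT y|lborel. g y *\<^sub>R (LINT x|lborel. (f x - f y) *\<^sub>R riesz_kernel s (x - y)))"
  proof (rule Bochner_Integration.integral_cong[OF refl])
    fix y
    have "(f y - f x) *\<^sub>R riesz_kernel s (y - x) = (f x - f y) *\<^sub>R riesz_kernel s (x - y)" for x
      using riesz_kernel_uminus[of s "x - y"] by (simp add: algebra_simps)
    then show "(LINT x|lborel. g y *\<^sub>R ((f y - f x) *\<^sub>R riesz_kernel s (y - x)))
        = g y *\<^sub>R (LINT x|lborel. (f x - f y) *\<^sub>R riesz_kernel s (x - y))"
      by (simp only: integral_scaleR_right)
  qed
  finally show "(LINT x|lborel. riesz_comm s f g x) = (LINT x|lborel. g x *\<^sub>R riesz_grad s f x)"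
    by (simp only: riesz_comm_lborel[OF f g] riesz_grad_lborel[OF f]
        scaleR_left_commute[of "g _" "riesz_const _ s"] integral_scaleR_right)
qed

lemma riesz_grad_integration_by_parts:
  assumes s: "0 < s" "s < 1" and f: "lipschitz_cs f" and g: "lipschitz_cs g"
  shows "(LINT x|lebesgue. f x *\<^sub>R riesz_grad s g x) = - (LINT x|lebesgue. g x *\<^sub>R riesz_grad s f x)"
proof -
  have [measurable]: "f \<in> borel_measurable borel" "g \<in> borel_measurable borel"
    "riesz_grad s f \<in> borel_measurable borel" "riesz_grad s g \<in> borel_measurable borel"
    by (simp_all add: lipschitz_cs_measurable riesz_grad_borel_measurable f g)
  have fg: "lipschitz_cs (\<lambda>x. f x * g x)" by (rule lipschitz_cs_mult[OF f g])
  \<comment> \<open>Integrability of f times the gradient of g is read off the Leibniz rule as a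
    difference of two integrable functions.\<close>
  have "integrable lborel (\<lambda>x. riesz_grad s (\<lambda>x. f x * g x) x - riesz_comm s f g x)"
    using riesz_grad_integrable[OF s fg] integral_riesz_comm(1)[OF s f g] by simp
  then have int: "integrable lborel (\<lambda>x. f x *\<^sub>R riesz_grad s g x)"
    by (simp add: riesz_grad_mult[OF s f g])
  have "(LINT x|lborel. f x *\<^sub>R riesz_grad s g x) + (LINT x|lborel. riesz_comm s f g x) = 0"
    using integral_riesz_grad_eq_0[OF s fg] int integral_riesz_comm(1)[OF s f g]
    by (simp add: riesz_grad_mult[OF s f g])
  then show ?thesis
    unfolding integral_riesz_comm(2)[OF s f g] by (simp add: integral_completion eq_neg_iff_add_eq_0)
qed

section \<open>Boundedness of the commutator on L^q\<close>

lemma sigma_finite_measure_lebesgue: "sigma_finite_measure (lebesgue :: 'a::euclidean_space measure)"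
proof
  obtain A :: "'a set set" where A: "countable A" "A \<subseteq> sets lborel" "\<Union>A = space lborel" "\<forall>a\<in>A. emeasure lborel a \<noteq> \<infinity>"
    using lborel.sigma_finite_countable by blast
  then show "\<exists>A::'a set set. countable A \<and> A \<subseteq> sets lebesgue \<and> \<Union>A = space lebesgue \<and> (\<forall>a\<in>A. emeasure lebesgue a \<noteq> \<infinity>)"
    by (intro exI[of _ A]) (auto simp: sets_completionI_sets)
qed

text \<open>Elements of L^q are only Lebesgue measurable, so the Schur test runs over
  \<open>lebesgue\<close>, whereas the kernels are Borel on the product.\<close>

lemma measurable_lebesgue_pair:
  assumes "h \<in> borel_measurable (lborel \<Otimes>\<^sub>M lborel)"
  shows "h \<in> borel_measurable (lebesgue \<Otimes>\<^sub>M lebesgue)"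
proof -
  have "(\<lambda>u. (fst u, snd u)) \<in> (lebesgue \<Otimes>\<^sub>M lebesgue) \<rightarrow>\<^sub>M (lborel \<Otimes>\<^sub>M lborel)"
    by (intro measurable_Pair measurable_compose[OF measurable_fst] measurable_compose[OF measurable_snd])
      (auto simp: measurable_completion)
  from measurable_compose[OF this assms] show ?thesis by simp
qed

lemma riesz_comm_Lp:
  fixes f :: "real^'n \<Rightarrow> real"
  assumes s: "0 < s" "s < 1" and q: "1 < q" and f: "lipschitz_cs f"
  obtains A where "0 < A" "\<And>w. w \<in> Lp q lebesgue \<Longrightarrow> riesz_comm s f w \<in> Lp q lebesgue"
    "\<And>w. w \<in> Lp q lebesgue \<Longrightarrow> Lp_norm q lebesgue (riesz_comm s f w) \<le> A * Lp_norm q lebesgue w"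
    "\<And>w. w \<in> Lp q lebesgue \<Longrightarrow> AE x in lebesgue. integrable lebesgue (\<lambda>y. w y *\<^sub>R ((f y - f x) *\<^sub>R riesz_kernel s (y - x)))"
proof -
  obtain C where C: "0 < C" "\<And>x. \<bar>f x\<bar> \<le> C" "\<And>x y. \<bar>f y - f x\<bar> \<le> C * norm (y - x)"
    using lipschitz_cs_bound[OF f] by metis
  have [measurable]: "f \<in> borel_measurable borel" by (rule lipschitz_cs_measurable[OF f])
  let ?c = "riesz_const CARD('n) s"
  define m where "m = riesz_mass TYPE('n) s"
  have m: "0 \<le> m" by (simp add: m_def riesz_mass_nonneg)
  \<comment> \<open>The summand 1 provides the strict positivity required by the Schur test, even if
    the mass were 0.\<close>
  define A0 where "A0 = 2 * C * m + 1"
  have A0: "0 < A0" using C m by (simp add: A0_def add_nonneg_pos)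
  have mass: "(\<integral>\<^sup>+y. ennreal (2 * C * riesz_weight s (y - x)) \<partial>lebesgue) \<le> ennreal A0"
    "(\<integral>\<^sup>+y. ennreal (2 * C * riesz_weight s (x - y)) \<partial>lebesgue) \<le> ennreal A0" for x :: "real^'n"
    using C m nn_integral_riesz_weight[OF s, of x]
    by (simp_all add: nn_integral_completion ennreal_mult riesz_weight_nonneg nn_integral_cmult A0_def
        flip: m_def)
  have K: "(\<lambda>(x,y). (f y - f x) *\<^sub>R riesz_kernel s (y - x)) \<in> borel_measurable (lebesgue \<Otimes>\<^sub>M lebesgue)"
    by (rule measurable_lebesgue_pair) measurable
  have k: "(\<lambda>(x,y). 2 * C * riesz_weight s (y - x :: real^'n)) \<in> borel_measurable (lebesgue \<Otimes>\<^sub>M lebesgue)"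
    by (rule measurable_lebesgue_pair) measurable
  note Schur = Lp_Schur_test[OF q sigma_finite_measure_lebesgue K k riesz_kernel_diff_bound[OF C(2,3)] A0 mass]
  show ?thesis
  proof (rule that[of "\<bar>?c\<bar> * A0 + 1"])
    fix w :: "real^'n \<Rightarrow> real" assume w: "w \<in> Lp q lebesgue"
    note S = Schur[OF w] Lp_scaleR[OF Schur(2)[OF w], of ?c]
    show "riesz_comm s f w \<in> Lp q lebesgue"
      unfolding riesz_comm_def[abs_def] using S(4) q by simp
    have "Lp_norm q lebesgue (riesz_comm s f w) \<le> \<bar>?c\<bar> * (A0 * Lp_norm q lebesgue w)"
      unfolding riesz_comm_def[abs_def] using S(3,5) q by (simp add: mult_left_mono)
    also have "\<dots> \<le> (\<bar>?c\<bar> * A0 + 1) * Lp_norm q lebesgue w"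
      using Lp_norm_nonneg[of q lebesgue w] by (simp add: algebra_simps)
    finally show "Lp_norm q lebesgue (riesz_comm s f w) \<le> (\<bar>?c\<bar> * A0 + 1) * Lp_norm q lebesgue w" .
    show "AE x in lebesgue. integrable lebesgue (\<lambda>y. w y *\<^sub>R ((f y - f x) *\<^sub>R riesz_kernel s (y - x)))"
      by (rule S(1))
  qed (use A0 in \<open>simp add: add_nonneg_pos\<close>)
qed

text \<open>Only almost everywhere: where one of the integrals diverges, its default value 0 would
  spoil additivity.\<close>

lemma riesz_comm_diff:
  assumes s: "0 < s" "s < 1" and q: "1 < q" and f: "lipschitz_cs f"
    and u: "u \<in> Lp q lebesgue" and v: "v \<in> Lp q lebesgue"
  shows "AE x in lebesgue. riesz_comm s f (\<lambda>x. u x - v x) x = riesz_comm s f u x - riesz_comm s f v x"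
proof -
  have int: "AE x in lebesgue. integrable lebesgue (\<lambda>y. w y *\<^sub>R ((f y - f x) *\<^sub>R riesz_kernel s (y - x)))"
    if "w \<in> Lp q lebesgue" for w
    using riesz_comm_Lp[OF s q f] that by blast
  show ?thesis
    using int[OF u] int[OF v]
  proof eventually_elim
    case (elim x)
    have "(LINT y|lebesgue. (u y - v y) *\<^sub>R ((f y - f x) *\<^sub>R riesz_kernel s (y - x)))
        = (LINT y|lebesgue. u y *\<^sub>R ((f y - f x) *\<^sub>R riesz_kernel s (y - x)))
        - (LINT y|lebesgue. v y *\<^sub>R ((f y - f x) *\<^sub>R riesz_kernel s (y - x)))"
      unfolding scaleR_left_diff_distrib[of "u _" "v _"]
      by (rule Bochner_Integration.integral_diff[OF elim])
    then show ?case
      by (simp only: riesz_comm_def scaleR_right_diff_distrib)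
  qed
qed

lemma riesz_comm_tendsto:
  assumes s: "0 < s" "s < 1" and q: "1 < q" and f: "lipschitz_cs f"
    and w: "Lp_tendsto q lebesgue w v"
  shows "Lp_tendsto q lebesgue (\<lambda>k. riesz_comm s f (w k)) (riesz_comm s f v)"
proof -
  obtain A where A: "0 < A" "\<And>w. w \<in> Lp q lebesgue \<Longrightarrow> riesz_comm s f w \<in> Lp q lebesgue"
    "\<And>w. w \<in> Lp q lebesgue \<Longrightarrow> Lp_norm q lebesgue (riesz_comm s f w) \<le> A * Lp_norm q lebesgue w"
    using riesz_comm_Lp[OF s q f] by metis
  note w' = w[unfolded Lp_tendsto_def]
  have d: "(\<lambda>x. w k x - v x) \<in> Lp q lebesgue" for k
    using w' q by (intro Lp_diff(1)) auto
  have [measurable]: "riesz_comm s f (w k) \<in> borel_measurable lebesgue" "riesz_comm s f v \<in> borel_measurable lebesgue" for k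
    using A(2) w' by (blast intro: LpD(1))+
  have bound: "Lp_norm q lebesgue (\<lambda>x. riesz_comm s f (w k) x - riesz_comm s f v x)
      \<le> A * Lp_norm q lebesgue (\<lambda>x. w k x - v x)" for k
  proof -
    have "Lp_norm q lebesgue (\<lambda>x. riesz_comm s f (w k) x - riesz_comm s f v x)
        \<le> 1 * Lp_norm q lebesgue (riesz_comm s f (\<lambda>x. w k x - v x))"
    proof (rule Lp_bound_AE(2)[OF A(2)[OF d]])
      show "AE x in lebesgue. norm (riesz_comm s f (w k) x - riesz_comm s f v x)
          \<le> 1 * norm (riesz_comm s f (\<lambda>x. w k x - v x) x)"
        using riesz_comm_diff[OF s q f, of "w k" v] w' by (auto elim!: eventually_mono)
    qed (use q in auto)
    with A(3)[OF d, of k] show ?thesis by simp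
  qed
  have "(\<lambda>k. Lp_norm q lebesgue (\<lambda>x. riesz_comm s f (w k) x - riesz_comm s f v x)) \<longlonglongrightarrow> 0"
  proof (rule tendsto_sandwich[OF _ _ tendsto_const])
    show "(\<lambda>k. A * Lp_norm q lebesgue (\<lambda>x. w k x - v x)) \<longlonglongrightarrow> 0"
      using w' by (auto intro: tendsto_mult_right_zero)
  qed (use bound in \<open>auto simp: Lp_norm_nonneg\<close>)
  then show ?thesis using A(2) w' by (simp add: Lp_tendsto_def)
qed

section \<open>The extended gradient\<close>

lemma Lp_tendsto_norm_bounded:
  assumes f: "Lp_tendsto q M f g" and q: "1 < q"
  obtains B where "0 < B" "\<And>k. Lp_norm q M (f k) \<le> B"
proof -
  note fg = f[unfolded Lp_tendsto_def]
  have "bounded (range (\<lambda>k. Lp_norm q M (\<lambda>x. f k x - g x)))"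
    using fg by (auto intro: convergent_imp_bounded)
  then obtain B where B: "0 < B" "\<And>k. Lp_norm q M (\<lambda>x. f k x - g x) \<le> B"
    by (auto simp: bounded_pos abs_of_nonneg[OF Lp_norm_nonneg])
  show ?thesis
  proof (rule that[of "4 * (B + Lp_norm q M g)"])
    show "0 < 4 * (B + Lp_norm q M g)" using B(1) Lp_norm_nonneg[of q M g] by simp
    fix k
    have "Lp_norm q M (\<lambda>x. (f k x - g x) + g x) \<le> 4 * (Lp_norm q M (\<lambda>x. f k x - g x) + Lp_norm q M g)"
      using fg q by (intro Lp_add(2) Lp_diff(1)) auto
    then show "Lp_norm q M (f k) \<le> 4 * (B + Lp_norm q M g)" using B(2)[of k] by simp
  qed
qed

lemma Lp_tendsto_add:
  assumes f: "Lp_tendsto q M f a" and g: "Lp_tendsto q M g b" and q: "1 < q"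
  shows "Lp_tendsto q M (\<lambda>k x. f k x + g k x) (\<lambda>x. a x + b x)"
proof -
  note fa = f[unfolded Lp_tendsto_def] and gb = g[unfolded Lp_tendsto_def]
  have "(\<lambda>k. Lp_norm q M (\<lambda>x. (f k x + g k x) - (a x + b x))) \<longlonglongrightarrow> 0"
  proof (rule tendsto_sandwich[OF _ _ tendsto_const])
    have "(\<lambda>k. 4 * (Lp_norm q M (\<lambda>x. f k x - a x) + Lp_norm q M (\<lambda>x. g k x - b x))) \<longlonglongrightarrow> 4 * (0 + 0)"
      using fa gb by (intro tendsto_intros) auto
    then show "(\<lambda>k. 4 * (Lp_norm q M (\<lambda>x. f k x - a x) + Lp_norm q M (\<lambda>x. g k x - b x))) \<longlonglongrightarrow> 0"
      by simp
    show "\<forall>\<^sub>F k in sequentially. Lp_norm q M (\<lambda>x. (f k x + g k x) - (a x + b x))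
        \<le> 4 * (Lp_norm q M (\<lambda>x. f k x - a x) + Lp_norm q M (\<lambda>x. g k x - b x))"
    proof (rule always_eventually, rule allI)
      fix k
      show "Lp_norm q M (\<lambda>x. (f k x + g k x) - (a x + b x))
        \<le> 4 * (Lp_norm q M (\<lambda>x. f k x - a x) + Lp_norm q M (\<lambda>x. g k x - b x))"
        using Lp_add(2)[OF Lp_diff(1) Lp_diff(1) q, of "f k" M a "g k" b] fa gb q
        by (simp add: add_diff_add)
    qed
  qed (simp add: Lp_norm_nonneg)
  then show ?thesis using fa gb q by (simp add: Lp_tendsto_def Lp_add(1))
qed

lemma Lp_mult_bounded:
  assumes "f \<in> Lp q M" "\<phi> \<in> borel_measurable M" "0 < q" "\<And>x. \<bar>\<phi> x\<bar> \<le> C"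
  shows "(\<lambda>x. \<phi> x *\<^sub>R f x) \<in> Lp q M" "Lp_norm q M (\<lambda>x. \<phi> x *\<^sub>R f x) \<le> C * Lp_norm q M f"
proof -
  note [measurable] = LpD(1)[OF assms(1)] assms(2)
  have C: "0 \<le> C" using assms(4) abs_ge_zero order_trans by blast
  have "norm (\<phi> x *\<^sub>R f x) \<le> C * norm (f x)" for x
    using assms(4) by (simp add: mult_right_mono)
  note b = this
  have m: "(\<lambda>x. \<phi> x *\<^sub>R f x) \<in> borel_measurable M" by measurable
  show "(\<lambda>x. \<phi> x *\<^sub>R f x) \<in> Lp q M" "Lp_norm q M (\<lambda>x. \<phi> x *\<^sub>R f x) \<le> C * Lp_norm q M f"
    by (rule Lp_bound[OF assms(1) m C assms(3) b])+
qed

lemma Lp_tendsto_mult: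
  fixes f :: "nat \<Rightarrow> 'a \<Rightarrow> 'b::euclidean_space"
  assumes f: "Lp_tendsto q M f a" and \<phi>: "\<phi> \<in> borel_measurable M" "\<And>x. \<bar>\<phi> x\<bar> \<le> C" and q: "1 < q"
  shows "Lp_tendsto q M (\<lambda>k x. \<phi> x *\<^sub>R f k x) (\<lambda>x. \<phi> x *\<^sub>R a x)"
proof -
  note fa = f[unfolded Lp_tendsto_def]
  have d: "(\<lambda>x. f k x - a x) \<in> Lp q M" for k using fa q by (intro Lp_diff(1)) auto
  have bound: "Lp_norm q M (\<lambda>x. \<phi> x *\<^sub>R f k x - \<phi> x *\<^sub>R a x) \<le> C * Lp_norm q M (\<lambda>x. f k x - a x)" for k
    using Lp_mult_bounded(2)[OF d \<phi>(1) _ \<phi>(2)] q by (simp add: scaleR_right_diff_distrib)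
  have "(\<lambda>k. Lp_norm q M (\<lambda>x. \<phi> x *\<^sub>R f k x - \<phi> x *\<^sub>R a x)) \<longlonglongrightarrow> 0"
  proof (rule tendsto_sandwich[OF _ _ tendsto_const])
    show "(\<lambda>k. C * Lp_norm q M (\<lambda>x. f k x - a x)) \<longlonglongrightarrow> 0"
      using fa by (auto intro: tendsto_mult_right_zero)
  qed (use bound in \<open>auto simp: Lp_norm_nonneg\<close>)
  moreover have "(\<lambda>x. \<phi> x *\<^sub>R u x) \<in> Lp q M" if "u \<in> Lp q M" for u :: "'a \<Rightarrow> 'b"
    by (rule Lp_mult_bounded(1)[OF that \<phi>(1) _ \<phi>(2)]) (use q in simp)
  ultimately show ?thesis using fa by (simp add: Lp_tendsto_def)
qed

lemma Lp_norm_cong_AE: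
  assumes "f \<in> borel_measurable M" "g \<in> borel_measurable M" "AE x in M. f x = g x"
  shows "Lp_norm p M f = Lp_norm p M g"
proof -
  note [measurable] = assms(1,2)
  have "(LINT x|M. norm (f x) powr p) = (LINT x|M. norm (g x) powr p)"
    by (intro integral_cong_AE) (use assms(3) in auto)
  then show ?thesis by (simp add: Lp_norm_def)
qed

section \<open>Closability of the gradient\<close>

lemma has_frac_gradD:
  assumes "has_frac_grad s q U v G"
  shows "v \<in> Lp q lebesgue" "G \<in> Lp q lebesgue"
  using assms unfolding has_frac_grad_def Lp_tendsto_def by blast+

lemma has_frac_grad_mono:
  "has_frac_grad s q U v G \<Longrightarrow> U \<subseteq> V \<Longrightarrow> has_frac_grad s q V v G"
  using test_functions_mono unfolding has_frac_grad_def by blast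

text \<open>Integration by parts survives the limit because both sides pair an L^q limit with a
  fixed element of the dual exponent. The right side no longer mentions G, which is the source of
  uniqueness.\<close>

lemma has_frac_grad_by_parts:
  assumes s: "0 < s" "s < 1" and q: "1 < q" and v: "has_frac_grad s q UNIV v G" and \<eta>: "lipschitz_cs \<eta>"
  shows "(LINT x|lebesgue. \<eta> x *\<^sub>R G x) = - (LINT x|lebesgue. v x *\<^sub>R riesz_grad s \<eta> x)"
proof -
  obtain \<psi> where \<psi>: "\<And>k::nat. \<psi> k \<in> test_functions UNIV" "Lp_tendsto q lebesgue \<psi> v"
    "Lp_tendsto q lebesgue (\<lambda>k. riesz_grad s (\<psi> k)) G"
    using v by (auto simp: has_frac_grad_def)
  have p: "1 < conj_exp q" by (rule conj_exp_gt_1[OF q])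
  have 1: "(\<lambda>k. LINT x|lebesgue. \<eta> x *\<^sub>R riesz_grad s (\<psi> k) x) \<longlonglongrightarrow> (LINT x|lebesgue. \<eta> x *\<^sub>R G x)"
    by (rule Lp_tendsto_integral[OF bounded_bilinear.flip[OF bounded_bilinear_scaleR] q \<psi>(3)])
      (rule lipschitz_cs_Lp[OF \<eta>], use p in simp)
  have "(\<lambda>k. LINT x|lebesgue. \<psi> k x *\<^sub>R riesz_grad s \<eta> x) \<longlonglongrightarrow> (LINT x|lebesgue. v x *\<^sub>R riesz_grad s \<eta> x)"
    by (rule Lp_tendsto_integral[OF bounded_bilinear_scaleR q \<psi>(2) riesz_grad_Lp[OF s \<eta> p]])
  then have "(\<lambda>k. - (LINT x|lebesgue. \<psi> k x *\<^sub>R riesz_grad s \<eta> x)) \<longlonglongrightarrow> - (LINT x|lebesgue. v x *\<^sub>R riesz_grad s \<eta> x)"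
    by (rule tendsto_minus)
  then have "(\<lambda>k. LINT x|lebesgue. \<eta> x *\<^sub>R riesz_grad s (\<psi> k) x) \<longlonglongrightarrow> - (LINT x|lebesgue. v x *\<^sub>R riesz_grad s \<eta> x)"
    unfolding riesz_grad_integration_by_parts[OF s \<eta> test_functions_imp_lipschitz_cs[OF \<psi>(1)]] .
  with 1 show ?thesis by (rule LIMSEQ_unique)
qed

text \<open>The difference of two candidates annihilates every Lipschitz function with compact
  support. This makes the choice in \<open>frac_grad\<close> harmless.\<close>

lemma has_frac_grad_unique:
  assumes s: "0 < s" "s < 1" and q: "1 < q"
    and G: "has_frac_grad s q UNIV v G" and H: "has_frac_grad s q UNIV v H"
  shows "AE x in lebesgue. G x = H x"
proof -
  note L = has_frac_gradD(2)[OF G] has_frac_gradD(2)[OF H]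
  have "AE x in lebesgue. G x - H x = 0"
  proof (rule fundamental_lemma[OF q Lp_diff(1)[OF L q]])
    fix \<eta> :: "real^'a \<Rightarrow> real" assume \<eta>: "lipschitz_cs \<eta>"
    have \<eta>L: "\<eta> \<in> Lp (conj_exp q) lebesgue"
      by (rule lipschitz_cs_Lp[OF \<eta>]) (use conj_exp_gt_1[OF q] in simp)
    have "(LINT x|lebesgue. \<eta> x *\<^sub>R (G x - H x)) = (LINT x|lebesgue. \<eta> x *\<^sub>R G x) - (LINT x|lebesgue. \<eta> x *\<^sub>R H x)"
      unfolding scaleR_right_diff_distrib
      by (intro Bochner_Integration.integral_diff Lp_scaleR_integrable(1)[OF q _ \<eta>L] L)
    then show "(LINT x|lebesgue. \<eta> x *\<^sub>R (G x - H x)) = 0"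
      using has_frac_grad_by_parts[OF s q _ \<eta>] G H by simp
  qed
  then show ?thesis by simp
qed

lemma has_frac_grad_frac_grad:
  assumes "has_frac_grad s q U v G"
  shows "has_frac_grad s q UNIV v (frac_grad s q v)"
  unfolding frac_grad_def by (rule someI[of _ G]) (rule has_frac_grad_mono[OF assms subset_UNIV])

text \<open>\<open>frac_grad\<close> refers to approximation on the whole space. Approximation by
  test functions of U is a special case, so both give the same gradient up to a null set.\<close>

lemma frac_grad_AE:
  assumes s: "0 < s" "s < 1" and q: "1 < q" and G: "has_frac_grad s q U v G"
  shows "AE x in lebesgue. frac_grad s q v x = G x"
  by (rule has_frac_grad_unique[OF s q has_frac_grad_frac_grad[OF G] has_frac_grad_mono[OF G subset_UNIV]])

section \<open>Scaling and the product rule for the extended gradient\<close>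

lemma riesz_grad_scale: "riesz_grad s (\<lambda>x. c * f x) x = c *\<^sub>R riesz_grad s f x"
proof -
  have "(LINT y|lebesgue. (c * f y - c * f x) *\<^sub>R riesz_kernel s (y - x))
      = (LINT y|lebesgue. c *\<^sub>R ((f y - f x) *\<^sub>R riesz_kernel s (y - x)))"
    by (simp add: right_diff_distrib)
  also have "\<dots> = c *\<^sub>R (LINT y|lebesgue. (f y - f x) *\<^sub>R riesz_kernel s (y - x))"
    by (rule integral_scaleR_right)
  finally show ?thesis by (simp add: riesz_grad_eq_kernel)
qed

lemma has_frac_grad_scale:
  assumes q: "1 < q" and v: "has_frac_grad s q U v G"
  shows "has_frac_grad s q U (\<lambda>x. c * v x) (\<lambda>x. c *\<^sub>R G x)"
proof -
  obtain \<psi> where \<psi>: "\<And>k::nat. \<psi> k \<in> test_functions U" "Lp_tendsto q lebesgue \<psi> v"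
    "Lp_tendsto q lebesgue (\<lambda>k. riesz_grad s (\<psi> k)) G"
    using v by (auto simp: has_frac_grad_def)
  show ?thesis
    unfolding has_frac_grad_def
  proof (intro exI[of _ "\<lambda>k x. c * \<psi> k x"] conjI allI)
    show "Lp_tendsto q lebesgue (\<lambda>k x. c * \<psi> k x) (\<lambda>x. c * v x)"
      using Lp_tendsto_mult[OF \<psi>(2), of "\<lambda>_. c" "\<bar>c\<bar>"] q by simp
    show "Lp_tendsto q lebesgue (\<lambda>k. riesz_grad s (\<lambda>x. c * \<psi> k x)) (\<lambda>x. c *\<^sub>R G x)"
      using Lp_tendsto_mult[OF \<psi>(3), of "\<lambda>_. c" "\<bar>c\<bar>"] q by (simp add: riesz_grad_scale[abs_def])
  qed (rule test_functions_scale[OF \<psi>(1)])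
qed

text \<open>Multiplying an approximating sequence by \<open>\<phi>\<close> moves its support into U.
  The Leibniz rule holds for each member, and both of its terms are continuous in L^q.\<close>

lemma has_frac_grad_mult:
  assumes s: "0 < s" "s < 1" and q: "1 < q"
    and v: "has_frac_grad s q UNIV v G" and \<phi>: "\<phi> \<in> test_functions U"
  shows "has_frac_grad s q U (\<lambda>x. \<phi> x * v x) (\<lambda>x. \<phi> x *\<^sub>R G x + riesz_comm s \<phi> v x)"
proof -
  obtain \<psi> where \<psi>: "\<And>k::nat. \<psi> k \<in> test_functions UNIV" "Lp_tendsto q lebesgue \<psi> v"
    "Lp_tendsto q lebesgue (\<lambda>k. riesz_grad s (\<psi> k)) G"
    using v by (auto simp: has_frac_grad_def)
  have l: "lipschitz_cs \<phi>" by (rule test_functions_imp_lipschitz_cs[OF \<phi>])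
  have m: "\<phi> \<in> borel_measurable lebesgue"
    using lipschitz_cs_measurable[OF l] by (simp add: measurable_completion)
  obtain C where C: "\<And>x. \<bar>\<phi> x\<bar> \<le> C" using lipschitz_cs_bound[OF l] by metis
  show ?thesis
    unfolding has_frac_grad_def
  proof (intro exI[of _ "\<lambda>k x. \<phi> x * \<psi> k x"] conjI allI)
    show "(\<lambda>x. \<phi> x * \<psi> k x) \<in> test_functions U" for k
      by (rule test_functions_mult[OF \<phi> \<psi>(1)])
    show "Lp_tendsto q lebesgue (\<lambda>k x. \<phi> x * \<psi> k x) (\<lambda>x. \<phi> x * v x)"
      using Lp_tendsto_mult[OF \<psi>(2) m C q] by simp
    have "(\<lambda>k. riesz_grad s (\<lambda>x. \<phi> x * \<psi> k x)) = (\<lambda>k x. \<phi> x *\<^sub>R riesz_grad s (\<psi> k) x + riesz_comm s \<phi> (\<psi> k) x)"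
      using riesz_grad_mult[OF s l test_functions_imp_lipschitz_cs[OF \<psi>(1)]] by (intro ext)
    then show "Lp_tendsto q lebesgue (\<lambda>k. riesz_grad s (\<lambda>x. \<phi> x * \<psi> k x)) (\<lambda>x. \<phi> x *\<^sub>R G x + riesz_comm s \<phi> v x)"
      using Lp_tendsto_add[OF Lp_tendsto_mult[OF \<psi>(3) m C q] riesz_comm_tendsto[OF s q l \<psi>(2)] q] by simp
  qed
qed

section \<open>Duality with the fractional divergence\<close>

text \<open>Scaling by an upper bound B instead of the norm of v avoids a separate case of norm zero
  and moves v into the unit ball. The bound is phrased with any gradient H, so that the explicit one
  from the product rule can be inserted.\<close>

lemma Hneg_norm_bound:
  assumes s: "0 < s" "s < 1" and p: "1 < p"
    and v: "has_frac_grad s (conj_exp p) U v H"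
    and T: "\<And>c. T (\<lambda>x. c * v x) = c * T v"
    and B: "0 < B" "Lp_norm (conj_exp p) lebesgue v powr conj_exp p + Lp_norm (conj_exp p) lebesgue H powr conj_exp p \<le> B powr conj_exp p"
  shows "ennreal \<bar>T v\<bar> \<le> ennreal B * Hneg_norm s p U T"
proof -
  define q where "q = conj_exp p"
  have q: "1 < q" using conj_exp_gt_1[OF p] by (simp add: q_def)
  note v = v[folded q_def] and B = B[folded q_def]
  let ?u = "\<lambda>x. (1/B) * v x"
  have u: "has_frac_grad s q U ?u (\<lambda>x. (1/B) *\<^sub>R H x)"
    by (rule has_frac_grad_scale[OF q v])
  have nu: "Lp_norm q lebesgue ?u = Lp_norm q lebesgue v / B"
    using Lp_scaleR(2)[OF has_frac_gradD(1)[OF v], of "1/B"] q B(1) by simp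
  have "Lp_norm q lebesgue (frac_grad s q ?u) = Lp_norm q lebesgue (\<lambda>x. (1/B) *\<^sub>R H x)"
    by (rule Lp_norm_cong_AE[OF LpD(1)[OF has_frac_gradD(2)[OF has_frac_grad_frac_grad[OF u]]]
        LpD(1)[OF has_frac_gradD(2)[OF u]] frac_grad_AE[OF s q u]])
  also have "\<dots> = Lp_norm q lebesgue H / B"
    using Lp_scaleR(2)[OF has_frac_gradD(2)[OF v], of "1/B"] q B(1) by simp
  finally have nH: "Lp_norm q lebesgue (frac_grad s q ?u) = Lp_norm q lebesgue H / B" .
  have "Hs_norm s q ?u = ((Lp_norm q lebesgue v powr q + Lp_norm q lebesgue H powr q) / B powr q) powr (1/q)"
    unfolding Hs_norm_def nu nH using B(1)
    by (simp add: powr_divide Lp_norm_nonneg add_divide_distrib)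
  also have "\<dots> \<le> 1 powr (1/q)"
    using B q by (intro powr_mono2) (auto simp: divide_le_eq)
  finally have "Hs_norm s q ?u \<le> 1" by simp
  moreover have "?u \<in> Hs0 s q U" using u by (auto simp: Hs0_def)
  ultimately have "ennreal \<bar>T ?u\<bar> \<le> Hneg_norm s p U T"
    unfolding Hneg_norm_def q_def by (intro SUP_upper) simp
  then have "ennreal B * ennreal \<bar>T ?u\<bar> \<le> ennreal B * Hneg_norm s p U T"
    by (rule mult_left_mono) simp
  also have "ennreal B * ennreal \<bar>T ?u\<bar> = ennreal \<bar>T v\<bar>"
    using B(1) unfolding T[of "1/B"] by (simp add: ennreal_mult[symmetric] abs_mult)
  finally show ?thesis .
qed

lemma frac_div_eq:
  assumes s: "0 < s" "s < 1" and p: "1 < p" and F: "F \<in> Lp p lebesgue"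
    and v: "has_frac_grad s (conj_exp p) U v H"
  shows "frac_div s p F v = - (LINT x|lebesgue. F x \<bullet> H x)"
proof -
  have q: "1 < conj_exp p" by (rule conj_exp_gt_1[OF p])
  note [measurable] = LpD(1)[OF F] LpD(1)[OF has_frac_gradD(2)[OF v]]
    LpD(1)[OF has_frac_gradD(2)[OF has_frac_grad_frac_grad[OF v]]]
  have "(LINT x|lebesgue. F x \<bullet> frac_grad s (conj_exp p) v x) = (LINT x|lebesgue. F x \<bullet> H x)"
    by (rule integral_cong_AE) (use frac_grad_AE[OF s q v] in auto)
  then show ?thesis by (simp add: frac_div_def)
qed

section \<open>Localization and passage to the limit in the product\<close>

lemma integral_lebesgue_on_vanishing:
  fixes h :: "'a::euclidean_space \<Rightarrow> 'b::{banach, second_countable_topology}"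
  assumes "U \<in> sets lebesgue" "\<And>x. x \<notin> U \<Longrightarrow> h x = 0"
  shows "(LINT x|lebesgue_on U. h x) = (LINT x|lebesgue. h x)"
proof -
  have "(LINT x|lebesgue_on U. h x) = (LINT x|lebesgue. indicator U x *\<^sub>R h x)"
    using assms(1) by (intro integral_restrict_space) simp
  also have "\<dots> = (LINT x|lebesgue. h x)"
    using assms(2) by (intro Bochner_Integration.integral_cong) (auto simp: indicator_def)
  finally show ?thesis .
qed

lemma Lp_lebesgue_on:
  assumes "f \<in> Lp p lebesgue" "U \<in> sets lebesgue"
  shows "f \<in> Lp p (lebesgue_on U)"
proof -
  have "integrable lebesgue (\<lambda>x. indicator U x *\<^sub>R (norm (f x) powr p))"
    by (rule integrable_mult_indicator[OF assms(2) LpD(2)[OF assms(1)]])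
  then have "integrable (lebesgue_on U) (\<lambda>x. norm (f x) powr p)"
    using assms(2) by (subst integrable_restrict_space) auto
  then show ?thesis
    using LpD(1)[OF assms(1)] by (simp add: Lp_def measurable_restrict_space1)
qed

theorem theorem3:
  fixes \<Omega> :: "(real^'n) set" and p p' s :: real
    and F :: "nat \<Rightarrow> real^'n \<Rightarrow> real^'n" and F_inf :: "real^'n \<Rightarrow> real^'n"
    and w :: "nat \<Rightarrow> real^'n \<Rightarrow> real" and w_inf :: "real^'n \<Rightarrow> real"
  assumes "CARD('n) \<ge> 2"
    and "open \<Omega>"
    and "1 < p" and "p' = conj_exp p"
    and "0 < s" and "s < 1"
    and "\<And>k. F k \<in> Lp p lebesgue" and "F_inf \<in> Lp p lebesgue"
    and "\<And>k. w k \<in> Hs s p'" and "w_inf \<in> Hs s p'"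
    and "weak_Lp_tendsto p lebesgue F F_inf"
    and "weak_Lp_loc_tendsto p' \<Omega> (\<lambda>k. frac_grad s p' (w k)) (frac_grad s p' w_inf)"
    and "Hneg_loc_tendsto s p \<Omega> (\<lambda>k. frac_div s p (F k)) (frac_div s p F_inf)"
    and "Lp_tendsto p' lebesgue w w_inf"
  shows "\<forall>\<phi> \<in> test_functions \<Omega>.
    (\<lambda>k. LINT x|lebesgue_on \<Omega>. \<phi> x * (F k x \<bullet> frac_grad s p' (w k) x))
      \<longlonglongrightarrow> (LINT x|lebesgue_on \<Omega>. \<phi> x * (F_inf x \<bullet> frac_grad s p' w_inf x))"
proof
  fix \<phi> assume \<phi>: "\<phi> \<in> test_functions \<Omega>"
  note p = \<open>1 < p\<close> and s = \<open>0 < s\<close> \<open>s < 1\<close> and F = assms(7,8)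
  note weakF = \<open>weak_Lp_tendsto p lebesgue F F_inf\<close>
  define q where "q = p'"
  have q: "1 < q" "conj_exp p = q" "conj_exp q = p"
    using conj_exp_gt_1[OF p] conj_exp_conj_exp[OF p] \<open>p' = conj_exp p\<close> by (simp_all add: q_def)
  have w_lim: "Lp_tendsto q lebesgue w w_inf" using assms(14) by (simp add: q_def)
  define G where "G k = frac_grad s q (w k)" for k
  define G_inf where "G_inf = frac_grad s q w_inf"
  have hG: "has_frac_grad s q UNIV (w k) (G k)" "has_frac_grad s q UNIV w_inf G_inf" for k
    using assms(9)[of k] assms(10) by (auto simp: Hs0_def G_def G_inf_def q_def intro: has_frac_grad_frac_grad)

  have l: "lipschitz_cs \<phi>" by (rule test_functions_imp_lipschitz_cs[OF \<phi>])
  have \<phi>m: "\<phi> \<in> borel_measurable lebesgue"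
    using lipschitz_cs_measurable[OF l] by (simp add: measurable_completion)
  obtain M where M: "0 < M" "\<And>x. \<bar>\<phi> x\<bar> \<le> M" using lipschitz_cs_bound[OF l] by metis
  have "compact (closure {x. \<phi> x \<noteq> 0})" "closure {x. \<phi> x \<noteq> 0} \<subseteq> \<Omega>"
    using \<phi> by (auto simp: test_functions_def)
  \<comment> \<open>The local hypotheses are available only on sets compactly contained in
    \<open>\<Omega>\<close>. U serves both as such a set and as the domain of the localized
    functions.\<close>
  then obtain U where U: "open U" "closure {x. \<phi> x \<noteq> 0} \<subseteq> U" "compactly_contained U \<Omega>"
    using exists_open_between[OF _ \<open>open \<Omega>\<close>] by blast
  have \<phi>U: "\<phi> \<in> test_functions U" using \<phi> U(2) by (simp add: test_functions_def)
  have U0: "\<phi> x = 0" if "x \<notin> U" for x using that U(2) closure_subset[of "{x. \<phi> x \<noteq> 0}"] by blast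
  have \<Omega>0: "\<phi> x = 0" if "x \<notin> \<Omega>" for x
    using that U0 U(3) by (auto simp: compactly_contained_def)
  have Ul: "U \<in> sets lebesgue" "\<Omega> \<in> sets lebesgue" using U(1) \<open>open \<Omega>\<close> by simp_all
  have weakG: "weak_Lp_tendsto q (lebesgue_on U) G G_inf"
    using assms(12)[unfolded weak_Lp_loc_tendsto_def, rule_format, of U] U(1,3)
    by (simp add: G_def[abs_def] G_inf_def q_def)

  define R where "R k = riesz_comm s \<phi> (w k)" for k
  define R_inf where "R_inf = riesz_comm s \<phi> w_inf"
  have R_lim: "Lp_tendsto q lebesgue R R_inf"
    unfolding R_def[abs_def] R_inf_def by (rule riesz_comm_tendsto[OF s q(1) l w_lim])
  have R: "R k \<in> Lp q lebesgue" "R_inf \<in> Lp q lebesgue" for k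
    using R_lim by (auto simp: Lp_tendsto_def)
  define H where "H k x = \<phi> x *\<^sub>R G k x + R k x" for k x
  have hH: "has_frac_grad s q U (\<lambda>x. \<phi> x * w k x) (H k)" for k
    using has_frac_grad_mult[OF s q(1) hG(1) \<phi>U] by (simp add: H_def[abs_def] R_def)
  note H = has_frac_gradD(2)[OF hH]
  have GL: "G k \<in> Lp q lebesgue" "G_inf \<in> Lp q lebesgue" for k
    using has_frac_gradD(2)[OF hG(1)] has_frac_gradD(2)[OF hG(2)] by auto

  \<comment> \<open>Stated for a general A because it is applied both to F k and to F_inf.\<close>
  have split: "(LINT x|lebesgue. \<phi> x * (A x \<bullet> G k x)) = (LINT x|lebesgue. A x \<bullet> H k x) - (LINT x|lebesgue. A x \<bullet> R k x)"
    if A: "A \<in> Lp p lebesgue" for A k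
  proof -
    have "(LINT x|lebesgue. \<phi> x * (A x \<bullet> G k x)) = (LINT x|lebesgue. A x \<bullet> H k x - A x \<bullet> R k x)"
      by (simp add: H_def inner_add_right)
    also have "\<dots> = (LINT x|lebesgue. A x \<bullet> H k x) - (LINT x|lebesgue. A x \<bullet> R k x)"
      using Holder_inner(1)[OF p A] H R q(2) by (intro Bochner_Integration.integral_diff) auto
    finally show ?thesis .
  qed

  obtain B1 where B1: "0 < B1" "\<And>k. Lp_norm q lebesgue (w k) \<le> B1"
    using Lp_tendsto_norm_bounded[OF w_lim q(1)] by metis
  obtain B2 where B2: "0 < B2" "\<And>k. Lp_norm q lebesgue (R k) \<le> B2"
    using Lp_tendsto_norm_bounded[OF R_lim q(1)] by metis
  obtain B3 where B3: "0 < B3" "\<And>k. Lp_norm q (lebesgue_on U) (G k) \<le> B3"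
    using weak_Lp_tendsto_bounded[OF weakG q(1)] by metis
  obtain B4 where B4: "0 < B4" "\<And>k. Lp_norm p lebesgue (F k) \<le> B4"
    using weak_Lp_tendsto_bounded[OF weakF p] by metis

  have n\<phi>w: "Lp_norm q lebesgue (\<lambda>x. \<phi> x * w k x) \<le> M * B1" for k
  proof -
    have "Lp_norm q lebesgue (\<lambda>x. \<phi> x * w k x) \<le> M * Lp_norm q lebesgue (w k)"
      using Lp_mult_bounded(2)[OF has_frac_gradD(1)[OF hG(1)] \<phi>m _ M(2)] q(1) by simp
    also have "\<dots> \<le> M * B1" using B1(2) M(1) by (intro mult_left_mono) auto
    finally show ?thesis .
  qed
  \<comment> \<open>The gradients of w^k are bounded only over U, but the factor
    \<open>\<phi>\<close> vanishes elsewhere, so the global norm is a norm over U.\<close>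
  have n\<phi>G: "Lp_norm q lebesgue (\<lambda>x. \<phi> x *\<^sub>R G k x) \<le> M * B3" for k
  proof -
    have "Lp_norm q lebesgue (\<lambda>x. \<phi> x *\<^sub>R G k x) = Lp_norm q (lebesgue_on U) (\<lambda>x. \<phi> x *\<^sub>R G k x)"
      unfolding Lp_norm_def
      by (subst integral_lebesgue_on_vanishing[OF Ul(1)]) (simp_all add: U0)
    also have "\<dots> \<le> M * Lp_norm q (lebesgue_on U) (G k)"
      using Lp_mult_bounded(2)[OF Lp_lebesgue_on[OF GL(1) Ul(1)] measurable_restrict_space1[OF \<phi>m] _ M(2)] q(1) by simp
    also have "\<dots> \<le> M * B3" using B3(2) M(1) by (intro mult_left_mono) auto
    finally show ?thesis .
  qed
  define B5 where "B5 = 4 * (M * B3 + B2)"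
  have nH: "Lp_norm q lebesgue (H k) \<le> B5" for k
  proof -
    have "Lp_norm q lebesgue (H k) \<le> 4 * (Lp_norm q lebesgue (\<lambda>x. \<phi> x *\<^sub>R G k x) + Lp_norm q lebesgue (R k))"
      unfolding H_def[abs_def]
      using Lp_mult_bounded(1)[OF GL(1) \<phi>m _ M(2)] q(1) R by (intro Lp_add(2)) auto
    also have "\<dots> \<le> B5" using n\<phi>G[of k] B2(2)[of k] by (simp add: B5_def)
    finally show ?thesis .
  qed
  \<comment> \<open>A bound, uniform in k, for the H^{s,q} norm of \<open>\<phi>\<close> w^k,
    assembled from its L^q part and its gradient part.\<close>
  define B where "B = ((M * B1) powr q + B5 powr q) powr (1/q)"
  have "0 < (M * B1) powr q + B5 powr q"
    using M(1) B1(1) by (intro add_pos_nonneg) auto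
  then have B: "0 < B" "B powr q = (M * B1) powr q + B5 powr q"
    using q(1) by (simp_all add: B_def powr_powr)

  define T where "T k v = frac_div s p (F k) v - frac_div s p F_inf v" for k v
  have Hneg: "\<And>k. frac_div s p (F k) \<in> Hneg s p U" "frac_div s p F_inf \<in> Hneg s p U"
    "(\<lambda>k. Hneg_norm s p U (T k)) \<longlonglongrightarrow> 0"
    using assms(13)[unfolded Hneg_loc_tendsto_def, rule_format, of U] U(1,3)
    by (simp_all add: T_def[abs_def])
  have Tbound: "ennreal \<bar>T k (\<lambda>x. \<phi> x * w k x)\<bar> \<le> ennreal B * Hneg_norm s p U (T k)" for k
  proof (rule Hneg_norm_bound[OF s p])
    show "has_frac_grad s (conj_exp p) U (\<lambda>x. \<phi> x * w k x) (H k)"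
      using hH by (simp add: q(2))
    have "(\<lambda>x. \<phi> x * w k x) \<in> Hs0 s (conj_exp p) U"
      using hH by (auto simp: Hs0_def q(2))
    then show "T k (\<lambda>x. c * (\<phi> x * w k x)) = c * T k (\<lambda>x. \<phi> x * w k x)" for c
      using Hneg(1)[of k] Hneg(2) by (simp add: T_def Hneg_def right_diff_distrib)
    show "Lp_norm (conj_exp p) lebesgue (\<lambda>x. \<phi> x * w k x) powr conj_exp p +
        Lp_norm (conj_exp p) lebesgue (H k) powr conj_exp p \<le> B powr conj_exp p"
      unfolding q(2) B(2) using q(1) n\<phi>w nH
      by (intro add_mono powr_mono2) (auto simp: Lp_norm_nonneg)
  qed (rule B(1))
  have "(\<lambda>k. ennreal \<bar>T k (\<lambda>x. \<phi> x * w k x)\<bar>) \<longlonglongrightarrow> 0"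
  proof (rule tendsto_sandwich[OF _ _ tendsto_const])
    have "(\<lambda>k. ennreal B * Hneg_norm s p U (T k)) \<longlonglongrightarrow> ennreal B * 0"
      by (rule ennreal_tendsto_cmult[OF _ Hneg(3)]) simp
    then show "(\<lambda>k. ennreal B * Hneg_norm s p U (T k)) \<longlonglongrightarrow> 0"
      by simp
    show "\<forall>\<^sub>F k in sequentially. ennreal \<bar>T k (\<lambda>x. \<phi> x * w k x)\<bar> \<le> ennreal B * Hneg_norm s p U (T k)"
      by (rule always_eventually) (rule allI, rule Tbound)
  qed simp
  then have "(\<lambda>k. T k (\<lambda>x. \<phi> x * w k x)) \<longlonglongrightarrow> 0"
    by (simp add: ennreal_tendsto_0_iff tendsto_rabs_zero_iff)
  \<comment> \<open>The minus sign in \<open>frac_div\<close> reverses the order of the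
    difference.\<close>
  moreover have "T k (\<lambda>x. \<phi> x * w k x) = (LINT x|lebesgue. F_inf x \<bullet> H k x) - (LINT x|lebesgue. F k x \<bullet> H k x)" for k
    using frac_div_eq[OF s p F(1), of U _ "H k" k] frac_div_eq[OF s p F(2), of U _ "H k"] hH[of k]
    by (simp add: T_def q(2))
  ultimately have lim1: "(\<lambda>k. (LINT x|lebesgue. F_inf x \<bullet> H k x) - (LINT x|lebesgue. F k x \<bullet> H k x)) \<longlonglongrightarrow> 0"
    by simp

  have FR: "(\<lambda>k. LINT x|lebesgue. A x \<bullet> R k x) \<longlonglongrightarrow> (LINT x|lebesgue. A x \<bullet> R_inf x)"
    if "A \<in> Lp p lebesgue" for A
    using Lp_tendsto_integral[OF bounded_bilinear_inner q(1) R_lim, of A] that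
    by (simp add: q(3) inner_commute)
  \<comment> \<open>The weak-strong product: R k is replaced by its fixed limit at a cost controlled
    by the bound on F k. Only then is weak convergence of F k applied.\<close>
  have "(\<lambda>k. LINT x|lebesgue. F k x \<bullet> (R k x - R_inf x)) \<longlonglongrightarrow> 0"
  proof (rule Lim_null_comparison)
    show "\<forall>\<^sub>F k in sequentially. norm (LINT x|lebesgue. F k x \<bullet> (R k x - R_inf x))
        \<le> B4 * Lp_norm q lebesgue (\<lambda>x. R k x - R_inf x)"
    proof (rule always_eventually, rule allI)
      fix k
      have "norm (LINT x|lebesgue. F k x \<bullet> (R k x - R_inf x)) \<le> Lp_norm p lebesgue (F k) * Lp_norm q lebesgue (\<lambda>x. R k x - R_inf x)"
        using Holder_inner(2)[OF p F(1)] Lp_diff(1)[OF R(1) R(2) q(1)] by (simp add: q(2))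
      also have "\<dots> \<le> B4 * Lp_norm q lebesgue (\<lambda>x. R k x - R_inf x)"
        by (intro mult_right_mono B4 Lp_norm_nonneg)
      finally show "norm (LINT x|lebesgue. F k x \<bullet> (R k x - R_inf x)) \<le> B4 * Lp_norm q lebesgue (\<lambda>x. R k x - R_inf x)" .
    qed
    show "(\<lambda>k. B4 * Lp_norm q lebesgue (\<lambda>x. R k x - R_inf x)) \<longlonglongrightarrow> 0"
      using R_lim by (auto simp: Lp_tendsto_def intro: tendsto_mult_right_zero)
  qed
  moreover have "(LINT x|lebesgue. F k x \<bullet> (R k x - R_inf x))
      = (LINT x|lebesgue. F k x \<bullet> R k x) - (LINT x|lebesgue. F k x \<bullet> R_inf x)" for k
    unfolding inner_diff_right
    using Holder_inner(1)[OF p F(1)] R q(2) by (intro Bochner_Integration.integral_diff) auto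
  moreover have "(\<lambda>k. LINT x|lebesgue. F k x \<bullet> R_inf x) \<longlonglongrightarrow> (LINT x|lebesgue. F_inf x \<bullet> R_inf x)"
    using weakF R(2) q(2) by (simp add: weak_Lp_tendsto_def)
  ultimately have "(\<lambda>k. ((LINT x|lebesgue. F k x \<bullet> R k x) - (LINT x|lebesgue. F k x \<bullet> R_inf x))
      + (LINT x|lebesgue. F k x \<bullet> R_inf x)) \<longlonglongrightarrow> 0 + (LINT x|lebesgue. F_inf x \<bullet> R_inf x)"
    by (intro tendsto_add) simp_all
  then have lim2: "(\<lambda>k. LINT x|lebesgue. F k x \<bullet> R k x) \<longlonglongrightarrow> (LINT x|lebesgue. F_inf x \<bullet> R_inf x)"
    by simp

  \<comment> \<open>The fixed function \<open>\<phi>\<close> F_inf is an admissible dual element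
    over U, so weak convergence of the gradients over U is enough.\<close>
  have "(\<lambda>x. \<phi> x *\<^sub>R F_inf x) \<in> Lp (conj_exp q) (lebesgue_on U)"
    using Lp_lebesgue_on[OF Lp_mult_bounded(1)[OF F(2) \<phi>m _ M(2)] Ul(1)] p by (simp add: q(3))
  then have "(\<lambda>k. LINT x|lebesgue_on U. G k x \<bullet> (\<phi> x *\<^sub>R F_inf x)) \<longlonglongrightarrow> (LINT x|lebesgue_on U. G_inf x \<bullet> (\<phi> x *\<^sub>R F_inf x))"
    by (rule weakG[unfolded weak_Lp_tendsto_def, THEN conjunct2, THEN conjunct2, THEN bspec])
  then have lim3: "(\<lambda>k. LINT x|lebesgue. \<phi> x * (F_inf x \<bullet> G k x)) \<longlonglongrightarrow> (LINT x|lebesgue. \<phi> x * (F_inf x \<bullet> G_inf x))"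
    by (simp add: integral_lebesgue_on_vanishing[OF Ul(1)] U0 inner_commute)

  \<comment> \<open>By \<open>split\<close> with A = F_inf the terms with F_inf cancel, leaving the
    pairing of F k with H k minus that with R k. By \<open>split\<close> with A = F k this is the
    sequence in question.\<close>
  have "(\<lambda>k. (LINT x|lebesgue. \<phi> x * (F_inf x \<bullet> G k x)) + (LINT x|lebesgue. F_inf x \<bullet> R k x)
      - ((LINT x|lebesgue. F_inf x \<bullet> H k x) - (LINT x|lebesgue. F k x \<bullet> H k x)) - (LINT x|lebesgue. F k x \<bullet> R k x))
      \<longlonglongrightarrow> (LINT x|lebesgue. \<phi> x * (F_inf x \<bullet> G_inf x)) + (LINT x|lebesgue. F_inf x \<bullet> R_inf x) - 0
      - (LINT x|lebesgue. F_inf x \<bullet> R_inf x)"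
    by (intro tendsto_diff tendsto_add lim1 lim2 lim3 FR F(2))
  then have "(\<lambda>k. LINT x|lebesgue. \<phi> x * (F k x \<bullet> G k x)) \<longlonglongrightarrow> (LINT x|lebesgue. \<phi> x * (F_inf x \<bullet> G_inf x))"
    by (simp add: split F)
  then show "(\<lambda>k. LINT x|lebesgue_on \<Omega>. \<phi> x * (F k x \<bullet> frac_grad s p' (w k) x))
      \<longlonglongrightarrow> (LINT x|lebesgue_on \<Omega>. \<phi> x * (F_inf x \<bullet> frac_grad s p' w_inf x))"
    by (simp add: integral_lebesgue_on_vanishing[OF Ul(2)] \<Omega>0 G_def G_inf_def q_def)
qed

end
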